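(* Let $f:\{0,1\}^n\to\{\pm1\}$ be computable by a decision tree of size $s$, and let $\varepsilon,\delta>0$. There is an algorithm that runs in time $\mathrm{poly}(n^{\log s},1/\varepsilon,\log(1/\delta))$, uses memory $\mathrm{poly}(s,\log n,1/\varepsilon,\log(1/\delta))$, and uses $\mathrm{poly}(s,\log n,1/\varepsilon,\log(1/\delta))$ random samples from $f$, and with probability at least $1-\delta$ returns a decision tree that is an $\varepsilon$-approximation of $f$.
   Context: Size of a decision tree = number of leaves; logarithms base 2. A random sample from $f$ is a pair $(\mathbf{x},f(\mathbf{x}))$ with $\mathbf{x}$ uniform on $\{0,1\}^n$. A tree $T$ is an $\varepsilon$-approximation of $f$ if $\Pr_{\mathbf{x}}[T(\mathbf{x})\ne f(\mathbf{x})]\le\varepsilon$ for uniform $\mathbf{x}$. *)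

theory Defs
  imports "HOL-Probability.Probability" "HOL-Library.Log_Nat"
begin

section \<open>Decision trees\<close>

definition cube :: "nat \<Rightarrow> bool list set" where
  "cube n = {x. length x = n}"

text \<open>In \<open>Node i l r\<close> the left subtree is followed if \<open>x\<^sub>i = 0\<close>, with coordinates numbered from 0.\<close>

datatype dtree = Leaf int | Node nat dtree dtree

fun dtree_on :: "nat \<Rightarrow> dtree \<Rightarrow> bool" where
  "dtree_on n (Leaf y) \<longleftrightarrow> y \<in> {-1, 1}"
| "dtree_on n (Node i l r) \<longleftrightarrow> i < n \<and> dtree_on n l \<and> dtree_on n r"

fun dt_eval :: "dtree \<Rightarrow> bool list \<Rightarrow> int" where
  "dt_eval (Leaf y) x = y"
| "dt_eval (Node i l r) x = (if x ! i then dt_eval r x else dt_eval l x)"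

fun leaves :: "dtree \<Rightarrow> nat" where
  "leaves (Leaf y) = 1"
| "leaves (Node i l r) = leaves l + leaves r"

definition computable_by_size :: "nat \<Rightarrow> (bool list \<Rightarrow> int) \<Rightarrow> nat \<Rightarrow> bool" where
  "computable_by_size n f s \<longleftrightarrow>
     (\<exists>T. dtree_on n T \<and> leaves T = s \<and> (\<forall>x\<in>cube n. dt_eval T x = f x))"

definition approximates :: "nat \<Rightarrow> real \<Rightarrow> dtree \<Rightarrow> (bool list \<Rightarrow> int) \<Rightarrow> bool" where
  "approximates n \<epsilon> T f \<longleftrightarrow>
     measure_pmf.prob (pmf_of_set (cube n)) {x. dt_eval T x \<noteq> f x} \<le> \<epsilon>"

type_synonym sample = "bool list \<times> int"

definition random_sample :: "nat \<Rightarrow> (bool list \<Rightarrow> int) \<Rightarrow> sample pmf" where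
  "random_sample n f = map_pmf (\<lambda>x. (x, f x)) (pmf_of_set (cube n))"

section \<open>Learning algorithms\<close>

text \<open>
  An algorithm is a fixed program for a randomized random access machine.  The memory consists
  of cells holding natural numbers; the operands of instructions are cell addresses (except for
  the constant loaded by \<open>Const\<close>), and \<open>Load\<close> and \<open>Store\<close> address indirectly.  Arithmetic is
  limited to addition and truncated subtraction, so that counting each instruction as one unit
  of time is polynomially equivalent to counting bit operations.

  \<open>Draw\<close> obtains a fresh random sample.  The samples drawn so far are read-only input and can be
  accessed repeatedly: \<open>QueryBit r i j\<close> reads one coordinate of one sample and \<open>QueryLabel r i\<close>
  one label, with label 1 read as 1 and label -1 as 0.  As usual for sublinear space, read-only
  input is not counted as memory: a sample has \<open>n\<close> bits, and memory is measured on
  the scale of \<open>log n\<close>.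
\<close>

datatype instr =
    Const nat nat
  | Add nat nat nat
  | Sub nat nat nat
  | Load nat nat
  | Store nat nat
  | Coin nat
  | Draw
  | QueryBit nat nat nat
  | QueryLabel nat nat

datatype prog =
    Instr instr
  | Seq prog prog
  | If nat prog prog
  | While nat prog

type_synonym mem = "nat \<Rightarrow> nat"

fun exec :: "sample pmf \<Rightarrow> instr \<Rightarrow> mem \<Rightarrow> sample list \<Rightarrow> (mem \<times> sample list) pmf" where
  "exec D (Const r v) m S = return_pmf (m(r := v), S)"
| "exec D (Add r a b) m S = return_pmf (m(r := m a + m b), S)"
| "exec D (Sub r a b) m S = return_pmf (m(r := m a - m b), S)"
| "exec D (Load r a) m S = return_pmf (m(r := m (m a)), S)"
| "exec D (Store a r) m S = return_pmf (m(m a := m r), S)"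
| "exec D (Coin r) m S = map_pmf (\<lambda>b. (m(r := of_bool b), S)) (bernoulli_pmf (1/2))"
| "exec D Draw m S = map_pmf (\<lambda>z. (m, S @ [z])) D"
| "exec D (QueryBit r i j) m S =
     return_pmf (m(r := of_bool (m i < length S \<and> m j < length (fst (S ! m i)) \<and> fst (S ! m i) ! m j)), S)"
| "exec D (QueryLabel r i) m S =
     return_pmf (m(r := of_bool (m i < length S \<and> snd (S ! m i) = 1)), S)"

text \<open>
  A configuration consists of the list of programs still to be executed, the memory and the
  samples drawn.  For a given program only finitely many such lists are reachable, so
  this component plays the role of a program counter.
\<close>

type_synonym config = "prog list \<times> mem \<times> sample list"

fun step :: "sample pmf \<Rightarrow> config \<Rightarrow> config pmf" where
  "step D ([], m, S) = return_pmf ([], m, S)"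
| "step D (Instr i # K, m, S) = map_pmf (\<lambda>(m', S'). (K, m', S')) (exec D i m S)"
| "step D (Seq p q # K, m, S) = return_pmf (p # q # K, m, S)"
| "step D (If r p q # K, m, S) = return_pmf ((if m r \<noteq> 0 then p else q) # K, m, S)"
| "step D (While r p # K, m, S) =
     return_pmf (if m r \<noteq> 0 then p # While r p # K else K, m, S)"

definition steps :: "sample pmf \<Rightarrow> nat \<Rightarrow> config \<Rightarrow> config pmf" where
  "steps D t c = ((\<lambda>M. bind_pmf M (step D)) ^^ t) (return_pmf c)"

text \<open>
  The real parameters are given to the machine as the integers \<open>\<lceil>1/\<epsilon>\<rceil>\<close> and
  \<open>\<lceil>log (1/\<delta>)\<rceil>\<close> (the latter is 0 if \<open>\<delta> \<ge> 1\<close>).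
\<close>

definition initial_mem :: "nat \<Rightarrow> nat \<Rightarrow> real \<Rightarrow> real \<Rightarrow> mem" where
  "initial_mem n s \<epsilon> \<delta> =
     (\<lambda>_. 0)(0 := n, 1 := s, 2 := nat \<lceil>1 / \<epsilon>\<rceil>, 3 := nat \<lceil>log 2 (1 / \<delta>)\<rceil>)"

definition run_for :: "prog \<Rightarrow> nat \<Rightarrow> nat \<Rightarrow> real \<Rightarrow> real \<Rightarrow> (bool list \<Rightarrow> int) \<Rightarrow> nat \<Rightarrow> config pmf" where
  "run_for P n s \<epsilon> \<delta> f t = steps (random_sample n f) t ([P], initial_mem n s \<epsilon> \<delta>, [])"

definition halted :: "config \<Rightarrow> bool" where
  "halted c \<longleftrightarrow> fst c = []"

text \<open>
  Memory in bits: each nonzero cell is charged for its content and for its address.  The sum is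
  over a finite set in every reachable configuration, see \<open>finite_support_steps\<close> below.
\<close>

definition mem_bits :: "mem \<Rightarrow> nat" where
  "mem_bits m = (\<Sum>a | m a \<noteq> 0. floorlog 2 a + floorlog 2 (m a))"

definition memory_used :: "config \<Rightarrow> nat" where
  "memory_used c = mem_bits (fst (snd c))"

definition samples_used :: "config \<Rightarrow> nat" where
  "samples_used c = length (snd (snd c))"

text \<open>
  A tree is returned as its preorder traversal, stored in consecutive cells starting at the
  address held in cell 0.  The code is prefix-free, so at most one tree is returned.
\<close>

fun encode :: "dtree \<Rightarrow> nat list" where
  "encode (Leaf y) = [if y = 1 then 1 else 0]"
| "encode (Node i l r) = (i + 2) # encode l @ encode r"

definition returns :: "nat \<Rightarrow> config \<Rightarrow> dtree \<Rightarrow> bool" where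
  "returns n c T \<longleftrightarrow> halted c \<and> dtree_on n T \<and>
     (let m = fst (snd c) in \<forall>k < length (encode T). m (m 0 + k) = encode T ! k)"

section \<open>Polynomial bounds\<close>

text \<open>
  For nonnegative quantities \<open>xs\<close>, being at most a fixed polynomial in \<open>xs\<close> is the same as being
  at most \<open>C * (1 + \<Sum>xs) ^ k\<close> for fixed \<open>C\<close> and \<open>k\<close>.
\<close>

definition poly_bound :: "nat \<Rightarrow> nat \<Rightarrow> real list \<Rightarrow> real" where
  "poly_bound C k xs = real C * (1 + sum_list xs) ^ k"

text \<open>\<open>log (1/\<delta>)\<close>, cut off at 0 where \<open>\<delta> > 1\<close> would make it negative.\<close>

definition log_inv :: "real \<Rightarrow> real" where
  "log_inv \<delta> = max 0 (log 2 (1 / \<delta>))"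

section \<open>Sanity checks\<close>

lemma finite_support_exec:
  assumes "(m', S') \<in> set_pmf (exec D i m S)" and fin: "finite {a. m a \<noteq> 0}"
  shows "finite {a. m' a \<noteq> 0}"
proof -
  have upd: "finite {a. (m(r := v)) a \<noteq> 0}" for r v
    by (rule finite_subset[of _ "insert r {a. m a \<noteq> 0}"]) (use fin in auto)
  show ?thesis
    using assms(1) fin by (cases i) (auto simp only: exec.simps set_return_pmf set_map_pmf prod.inject singleton_iff image_iff upd)
qed

lemma finite_support_step:
  assumes "c' \<in> set_pmf (step D c)" and "finite {a. fst (snd c) a \<noteq> 0}"
  shows "finite {a. fst (snd c') a \<noteq> 0}"
proof (cases "(D, c)" rule: step.cases)
  case (2 D' i K m S)
  with assms obtain m' S' where "(m', S') \<in> set_pmf (exec D i m S)" "c' = (K, m', S')"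
    by auto
  moreover have "finite {a. m a \<noteq> 0}" using 2 assms by simp
  ultimately show ?thesis using finite_support_exec by simp
qed (use assms in \<open>simp_all\<close>)

lemma finite_support_steps:
  assumes "c \<in> set_pmf (run_for P n s \<epsilon> \<delta> f t)"
  shows "finite {a. fst (snd c) a \<noteq> 0}"
  using assms unfolding run_for_def steps_def
proof (induction t arbitrary: c)
  case 0
  have "finite {a. initial_mem n s \<epsilon> \<delta> a \<noteq> 0}"
    by (rule finite_subset[of _ "{0, 1, 2, 3}"]) (auto simp: initial_mem_def)
  with 0 show ?case by simp
next
  case (Suc t)
  from Suc.prems obtain c' where
    "c' \<in> set_pmf (((\<lambda>M. bind_pmf M (step (random_sample n f))) ^^ t)
              (return_pmf ([P], initial_mem n s \<epsilon> \<delta>, [])))"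
    and c: "c \<in> set_pmf (step (random_sample n f) c')"
    by (auto simp only: funpow.simps comp_apply set_bind_pmf)
  then have "finite {a. fst (snd c') a \<noteq> 0}" by (intro Suc.IH)
  with c show ?case by (rule finite_support_step)
qed

lemma encode_prefix_free:
  assumes "dtree_on n T" "dtree_on n T'" "encode T @ xs = encode T' @ ys"
  shows "T = T' \<and> xs = ys"
  using assms
proof (induction T arbitrary: T' xs ys)
  case (Leaf y)
  then show ?case by (cases T') (auto split: if_splits)
next
  case (Node i l r)
  from Node.prems obtain i' l' r' where T': "T' = Node i' l' r'"
    by (cases T') (auto split: if_splits)
  with Node.prems have eq:
    "encode l @ (encode r @ xs) = encode l' @ (encode r' @ ys)" "dtree_on n l" "dtree_on n r"
    "dtree_on n l'" "dtree_on n r'" "i = i'" by simp_all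
  from Node.IH(1)[OF eq(2,4,1)] have "l = l'" "encode r @ xs = encode r' @ ys" by simp_all
  with Node.IH(2)[OF eq(3,5)] T' eq(6) show ?case by simp
qed

end

theory Submission
  imports Defs
begin

text \<open>
  The learner is the recursive search of Ehrenfeucht and Haussler, truncated at depth
  \<open>d = O(log (s/\<epsilon>))\<close>.  A tree of size at most \<open>2 ^ r\<close> has at its root a child of size at most
  \<open>2 ^ (r - 1)\<close>.  So one looks for a literal such that the search with budget \<open>r - 1\<close> succeeds
  on the subcube where it holds, and then continues with budget \<open>r\<close> on the complementary subcube
  without ever revising this choice; this takes \<open>n ^ O(r) 2 ^ d\<close> calls with \<open>r \<approx> log s\<close>.  A call
  succeeds at depth \<open>d\<close> or when the sample is constant on the subcube.  The tree found is
  consistent with the sample except at its leaves at depth \<open>d\<close>.  Each of these is reached with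
  budget decreasing at most \<open>r\<close> times, so their total mass is at most \<open>2\<^sup>r (3/4)\<^sup>d \<le> \<epsilon>/2\<close>.  The
  remaining error is controlled by a union bound over the trees of depth \<open>d\<close> with leaves labelled
  \<open>-1\<close>, \<open>1\<close> or undecided, whose number has logarithm \<open>poly(s, 1/\<epsilon>) log n\<close>.  The machine only
  stores the current path, and it finds the tree in preorder by repeating the search at each node.
\<close>

section \<open>Truncated search for a decision tree\<close>

text \<open>Truncation serves the sample size as well as the memory. A consistent tree found by the
  full search can have about \<open>n ^ log s\<close> leaves, too many for
  \<open>poly(s, log n)\<close> samples to generalize; at depth \<open>d\<close> the class has at
  most \<open>(N + 3) ^ (2 ^ Suc d)\<close> members. The label of a truncated leaf may contradict
  the sample, so the analysis replaces it by 0 and counts every input reaching it as an error; only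
  the resulting partial tree enters the union bound. The base \<open>3/4\<close> arises by weighing
  a path with \<open>2\<close> to the power of its remaining budget: of two equally likely children
  one halves this weight, and \<open>(1 + 1/2) / 2 = 3/4\<close>. The learner tosses no coins and
  draws all samples in advance, so halting, time and memory are guaranteed on every run, and only
  the accuracy is probabilistic.\<close>

text \<open>A path is a list of entries \<open>(v, b, t)\<close>, deepest first, where \<open>b\<close> is the value of \<open>x\<^sub>v\<close>.  The
  entry is a test, i.e. it decreases the budget, if \<open>b = t\<close>.\<close>

type_synonym entry = "nat \<times> bool \<times> bool"

definition bit_of :: "bool list \<Rightarrow> nat \<Rightarrow> bool" where
  "bit_of x i \<longleftrightarrow> i < length x \<and> x ! i"

definition matches :: "entry list \<Rightarrow> bool list \<Rightarrow> bool" where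
  "matches st x \<longleftrightarrow> (\<forall>(v, b, t)\<in>set st. bit_of x v = b)"

text \<open>Comparing only the top entry suffices, since every lower entry was on top when it was
  entered. Distinct variables on a path make each entry halve the subcube in the measure
  bound.\<close>

fun dup :: "entry list \<Rightarrow> bool" where
  "dup [] \<longleftrightarrow> False"
| "dup ((v, b, t) # st) \<longleftrightarrow> v \<in> fst ` set st"

definition tests :: "entry list \<Rightarrow> nat" where
  "tests st = length (filter (\<lambda>(v, b, t). b = t) st)"

lemma matches_Nil [simp]: "matches [] x"
  by (simp add: matches_def)

lemma matches_Cons [simp]: "matches ((v, b, t) # st) x \<longleftrightarrow> bit_of x v = b \<and> matches st x"
  by (simp add: matches_def)

lemma tests_Nil [simp]: "tests [] = 0"
  by (simp add: tests_def)

lemma tests_Cons [simp]: "tests ((v, b, t) # st) = (if b = t then Suc (tests st) else tests st)"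
  by (simp add: tests_def)

locale search =
  fixes S :: "sample list" and N d R :: nat
begin

definition seen :: "entry list \<Rightarrow> bool \<Rightarrow> bool" where
  "seen st c \<longleftrightarrow> (\<exists>z\<in>set S. matches st (fst z) \<and> (snd z = 1) = c)"

definition pure :: "entry list \<Rightarrow> bool" where
  "pure st \<longleftrightarrow> \<not> (seen st True \<and> seen st False)"

definition label :: "entry list \<Rightarrow> int" where
  "label st = (if seen st True then 1 else -1)"

definition cands :: "nat \<Rightarrow> (nat \<times> bool) list" where
  "cands v = List.product [v..<N] [False, True]"

function ok :: "entry list \<Rightarrow> bool" where
  "ok st =
     (if dup st then False
      else if d \<le> length st \<or> pure st then True
      else if R \<le> tests st then False
      else case List.find (\<lambda>(v, b). ok ((v, b, b) # st)) (cands 0) of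
        None \<Rightarrow> False
      | Some (v, b) \<Rightarrow> ok ((v, \<not> b, b) # st))"
  by pat_completeness auto
termination
  by (relation "Wellfounded.measure (\<lambda>st. d - length st)") auto

declare ok.simps [simp del]

definition first_test :: "entry list \<Rightarrow> (nat \<times> bool) option" where
  "first_test st = List.find (\<lambda>(v, b). ok ((v, b, b) # st)) (cands 0)"

lemma ok_eq:
  "ok st \<longleftrightarrow> \<not> dup st \<and> (d \<le> length st \<or> pure st \<or> tests st < R \<and>
     (case first_test st of None \<Rightarrow> False | Some (v, b) \<Rightarrow> ok ((v, \<not> b, b) # st)))"
  unfolding first_test_def by (subst ok.simps) auto

text \<open>\<open>g\<close> labels the impure leaves at depth \<open>d\<close>:
  \<open>label\<close> gives the output tree, the constant 0 the partial tree that is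
  analysed.\<close>

function build :: "(entry list \<Rightarrow> int) \<Rightarrow> entry list \<Rightarrow> dtree" where
  "build g st =
     (if d \<le> length st \<or> pure st then Leaf (if pure st then label st else g st)
      else case first_test st of
        None \<Rightarrow> Leaf (g st)
      | Some (v, b) \<Rightarrow> Node v (build g ((v, False, b) # st)) (build g ((v, True, b) # st)))"
  by pat_completeness auto
termination
  by (relation "Wellfounded.measure (\<lambda>(g, st). d - length st)") auto

declare build.simps [simp del]

lemma set_cands: "set (cands v) = {v..<N} \<times> UNIV"
  by (auto simp: cands_def)

lemma first_test_Some:
  assumes "first_test st = Some (v, b)"
  shows "v < N" "ok ((v, b, b) # st)" "v \<notin> fst ` set st"
proof -
  show "v < N" and 1: "ok ((v, b, b) # st)"
    using assms set_cands[of 0] unfolding first_test_def find_Some_iff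
    by (auto dest!: nth_mem)
  show "v \<notin> fst ` set st" using 1 by (subst (asm) ok_eq) auto
qed

lemma ok_cases [consumes 1, case_names leaf node]:
  assumes "ok st"
  obtains "d \<le> length st \<or> pure st"
  | v b where "length st < d" "\<not> pure st" "tests st < R" "first_test st = Some (v, b)" "v < N"
      "v \<notin> fst ` set st" "\<And>c. ok ((v, c, b) # st)"
proof (cases "d \<le> length st \<or> pure st")
  case False
  with assms obtain v b where vb: "tests st < R" "first_test st = Some (v, b)"
      "ok ((v, \<not> b, b) # st)"
    by (subst (asm) ok_eq) (auto split: option.splits)
  note 1 = first_test_Some[OF vb(2)]
  have "ok ((v, c, b) # st)" for c using 1(2) vb(3) by (cases "c = b") auto
  with 1 vb False show thesis by (intro that(2)[of v b]) auto
qed (use that in auto)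

lemma build_leaf: "d \<le> length st \<or> pure st \<Longrightarrow>
    build g st = Leaf (if pure st then label st else g st)"
  by (subst build.simps) simp

lemma build_node: "length st < d \<Longrightarrow> \<not> pure st \<Longrightarrow> first_test st = Some (v, b) \<Longrightarrow>
    build g st = Node v (build g ((v, False, b) # st)) (build g ((v, True, b) # st))"
  by (subst build.simps) simp

text \<open>Induction over the nodes of \<open>build\<close>: under \<open>ok st\<close> the search
  supplies a test at every inner node, and both children are again \<open>ok\<close>.\<close>

lemma search_induct [consumes 1, case_names leaf node]:
  assumes "ok st"
    and "\<And>st. ok st \<Longrightarrow> d \<le> length st \<or> pure st \<Longrightarrow> P st"
    and "\<And>st v b. ok st \<Longrightarrow> length st < d \<Longrightarrow> \<not> pure st \<Longrightarrow> tests st < R \<Longrightarrow>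
      first_test st = Some (v, b) \<Longrightarrow> v < N \<Longrightarrow> v \<notin> fst ` set st \<Longrightarrow>
      (\<And>c. ok ((v, c, b) # st)) \<Longrightarrow> (\<And>c. P ((v, c, b) # st)) \<Longrightarrow> P st"
  shows "P st"
  using assms(1)
proof (induction "d - length st" arbitrary: st rule: less_induct)
  case less
  from less.prems show ?case
  proof (cases rule: ok_cases)
    case leaf
    with less.prems show ?thesis by (rule assms(2))
  next
    case (node v b)
    from node less.hyps show ?thesis by (intro assms(3)[OF less.prems]) auto
  qed
qed

text \<open>Whichever test the search picks, the same tree \<open>T\<close> is still available on the other side of it.\<close>

lemma ok_if_small_tree:
  assumes "leaves T \<le> 2 ^ (R - tests st)" "\<not> dup st" "dtree_on N T"
    and "\<And>z. z \<in> set S \<Longrightarrow> matches st (fst z) \<Longrightarrow> dt_eval T (fst z) = snd z"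
    and len: "\<And>z. z \<in> set S \<Longrightarrow> N \<le> length (fst z)"
  shows "ok st"
  using assms(1-4)
proof (induction "d - length st" arbitrary: st T rule: less_induct)
  case (less st T)
  note outer = less.hyps
  show ?case using less.prems
  \<comment> \<open>The inner induction is for a root variable of \<open>T\<close> that already
    occurs on the path: \<open>T\<close> then shrinks to the child that the path selects, while
    \<open>st\<close> stays the same.\<close>
  proof (induction T)
    case (Leaf y)
    have "snd z = y" if "z \<in> set S" "matches st (fst z)" for z
      using Leaf.prems(4)[OF that] by simp
    then have "pure st" unfolding pure_def seen_def by metis
    with Leaf show ?case by (subst ok_eq) simp
  next
    case (Node v l r)
    have ev: "dt_eval (Node v l r) (fst z) = dt_eval (if bit_of (fst z) v then r else l) (fst z)"
      if "z \<in> set S" for z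
      using len[OF that] Node.prems(3) by (auto simp: bit_of_def)
    show ?case
    proof (cases "d \<le> length st \<or> pure st")
      case True
      with Node.prems(2) show ?thesis by (subst ok_eq) blast
    next
      case False
      show ?thesis
      proof (cases "v \<in> fst ` set st")
        case True
        then obtain b t where b: "(v, b, t) \<in> set st" by auto
        then have *: "bit_of (fst z) v = b" if "matches st (fst z)" for z :: sample
          using that by (auto simp: matches_def)
        show ?thesis
        proof (cases b)
          case True
          show ?thesis
            by (rule Node.IH(2)) (use Node.prems True * ev in auto)
        next
          case False
          show ?thesis
            by (rule Node.IH(1)) (use Node.prems False * ev in auto)
        qed
      next
        case fresh: False
        have pos: "leaves T \<ge> 1" for T by (induction T) auto
        \<comment> \<open>Two leaves need an exponent of at least 1, so the budget is not exhausted
          and a test is allowed.\<close>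
        have "2 \<le> leaves (Node v l r)" using pos[of l] pos[of r] by simp
        with Node.prems(1) have "(2::nat) ^ (R - tests st) \<noteq> 1" by linarith
        then obtain j where j: "R - tests st = Suc j" by (cases "R - tests st") auto
        \<comment> \<open>\<open>b\<close> selects a child of \<open>T\<close> with at most
          \<open>2 ^ j\<close> leaves; two larger children would exceed
          \<open>2 ^ Suc j\<close>.\<close>
        define b where "b \<longleftrightarrow> \<not> leaves l \<le> 2 ^ j"
        have "leaves (if b then r else l) \<le> 2 ^ j"
          using Node.prems(1) by (auto simp: b_def j)
        then have "ok ((v, b, b) # st)"
        proof (intro outer[where T = "if b then r else l"])
          show "d - length ((v, b, b) # st) < d - length st"
            using False by (auto intro!: diff_less_mono2)
          show "leaves (if b then r else l) \<le> 2 ^ (R - tests ((v, b, b) # st))"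
            if "leaves (if b then r else l) \<le> 2 ^ j"
          proof -
            have "R - tests ((v, b, b) # st) = j" using j by simp
            with that show ?thesis by simp
          qed
          show "dt_eval (if b then r else l) (fst z) = snd z"
            if "z \<in> set S" "matches ((v, b, b) # st) (fst z)" for z
            using Node.prems(4)[of z] ev[of z] that by simp
        qed (use fresh Node.prems(3) in auto)
        moreover have "(v, b) \<in> set (cands 0)" using Node.prems(3) by (simp add: set_cands)
        ultimately have "first_test st \<noteq> None"
          unfolding first_test_def find_None_iff by auto
        then obtain v' b' where f: "first_test st = Some (v', b')" by auto
        have "ok ((v', \<not> b', b') # st)"
          using Node.prems False first_test_Some[OF f]
          by (intro outer[where T="Node v l r"]) auto
        with f j Node.prems(2) show ?thesis by (subst ok_eq) auto
      qed
    qed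
  qed
qed

lemma length_encode_build:
  "length (encode (build g st)) \<le> 2 ^ Suc (d - length st) - 1"
proof (induction "d - length st" arbitrary: st)
  case 0
  then show ?case by (simp add: build_leaf)
next
  case (Suc k)
  show ?case
  proof (cases "pure st \<or> first_test st = None")
    case True
    then have "length (encode (build g st)) = 1" by (subst build.simps) auto
    moreover have "(2::nat) \<le> 2 ^ Suc (d - length st)" by simp
    ultimately show ?thesis by linarith
  next
    case False
    then obtain v b where f: "first_test st = Some (v, b)" by auto
    have "length (encode (build g ((v, c, b) # st))) \<le> 2 ^ Suc k - 1" for c
    proof -
      have "k = d - length ((v, c, b) # st)" using Suc.hyps(2) by simp
      with Suc.hyps(1)[OF this] show ?thesis by metis
    qed
    from this[of True] this[of False] one_le_power[of "2::nat" k]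
    have "Suc (length (encode (build g ((v, False, b) # st))) + length (encode (build g ((v, True, b) # st))))
        \<le> 2 ^ Suc (Suc k) - 1" by (simp only: power_Suc) linarith
    then show ?thesis
      using False Suc.hyps(2) by (simp add: build_node[OF _ _ f])
  qed
qed

lemma dtree_on_build: "(\<And>st. g st \<in> {-1, 1}) \<Longrightarrow> ok st \<Longrightarrow> dtree_on N (build g st)"
  by (rotate_tac 1, induction rule: search_induct)
     (auto simp: build_leaf build_node label_def)

lemma build_agrees:
  "ok st \<Longrightarrow> dt_eval (build (\<lambda>_. 0) st) x \<noteq> 0 \<Longrightarrow> dt_eval (build g st) x = dt_eval (build (\<lambda>_. 0) st) x"
  by (induction rule: search_induct) (auto simp: build_leaf build_node split: if_splits)

text \<open>An undecided leaf gives 0. At a decided one, \<open>z\<close> itself is among the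
  samples seen, so purity forces the label of the leaf to be that of \<open>z\<close>.\<close>

lemma build_consistent:
  assumes "ok st" "z \<in> set S" "matches st (fst z)" "N \<le> length (fst z)" "snd z \<in> {-1, 1}"
  shows "dt_eval (build (\<lambda>_. 0) st) (fst z) \<in> {0, snd z}"
  using assms(1,3)
proof (induction rule: search_induct)
  case (leaf st)
  have "seen st (snd z = 1)" using assms(2) leaf(3) by (auto simp: seen_def)
  with leaf(2) assms(5) show ?case
    by (cases "snd z = 1") (auto simp: build_leaf label_def pure_def split: if_splits)
next
  case (node st v b)
  have "bit_of (fst z) v = fst z ! v" using node(6) assms(4) by (auto simp: bit_of_def)
  with node show ?case by (auto simp: build_node)
qed

end

section \<open>Counting partial trees and the inputs that reach truncated leaves\<close>

text \<open>The hypothesis class of the union bound. It depends on \<open>N\<close> and the depth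
  only, hence not on the sample; label 0 means undecided.\<close>

fun partial_trees :: "nat \<Rightarrow> nat \<Rightarrow> dtree set" where
  "partial_trees N 0 = Leaf ` {-1, 0, 1}"
| "partial_trees N (Suc k) = Leaf ` {-1, 0, 1} \<union>
     (\<lambda>(i, l, r). Node i l r) ` ({..<N} \<times> partial_trees N k \<times> partial_trees N k)"

lemma Leaf_in_partial_trees: "y \<in> {-1, 0, 1} \<Longrightarrow> Leaf y \<in> partial_trees N k"
  by (cases k) auto

lemma Node_in_partial_trees:
  assumes "i < N" "l \<in> partial_trees N k" "r \<in> partial_trees N k"
  shows "Node i l r \<in> partial_trees N (Suc k)"
  unfolding partial_trees.simps
  by (rule UnI2, rule image_eqI[of _ _ "(i, l, r)"]) (use assms in auto)

text \<open>A full binary tree of depth \<open>k\<close> has \<open>2 ^ Suc k - 1\<close> positions,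
  each filled with one of \<open>N\<close> variables or three labels.\<close>

lemma card_partial_trees:
  "finite (partial_trees N k) \<and> card (partial_trees N k) \<le> (N + 3) ^ (2 ^ Suc k - 1)"
proof (induction k)
  case 0
  have "card (Leaf ` {-1, 0, 1}) \<le> card {-1, 0, 1::int}" by (rule card_image_le) simp
  then show ?case by simp
next
  case (Suc k)
  define q :: nat where "q = 2 ^ Suc k - 1"
  have q: "2 ^ Suc (Suc k) - 1 = Suc (q + q)"
  proof -
    have "q + 1 = 2 ^ Suc k" by (simp add: q_def)
    then have "2 ^ Suc (Suc k) = 2 * (q + 1)" by simp
    then show ?thesis by simp
  qed
  let ?P = "partial_trees N k"
  have fin: "finite ?P" and c: "card ?P \<le> (N + 3) ^ q" using Suc by (auto simp: q_def)
  have 1: "card (Leaf ` {-1, 0, 1}) \<le> 3"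
    by (rule order.trans[OF card_image_le]) simp_all
  have "card ((\<lambda>(i, l, r). Node i l r) ` ({..<N} \<times> ?P \<times> ?P)) \<le> card ({..<N} \<times> ?P \<times> ?P)"
    by (rule card_image_le) (use fin in auto)
  also have "\<dots> = N * (card ?P * card ?P)" by (simp add: card_cartesian_product)
  also have "\<dots> \<le> N * ((N + 3) ^ q * (N + 3) ^ q)" by (intro mult_le_mono le_refl c)
  finally have 2: "card ((\<lambda>(i, l, r). Node i l r) ` ({..<N} \<times> ?P \<times> ?P)) \<le> N * (N + 3) ^ (q + q)"
    by (simp add: power_add)
  have "card (partial_trees N (Suc k)) \<le> 3 + N * (N + 3) ^ (q + q)"
    unfolding partial_trees.simps by (rule order.trans[OF card_Un_le add_mono[OF 1 2]])
  also have "\<dots> \<le> 3 * (N + 3) ^ (q + q) + N * (N + 3) ^ (q + q)" by simp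
  also have "\<dots> = (N + 3) ^ Suc (q + q)" by (simp add: algebra_simps)
  finally show ?case using fin unfolding q by simp
qed

text \<open>Flipping bit \<open>v\<close> exchanges the halves \<open>?A b\<close> and
  \<open>?A (\<not> b)\<close> of the remaining subcube, because \<open>v\<close> is a new
  variable.\<close>

lemma card_matches:
  assumes "distinct (map fst st)" "fst ` set st \<subseteq> {..<n}"
  shows "real (card {x \<in> cube n. matches st x}) = 2 ^ n / 2 ^ length st"
  using assms
proof (induction st)
  case Nil
  have "card (cube n) = 2 ^ n"
    using card_lists_length_eq[of "UNIV :: bool set" n] by (simp add: cube_def)
  then show ?case by simp
next
  case (Cons e st)
  obtain v b t where e: "e = (v, b, t)" by (cases e)
  have v: "v < n" "v \<notin> fst ` set st" using Cons.prems e by auto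
  have finc: "finite (cube n)"
    using finite_lists_length_eq[of "UNIV :: bool set" n] by (simp add: cube_def)
  let ?A = "\<lambda>c. {x \<in> cube n. bit_of x v = c \<and> matches st x}"
  let ?h = "\<lambda>x. x[v := \<not> x ! v]"
  have "bit_of (?h x) w = bit_of x w" if "w \<noteq> v" for w x
    using that by (simp add: bit_of_def)
  moreover have "fst e \<noteq> v" if "e \<in> set st" for e using that v(2) by auto
  ultimately have m: "matches st (?h x) = matches st x" for x
    unfolding matches_def by (intro ball_cong refl) (auto split: prod.splits)
  have "bij_betw ?h (?A b) (?A (\<not> b))"
    by (rule bij_betwI[where g = ?h])
       (use v in \<open>auto simp: cube_def m, auto simp: bit_of_def\<close>)
  then have "card (?A b) = card (?A (\<not> b))" by (rule bij_betw_same_card)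
  moreover have "{x \<in> cube n. matches st x} = ?A b \<union> ?A (\<not> b)" by auto
  moreover have "card (?A b \<union> ?A (\<not> b)) = card (?A b) + card (?A (\<not> b))"
    using finc by (intro card_Un_disjoint) auto
  ultimately have "real (card {x \<in> cube n. matches st x}) = 2 * real (card (?A b))" by simp
  with Cons e show ?case by (simp add: field_simps)
qed

context search
begin

lemma build_in_partial_trees:
  "ok st \<Longrightarrow> build (\<lambda>_. 0) st \<in> partial_trees N (d - length st)"
proof (induction rule: search_induct)
  case (leaf st)
  then show ?case by (auto simp: build_leaf label_def intro!: Leaf_in_partial_trees)
next
  case (node st v b)
  have "d - length st = Suc (d - Suc (length st))" using node(2) by simp
  then show ?case using node(9) unfolding build_node[OF node(2,3,5)]
    by (simp only: length_Cons) (rule Node_in_partial_trees[OF node(6)])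
qed

text \<open>This mass is the probability of at most \<open>R\<close> heads in \<open>d\<close> coin tosses; the bound is
  Markov's inequality for \<open>2\<close> to the power of minus the number of heads.\<close>

lemma card_truncated:
  assumes "ok st" "N \<le> n" "length st \<le> d" "distinct (map fst st)" "fst ` set st \<subseteq> {..<N}"
  shows "real (card {x \<in> cube n. matches st x \<and> dt_eval (build (\<lambda>_. 0) st) x = 0})
    \<le> 2 ^ (R - tests st) * (3/4) ^ (d - length st) * (2 ^ n / 2 ^ length st)"
  using assms(1,3-5)
proof (induction rule: search_induct)
  case (leaf st)
  show ?case
  proof (cases "pure st")
    case True
    then have "{x \<in> cube n. matches st x \<and> dt_eval (build (\<lambda>_. 0) st) x = 0} = {}"
      by (auto simp: build_leaf label_def)
    then show ?thesis by (simp only: card.empty) simp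
  next
    case False
    with leaf have "length st = d" by simp
    have "{x \<in> cube n. matches st x \<and> dt_eval (build (\<lambda>_. 0) st) x = 0} = {x \<in> cube n. matches st x}"
      using leaf(2) False by (auto simp: build_leaf)
    moreover have "fst ` set st \<subseteq> {..<n}" using leaf(5) assms(2) by auto
    ultimately have "real (card {x \<in> cube n. matches st x \<and> dt_eval (build (\<lambda>_. 0) st) x = 0})
        = 1 * (2 ^ n / 2 ^ length st)"
      using card_matches[OF leaf(4)] by simp
    also have "\<dots> \<le> 2 ^ (R - tests st) * (2 ^ n / 2 ^ length st)"
      by (intro mult_right_mono) auto
    finally show ?thesis using \<open>length st = d\<close> by simp
  qed
next
  case (node st v b)
  let ?A = "\<lambda>c. {x \<in> cube n. matches ((v, c, b) # st) x \<and> dt_eval (build (\<lambda>_. 0) ((v, c, b) # st)) x = 0}"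
  obtain k where k: "d - length st = Suc k" "d - Suc (length st) = k"
    using \<open>length st < d\<close> by (cases "d - length st") auto
  obtain j where j: "R - tests st = Suc j" "R - Suc (tests st) = j"
    using \<open>tests st < R\<close> by (cases "R - tests st") auto
  have IH: "real (card (?A c)) \<le>
      2 ^ (R - tests ((v, c, b) # st)) * (3/4) ^ k * (2 ^ n / 2 ^ Suc (length st))" for c
    using node(9)[of c] node k(2) by (auto simp del: matches_Cons tests_Cons)
  have bit: "bit_of x v = x ! v" if "x \<in> cube n" for x
    using that node(6) assms(2) by (auto simp: cube_def bit_of_def)
  have "{x \<in> cube n. matches st x \<and> dt_eval (build (\<lambda>_. 0) st) x = 0} \<subseteq> ?A b \<union> ?A (\<not> b)"
  proof
    fix x
    assume x: "x \<in> {x \<in> cube n. matches st x \<and> dt_eval (build (\<lambda>_. 0) st) x = 0}"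
    then have "dt_eval (build (\<lambda>_. 0) ((v, x ! v, b) # st)) x = 0"
      using build_node[OF node(2,3,5)] by (cases "x ! v") auto
    with x bit have mem: "x \<in> ?A (x ! v)" by auto
    show "x \<in> ?A b \<union> ?A (\<not> b)"
    proof (cases "x ! v = b")
      case True
      show ?thesis using mem unfolding True by (rule UnI1)
    next
      case False
      then have "x ! v = (\<not> b)" by auto
      show ?thesis using mem unfolding \<open>x ! v = (\<not> b)\<close> by (rule UnI2)
    qed
  qed
  moreover have "finite (?A c)" for c
    using finite_lists_length_eq[of "UNIV :: bool set" n] by (simp add: cube_def)
  ultimately have "card {x \<in> cube n. matches st x \<and> dt_eval (build (\<lambda>_. 0) st) x = 0} \<le> card (?A b) + card (?A (\<not> b))"
    by (intro order.trans[OF card_mono card_Un_le]) auto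
  then have "real (card {x \<in> cube n. matches st x \<and> dt_eval (build (\<lambda>_. 0) st) x = 0})
      \<le> real (card (?A b)) + real (card (?A (\<not> b)))" by linarith
  also have "\<dots> \<le> 2 ^ j * (3/4) ^ k * (2 ^ n / 2 ^ Suc (length st))
      + 2 ^ Suc j * (3/4) ^ k * (2 ^ n / 2 ^ Suc (length st))"
    using IH[of b] IH[of "\<not> b"] by (intro add_mono) (simp_all add: j)
  \<comment> \<open>Each side has half of the mass, and the test side half of the weight
    \<open>2 ^ Suc j\<close>; hence the factor \<open>3/4 = (1 + 1/2) / 2\<close>.\<close>
  also have "\<dots> = 2 ^ Suc j * (3/4) ^ Suc k * (2 ^ n / 2 ^ length st)"
    by (simp add: field_simps)
  finally show ?case by (simp only: j k)
qed

end

section \<open>The search as a stack machine\<close>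

datatype mode = Enter | Ret bool | Done

type_synonym state = "entry list \<times> nat \<times> nat list \<times> mode"

context search
begin

text \<open>Used with increasing \<open>v\<close> and the literal \<open>False\<close> first, so
  candidates come in the order of \<open>cands\<close> and the one found is
  \<open>first_test\<close>.\<close>

definition attempt :: "nat \<Rightarrow> entry list \<Rightarrow> nat \<Rightarrow> nat list \<Rightarrow> state" where
  "attempt v st B out =
     (if v < N then ((v, False, False) # st, B, out, Enter) else (st, B, out, Ret False))"

text \<open>The lowest \<open>B\<close> entries of the stack are the path to the node of the output tree that is
  being built, the entries above belong to the search for the variable at this node.  Once the
  search succeeds with a single test entry above \<open>B\<close>, this entry becomes part of the path.
  On the path, bit \<open>False\<close> means that the right subtree is still to be built.\<close>

fun move :: "state \<Rightarrow> state" where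
  "move (st, B, out, Done) = (st, B, out, Done)"
| "move (st, B, out, Enter) =
     (if dup st then (st, B, out, Ret False)
      else if length st = d \<or> pure st then
        (st, B, if length st = B then out @ [of_bool (seen st True)] else out, Ret True)
      else if R \<le> tests st then (st, B, out, Ret False)
      else attempt 0 st B out)"
| "move (st, B, out, Ret False) =
     (case st of
        [] \<Rightarrow> (st, B, out, Done)
      | (v, b, t) # st' \<Rightarrow>
          if b \<noteq> t then (st', B, out, Ret False)
          else if \<not> t then ((v, True, True) # st', B, out, Enter)
          else attempt (Suc v) st' B out)"
| "move (st, B, out, Ret True) =
     (case st of
        [] \<Rightarrow> (st, B, out, Done)
      | (v, b, t) # st' \<Rightarrow>
          if length st = B then
            (if b then (st', B - 1, out, Ret True) else ((v, True, t) # st', B, out, Enter))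
          else if b \<noteq> t then (st', B, out, Ret True)
          else if length st = Suc B then ((v, False, t) # st', Suc B, out @ [v + 2], Enter)
          else ((v, \<not> b, t) # st', B, out, Enter))"

section \<open>Number of moves of the stack machine\<close>

definition reach :: "nat \<Rightarrow> state \<Rightarrow> state \<Rightarrow> bool" where
  "reach k a a' \<longleftrightarrow> (\<exists>i\<le>k. (move ^^ i) a = a')"

lemma reach_refl: "reach k a a"
  unfolding reach_def by (intro exI[of _ 0]) auto

lemma reach_step: "reach k (move a) a' \<Longrightarrow> reach (Suc k) a a'"
  unfolding reach_def by (elim exE conjE) (rule exI[of _ "Suc i" for i], simp add: funpow_swap1)

lemma reach_trans: "reach k a b \<Longrightarrow> reach l b c \<Longrightarrow> reach (k + l) a c"
  unfolding reach_def
proof (elim exE conjE)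
  fix i j
  assume "i \<le> k" "(move ^^ i) a = b" "j \<le> l" "(move ^^ j) b = c"
  then show "\<exists>i\<le>k + l. (move ^^ i) a = c"
    by (intro exI[of _ "j + i"]) (simp add: funpow_add)
qed

lemma reach_mono: "reach k a b \<Longrightarrow> k \<le> l \<Longrightarrow> reach l a b"
  unfolding reach_def using order_trans by blast

lemma reach_move: "move a = a' \<Longrightarrow> reach 1 a a'"
  unfolding One_nat_def by (rule reach_step) (simp add: reach_refl)

lemma cands_Cons: "v < N \<Longrightarrow> cands v = (v, False) # (v, True) # cands (Suc v)"
  by (simp add: cands_def upt_conv_Cons)

lemma cands_Nil: "N \<le> v \<Longrightarrow> cands v = []"
  by (simp add: cands_def)

text \<open>Each variable gives two literals, and each costs a test of at most \<open>\<tau>\<close>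
  moves and one move to the next candidate.\<close>

lemma reach_search:
  assumes test: "\<And>v b. v < N \<Longrightarrow> reach \<tau> ((v, b, b) # st, B, out, Enter)
      ((v, b, b) # st, B, out, Ret (ok ((v, b, b) # st)))"
    and B: "B \<le> length st"
  shows "reach (2 * (N - v) * Suc \<tau>) (attempt v st B out)
     (case List.find (\<lambda>(v, b). ok ((v, b, b) # st)) (cands v) of
        None \<Rightarrow> (st, B, out, Ret False)
      | Some (v, b) \<Rightarrow> ((v, b, b) # st, B, out, Ret True))"
proof (induction "N - v" arbitrary: v)
  case 0
  then show ?case by (simp add: cands_Nil attempt_def reach_refl)
next
  case (Suc k)
  then have v: "v < N" and k: "k = N - Suc v" by auto
  let ?f = "\<lambda>v. case List.find (\<lambda>(v, b). ok ((v, b, b) # st)) (cands v) of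
        None \<Rightarrow> (st, B, out, Ret False)
      | Some (v, b) \<Rightarrow> ((v, b, b) # st, B, out, Ret True)"
  have 1: "attempt v st B out = ((v, False, False) # st, B, out, Enter)"
    using v by (simp add: attempt_def)
  show ?case
  proof (cases "ok ((v, False, False) # st)")
    case True
    have "1 * \<tau> \<le> 2 * (N - v) * Suc \<tau>" by (rule mult_le_mono) (use v in auto)
    with test[OF v, of False] True show ?thesis unfolding 1
      by (simp add: cands_Cons[OF v]) (erule reach_mono, simp)
  next
    case False
    note f1 = this
    have "reach \<tau> ((v, False, False) # st, B, out, Enter) ((v, False, False) # st, B, out, Ret False)"
      using test[OF v, of False] False by simp
    moreover have "reach 1 ((v, False, False) # st, B, out, Ret False) ((v, True, True) # st, B, out, Enter)"
      by (intro reach_move) simp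
    ultimately have "reach (\<tau> + 1 + \<tau>) ((v, False, False) # st, B, out, Enter)
        ((v, True, True) # st, B, out, Ret (ok ((v, True, True) # st)))"
      using test[OF v, of True] by (intro reach_trans)
    moreover have "reach (1 + 2 * k * Suc \<tau>)
        ((v, True, True) # st, B, out, Ret (ok ((v, True, True) # st))) (?f v)"
    proof (cases "ok ((v, True, True) # st)")
      case True
      with f1 show ?thesis by (simp add: cands_Cons[OF v] reach_refl)
    next
      case False
      with f1 Suc.hyps(1)[OF k] k show ?thesis
        by (simp add: cands_Cons[OF v] reach_step)
    qed
    ultimately have "reach (\<tau> + 1 + \<tau> + (1 + 2 * k * Suc \<tau>)) (attempt v st B out) (?f v)"
      unfolding 1 by (rule reach_trans)
    moreover have "\<tau> + 1 + \<tau> + (1 + 2 * k * Suc \<tau>) = 2 * Suc k * Suc \<tau>" by simp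
    ultimately show ?thesis using Suc.hyps(2) by simp
  qed
qed

text \<open>Solves the recurrence of \<open>ok_time_Suc\<close>: \<open>j\<close> is the remaining
  budget, \<open>k\<close> the remaining depth. The \<open>2 * N\<close> tests with budget
  \<open>j\<close> cost at most \<open>ok_time (Suc j) k\<close>, so each further level at most
  doubles the total.\<close>

definition ok_time :: "nat \<Rightarrow> nat \<Rightarrow> nat" where
  "ok_time j k = (4 * N + 3) ^ j * 2 ^ k"

lemma ok_time_pos: "1 \<le> ok_time j k"
  by (simp add: ok_time_def)

lemma ok_time_Suc:
  "3 + 2 * N * Suc (ok_time j k) + ok_time (Suc j) k \<le> ok_time (Suc j) (Suc k)"
proof -
  have "3 + 2 * N * Suc (ok_time j k) \<le> (4 * N + 3) * ok_time j k"
    using ok_time_pos[of j k] by (cases "ok_time j k") (auto simp: algebra_simps)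
  then show ?thesis by (simp add: ok_time_def algebra_simps)
qed

lemma ok_time_mono: "j \<le> j' \<Longrightarrow> k \<le> k' \<Longrightarrow> ok_time j k \<le> ok_time j' k'"
  unfolding ok_time_def by (intro mult_le_mono power_increasing) auto

text \<open>The assumption \<open>B < length st\<close> keeps the search strictly above the output
  path, so \<open>B\<close> and \<open>out\<close> come back unchanged.\<close>

lemma reach_ok:
  assumes "B < length st" "length st \<le> d"
  shows "reach (ok_time (R - tests st) (d - length st)) (st, B, out, Enter) (st, B, out, Ret (ok st))"
  using assms
proof (induction "d - length st" arbitrary: st rule: less_induct)
  case (less st)
  note pos = ok_time_pos[of "R - tests st" "d - length st"]
  show ?case
  proof (cases "dup st \<or> length st = d \<or> pure st \<or> R \<le> tests st")
    case True
    then have "move (st, B, out, Enter) = (st, B, out, Ret (\<not> dup st \<and> (length st = d \<or> pure st)))"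
      using less.prems by (cases "dup st"; cases "length st = d"; cases "pure st") simp_all
    moreover have "ok st = (\<not> dup st \<and> (length st = d \<or> pure st))"
      using True less.prems
      by (cases "dup st"; cases "length st = d"; cases "pure st") (simp_all add: ok_eq[of st])
    ultimately have "reach 1 (st, B, out, Enter) (st, B, out, Ret (ok st))"
      by (intro reach_move) simp
    with pos show ?thesis by (blast intro: reach_mono)
  next
    case False
    obtain k where k: "d - length st = Suc k" "d - Suc (length st) = k"
      using False less.prems by (cases "d - length st") auto
    obtain j where j: "R - tests st = Suc j" "R - Suc (tests st) = j"
      using False by (cases "R - tests st") auto
    have first: "move (st, B, out, Enter) = attempt 0 st B out"
      using False by simp
    have search: "reach (2 * N * Suc (ok_time j k)) (attempt 0 st B out)
     (case first_test st of
        None \<Rightarrow> (st, B, out, Ret False)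
      | Some (v, b) \<Rightarrow> ((v, b, b) # st, B, out, Ret True))"
    proof -
      have "reach (ok_time j k) ((v, b, b) # st, B, out, Enter)
         ((v, b, b) # st, B, out, Ret (ok ((v, b, b) # st)))" for v b
        using less.hyps[of "(v, b, b) # st"] less.prems k j False by simp
      from reach_search[OF this, where v = 0] less.prems show ?thesis
        by (simp add: first_test_def)
    qed
    show ?thesis
    proof (cases "first_test st")
      case None
      then have "\<not> ok st" using False less.prems by (subst ok_eq) auto
      have "reach (Suc (2 * N * Suc (ok_time j k))) (st, B, out, Enter) (st, B, out, Ret (ok st))"
        by (rule reach_step) (use search None \<open>\<not> ok st\<close> first in simp)
      then show ?thesis by (rule reach_mono) (use ok_time_Suc[of j k] in \<open>simp add: j k\<close>)
    next
      case (Some vb)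
      obtain v b where vb: "first_test st = Some (v, b)" using Some by (cases vb) auto
      let ?st = "(v, \<not> b, b) # st"
      have eq: "ok st = ok ?st" using vb False less.prems by (subst ok_eq) auto
      have "reach 1 ((v, b, b) # st, B, out, Ret True) (?st, B, out, Enter)"
        using less.prems by (intro reach_move) simp
      moreover have "reach (ok_time (Suc j) k) (?st, B, out, Enter) (?st, B, out, Ret (ok ?st))"
        using less.hyps[of ?st] less.prems k j False by simp
      moreover have "reach 1 (?st, B, out, Ret (ok ?st)) (st, B, out, Ret (ok ?st))"
        using less.prems by (cases "ok ?st") (auto intro!: reach_step simp: reach_refl)
      ultimately have "reach (1 + ok_time (Suc j) k + 1) ((v, b, b) # st, B, out, Ret True) (st, B, out, Ret (ok st))"
        unfolding eq by (intro reach_trans)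
      moreover have "reach (2 * N * Suc (ok_time j k)) (attempt 0 st B out) ((v, b, b) # st, B, out, Ret True)"
        using search vb by simp
      ultimately have "reach (2 * N * Suc (ok_time j k) + (1 + ok_time (Suc j) k + 1))
          (attempt 0 st B out) (st, B, out, Ret (ok st))"
        by (rule reach_trans[rotated])
      then have "reach (Suc (2 * N * Suc (ok_time j k) + (1 + ok_time (Suc j) k + 1)))
          (st, B, out, Enter) (st, B, out, Ret (ok st))"
        unfolding first[symmetric] by (rule reach_step)
      then show ?thesis by (rule reach_mono) (use ok_time_Suc[of j k] in \<open>simp add: j k\<close>)
    qed
  qed
qed

text \<open>The 4 counts the move that starts the search at a node and the three that commit to its
  test, turn to the right subtree and leave the node.\<close>

definition node_time :: nat where
  "node_time = 4 + 2 * N * Suc (ok_time R d)"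

text \<open>A tree of height \<open>d - length st\<close> has at most
  \<open>2 ^ Suc (d - length st) - 1\<close> nodes, and each pays for one search. Inside the
  subtrees \<open>B\<close> grows with the path, and leaving them restores it.\<close>

lemma reach_build:
  assumes "ok st" "B = length st" "length st \<le> d"
  shows "reach ((2 ^ Suc (d - length st) - 1) * node_time) (st, B, out, Enter)
    (st, B, out @ encode (build label st), Ret True)"
  using assms
proof (induction arbitrary: B out rule: search_induct)
  case (leaf st)
  from leaf(1) have "\<not> dup st" by (subst (asm) ok_eq) simp
  moreover have "length st = d \<or> pure st" using leaf(2,4) by auto
  moreover have "encode (build label st) = [of_bool (seen st True)]"
    by (simp add: build_leaf[OF leaf(2)] label_def)
  ultimately have "reach 1 (st, B, out, Enter) (st, B, out @ encode (build label st), Ret True)"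
    using leaf(3) by (intro reach_move) simp
  moreover have "1 * 1 \<le> (2 ^ Suc (d - length st) - 1) * node_time"
  proof (rule mult_le_mono)
    have "(2::nat) \<le> 2 ^ Suc (d - length st)" by simp
    then show "1 \<le> 2 ^ Suc (d - length st) - (1::nat)" by linarith
  qed (simp add: node_time_def)
  ultimately show ?case unfolding mult_1 by (rule reach_mono)
next
  case (node st v b)
  obtain k where k: "d - length st = Suc k" "d - Suc (length st) = k"
    using node(2) by (cases "d - length st") auto
  define q :: nat where "q = (2 ^ Suc k - 1) * node_time"
  have "\<not> dup st" using node(1) by (subst (asm) ok_eq) simp
  with node(2-4) have first: "move (st, B, out, Enter) = attempt 0 st B out" by simp
  have "reach (ok_time R d) ((v, b, b) # st, B, out, Enter)
      ((v, b, b) # st, B, out, Ret (ok ((v, b, b) # st)))" for v b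
    using node(2,10) by (intro reach_mono[OF reach_ok ok_time_mono]) auto
  from reach_search[OF this, where v = 0] node(5,10)
  have search: "reach (2 * N * Suc (ok_time R d)) (attempt 0 st B out) ((v, b, b) # st, B, out, Ret True)"
    by (simp add: first_test_def)
  have s1: "reach 1 ((v, b, b) # st, B, out, Ret True) ((v, False, b) # st, Suc B, out @ [v + 2], Enter)"
    using node(10) by (intro reach_move) simp
  have s2: "reach q ((v, False, b) # st, Suc B, out @ [v + 2], Enter)
      ((v, False, b) # st, Suc B, (out @ [v + 2]) @ encode (build label ((v, False, b) # st)), Ret True)"
    using node(9)[of "Suc B" False "out @ [v + 2]"]
      node(2,10) k by (simp add: q_def)
  have s3: "reach 1 ((v, False, b) # st, Suc B, (out @ [v + 2]) @ encode (build label ((v, False, b) # st)), Ret True)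
      ((v, True, b) # st, Suc B, (out @ [v + 2]) @ encode (build label ((v, False, b) # st)), Enter)"
    using node(10) by (intro reach_move) simp
  have s4: "reach q ((v, True, b) # st, Suc B, (out @ [v + 2]) @ encode (build label ((v, False, b) # st)), Enter)
      ((v, True, b) # st, Suc B, ((out @ [v + 2]) @ encode (build label ((v, False, b) # st))) @
         encode (build label ((v, True, b) # st)), Ret True)"
    using node(9)[of "Suc B" True "(out @ [v + 2]) @ encode (build label ((v, False, b) # st))"] node(2,10) k
    by (simp add: q_def)
  have s5: "reach 1 ((v, True, b) # st, Suc B, ((out @ [v + 2]) @ encode (build label ((v, False, b) # st))) @
         encode (build label ((v, True, b) # st)), Ret True)
      (st, B, out @ encode (build label st), Ret True)"
    using node(10) build_node[OF node(2,3,5), of label] by (intro reach_move) simp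
  have "reach (2 * N * Suc (ok_time R d) + (1 + q + 1 + q + 1)) (attempt 0 st B out)
      (st, B, out @ encode (build label st), Ret True)"
    by (rule reach_trans[OF search reach_trans[OF reach_trans[OF reach_trans[OF reach_trans[OF s1 s2] s3] s4] s5]])
  then have "reach (Suc (2 * N * Suc (ok_time R d) + (1 + q + 1 + q + 1))) (st, B, out, Enter)
      (st, B, out @ encode (build label st), Ret True)"
    unfolding first[symmetric] by (rule reach_step)
  moreover have "Suc (2 * N * Suc (ok_time R d) + (1 + q + 1 + q + 1)) = node_time + 2 * q"
    by (simp add: node_time_def)
  moreover have "node_time + 2 * q = (2 ^ Suc (Suc k) - 1) * node_time"
  proof -
    have "2 ^ Suc (Suc k) - 1 = Suc (2 * (2 ^ Suc k - 1 :: nat))"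
      using one_le_power[of "2::nat" k] by (simp only: power_Suc) linarith
    then show ?thesis unfolding q_def by (simp only: mult_Suc mult.assoc)
  qed
  ultimately show ?case by (simp only: k)
qed

lemma reach_tree:
  assumes "ok []"
  shows "reach (2 ^ Suc d * node_time) ([], 0, [], Enter) ([], 0, encode (build label []), Done)"
proof -
  have "reach ((2 ^ Suc d - 1) * node_time) ([], 0, [], Enter) ([], 0, encode (build label []), Ret True)"
    using reach_build[of "[]" 0 "[]"] assms by simp
  moreover have "reach 1 ([], 0, encode (build label []), Ret True) ([], 0, encode (build label []), Done)"
    by (intro reach_move) simp
  ultimately have "reach ((2 ^ Suc d - 1) * node_time + 1) ([], 0, [], Enter) ([], 0, encode (build label []), Done)"
    by (rule reach_trans)
  then show ?thesis
  proof (rule reach_mono)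
    obtain c where "(2::nat) ^ Suc d = Suc c" by (cases "(2::nat) ^ Suc d") auto
    then show "(2 ^ Suc d - 1) * node_time + 1 \<le> 2 ^ Suc d * node_time"
      by (simp add: node_time_def)
  qed
qed

section \<open>Invariants of the moves\<close>

fun proper :: "state \<Rightarrow> bool" where
  "proper (st, B, out, mode) \<longleftrightarrow> (\<forall>e\<in>set st. fst e < N) \<and> length st \<le> d \<and> B \<le> d"

definition written :: "state \<Rightarrow> nat list" where
  "written a = fst (snd (snd a))"

definition mode_of :: "state \<Rightarrow> mode" where
  "mode_of a = snd (snd (snd a))"

lemma proper_attempt:
  "\<forall>e\<in>set st. fst e < N \<Longrightarrow> length st < d \<Longrightarrow> B \<le> d \<Longrightarrow> proper (attempt v st B out)"
  by (simp add: attempt_def)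

lemma proper_move:
  assumes "proper a"
  shows "proper (move a)"
proof (cases a rule: move.cases)
  case (2 st B out)
  with assms show ?thesis by (simp add: proper_attempt le_neq_implies_less)
next
  case (3 st B out)
  with assms show ?thesis by (cases st; cases "hd st") (auto simp: proper_attempt)
next
  case (4 st B out)
  with assms show ?thesis by (cases st; cases "hd st") auto
qed (use assms in simp)

lemma written_move: "length (written a) \<le> length (written (move a))"
  by (cases a rule: move.cases) (auto simp: attempt_def written_def split: list.splits prod.splits)

text \<open>A bound on the length of the final output thus holds at all earlier moves; this keeps
  the machine within the cells reserved for the output.\<close>

lemma written_funpow: "length (written a) \<le> length (written ((move ^^ i) a))"
  by (induction i) (auto intro: order.trans written_move)

lemma move_Done: "mode_of a = Done \<Longrightarrow> (move ^^ i) a = a"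
proof (induction i)
  case (Suc i)
  obtain st B out mode where "a = (st, B, out, mode)" by (cases a)
  with Suc show ?case by (simp add: mode_of_def)
qed simp

end

section \<open>Reasoning about programs\<close>

text \<open>A bounded until operator over all outcomes of positive probability: \<open>Q\<close>
  within \<open>t\<close> steps, and \<open>J\<close> at every configuration before. Time and memory
  bounds derived from it are therefore sure.\<close>

fun attains :: "sample pmf \<Rightarrow> (config \<Rightarrow> bool) \<Rightarrow> nat \<Rightarrow> (config \<Rightarrow> bool) \<Rightarrow> config \<Rightarrow> bool" where
  "attains D J 0 Q c \<longleftrightarrow> Q c"
| "attains D J (Suc t) Q c \<longleftrightarrow> Q c \<or> J c \<and> (\<forall>c'\<in>set_pmf (step D c). attains D J t Q c')"

lemma attains_now: "Q c \<Longrightarrow> attains D J t Q c"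
  by (cases t) auto

lemma attains_mono: "attains D J t Q c \<Longrightarrow> t \<le> t' \<Longrightarrow> attains D J t' Q c"
proof (induction t arbitrary: t' c)
  case (Suc t)
  then obtain u where "t' = Suc u" "t \<le> u" by (cases t') auto
  with Suc show ?case by auto
qed (auto intro: attains_now)

lemma attains_trans:
  "attains D J t Q c \<Longrightarrow> (\<And>c. Q c \<Longrightarrow> attains D J u Q' c) \<Longrightarrow> attains D J (t + u) Q' c"
proof (induction t arbitrary: c)
  case (Suc t)
  show ?case
  proof (cases "Q c")
    case True
    then show ?thesis by (intro attains_mono[OF Suc.prems(2)]) auto
  next
    case False
    with Suc show ?thesis by auto
  qed
qed auto

definition bounded_mem :: "nat \<Rightarrow> nat \<Rightarrow> mem \<Rightarrow> bool" where
  "bounded_mem A V m \<longleftrightarrow> (\<forall>a. m a \<le> V \<and> (A \<le> a \<longrightarrow> m a = 0))"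

lemma bounded_mem_upd: "bounded_mem A V m \<Longrightarrow> r < A \<Longrightarrow> v \<le> V \<Longrightarrow> bounded_mem A V (m(r := v))"
  by (auto simp: bounded_mem_def)

lemma mem_bits_le:
  assumes "bounded_mem A V m"
  shows "mem_bits m \<le> A * (floorlog 2 A + floorlog 2 V)"
proof -
  have sub: "{a. m a \<noteq> 0} \<subseteq> {..<A}"
    using assms by (auto simp: bounded_mem_def not_less[symmetric])
  have "mem_bits m \<le> (\<Sum>a | m a \<noteq> 0. floorlog 2 A + floorlog 2 V)"
    unfolding mem_bits_def
    by (intro sum_mono add_mono floorlog_mono)
       (use sub assms in \<open>auto simp: bounded_mem_def intro: less_imp_le\<close>)
  also have "\<dots> = card {a. m a \<noteq> 0} * (floorlog 2 A + floorlog 2 V)" by simp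
  also have "\<dots> \<le> A * (floorlog 2 A + floorlog 2 V)"
    using card_mono[OF _ sub] by (intro mult_le_mono) auto
  finally show ?thesis .
qed

section \<open>Hoare triples with time and memory bounds\<close>

text \<open>\<open>A\<close>, \<open>V\<close> and \<open>M\<close> are to bound the addresses in
  use, the cell contents and the number of samples at every moment of a run.\<close>

locale machine =
  fixes D :: "sample pmf" and A V M :: nat
  assumes A: "32 \<le> A" and AV: "A \<le> V"
begin

lemma reg_bounds [simp]:
  "0 < A" "Suc 0 < A" "numeral k < (32::nat) \<Longrightarrow> numeral k < A"
  "Suc 0 \<le> V" "numeral k \<le> (32::nat) \<Longrightarrow> numeral k \<le> V"
  using A AV order.strict_trans2[OF _ A] order.trans[OF order.trans[OF _ A] AV] by (simp, simp, blast, simp, blast)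

definition good :: "mem \<Rightarrow> sample list \<Rightarrow> bool" where
  "good m S \<longleftrightarrow> bounded_mem A V m \<and> length S \<le> M"

definition good_config :: "config \<Rightarrow> bool" where
  "good_config = (\<lambda>(K, m, S). good m S)"

definition reached :: "prog list \<Rightarrow> (mem \<Rightarrow> sample list \<Rightarrow> bool) \<Rightarrow> config \<Rightarrow> bool" where
  "reached K Q c \<longleftrightarrow> fst c = K \<and> good (fst (snd c)) (snd (snd c)) \<and> Q (fst (snd c)) (snd (snd c))"

text \<open>Total correctness with a time bound. Quantifying over the rest \<open>K\<close> of the
  program makes triples compose, and \<open>good_config\<close> controls the intermediate
  configurations.\<close>

definition triple ::
    "(mem \<Rightarrow> sample list \<Rightarrow> bool) \<Rightarrow> prog \<Rightarrow> nat \<Rightarrow> (mem \<Rightarrow> sample list \<Rightarrow> bool) \<Rightarrow> bool" where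
  "triple P p t Q \<longleftrightarrow> (\<forall>K m S. good m S \<longrightarrow> P m S \<longrightarrow>
     attains D good_config t (reached K Q) (p # K, m, S))"

lemma tripleI:
  "(\<And>K m S. good m S \<Longrightarrow> P m S \<Longrightarrow>
     attains D good_config t (reached K Q) (p # K, m, S)) \<Longrightarrow>
   triple P p t Q"
  by (simp add: triple_def)

lemma tripleD:
  "triple P p t Q \<Longrightarrow> good m S \<Longrightarrow> P m S \<Longrightarrow>
     attains D good_config t (reached K Q) (p # K, m, S)"
  by (simp add: triple_def)

lemma reached_trans:
  assumes "attains D good_config t (reached K Q) c"
    and "\<And>m S. good m S \<Longrightarrow> Q m S \<Longrightarrow> attains D good_config u Q' (K, m, S)"
  shows "attains D good_config (t + u) Q' c"
  by (rule attains_trans[OF assms(1)]) (auto simp: reached_def intro: assms(2))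

lemma triple_mono:
  assumes "triple P p t Q" "t \<le> t'" "\<And>m S. good m S \<Longrightarrow> P' m S \<Longrightarrow> P m S" "\<And>m S. Q m S \<Longrightarrow> Q' m S"
  shows "triple P' p t' Q'"
proof (rule tripleI)
  fix K m S assume *: "good m S" "P' m S"
  have "attains D good_config (t + 0) (reached K Q') (p # K, m, S)"
    by (rule reached_trans[OF tripleD[OF assms(1) *(1) assms(3)[OF *]]])
       (simp add: reached_def assms(4))
  then show "attains D good_config t' (reached K Q') (p # K, m, S)"
    by (rule attains_mono) (use assms(2) in simp)
qed

lemma triple_Seq:
  assumes "triple P p t Q" "triple Q q u R"
  shows "triple P (Seq p q) (Suc (t + u)) R"
proof (rule tripleI)
  fix K m S assume *: "good m S" "P m S"
  have "attains D good_config (t + u) (reached K R) (p # q # K, m, S)"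
    by (rule reached_trans[OF tripleD[OF assms(1) *]]) (rule tripleD[OF assms(2)])
  with * show "attains D good_config (Suc (t + u)) (reached K R) (Seq p q # K, m, S)"
    by (simp add: good_config_def)
qed

lemma triple_If:
  assumes "triple (\<lambda>m S. P m S \<and> m r \<noteq> 0) p t Q" "triple (\<lambda>m S. P m S \<and> m r = 0) q u Q"
  shows "triple P (If r p q) (Suc (max t u)) Q"
proof (rule tripleI)
  fix K m S assume *: "good m S" "P m S"
  have "attains D good_config (max t u) (reached K Q) ((if m r \<noteq> 0 then p else q) # K, m, S)"
  proof (cases "m r = 0")
    case True
    with * have "attains D good_config u (reached K Q) (q # K, m, S)"
      by (intro tripleD[OF assms(2)]) auto
    from attains_mono[OF this, of "max t u"] True show ?thesis by simp
  next
    case False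
    with * have "attains D good_config t (reached K Q) (p # K, m, S)"
      by (intro tripleD[OF assms(1)]) auto
    from attains_mono[OF this, of "max t u"] False show ?thesis by simp
  qed
  with * show "attains D good_config (Suc (max t u)) (reached K Q) (If r p q # K, m, S)"
    by (simp add: good_config_def)
qed

text \<open>Supports are nonempty, so a statement about all outcomes is never vacuous. This rules
  out a loop body that is entered with variant 0.\<close>

lemma attains_False: "\<not> attains D J t (\<lambda>_. False) c"
proof (induction t arbitrary: c)
  case (Suc t)
  obtain c' where "c' \<in> set_pmf (step D c)" using set_pmf_not_empty by fast
  with Suc[of c'] show ?case by auto
qed simp

lemma triple_While:
  assumes "\<And>j. triple (\<lambda>m S. I j m S \<and> m r \<noteq> 0) p t (\<lambda>m S. \<exists>i<j. I i m S)"
  shows "triple (I j) (While r p) (j * (t + 1) + 1) (\<lambda>m S. m r = 0 \<and> (\<exists>i\<le>j. I i m S))"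
proof (rule tripleI)
  fix K m S
  assume "good m S" "I j m S"
  \<comment> \<open>The bound \<open>l\<close> in the postcondition is kept apart from the variant
    \<open>j\<close>, which decreases in the induction.\<close>
  then have "attains D good_config (j * (t + 1) + 1) (reached K (\<lambda>m S. m r = 0 \<and> (\<exists>i. i \<le> l \<and> I i m S)))
      (While r p # K, m, S)" if "j \<le> l" for l
    using that
  proof (induction j arbitrary: m S rule: less_induct)
    case (less j)
    let ?Q = "reached K (\<lambda>m S. m r = 0 \<and> (\<exists>i. i \<le> l \<and> I i m S))"
    show ?case
    proof (cases "m r = 0")
      case True
      with less.prems show ?thesis by (auto simp: good_config_def reached_def intro!: attains_now)
    next
      case False
      have body: "attains D good_config t (reached (While r p # K) (\<lambda>m S. \<exists>i<j. I i m S)) (p # While r p # K, m, S)"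
        using tripleD[OF assms less.prems(1)] less.prems(2) False by blast
      have "j \<noteq> 0"
      proof
        assume "j = 0"
        with body show False using attains_False by (simp add: reached_def[abs_def])
      qed
      then obtain j' where j: "j = Suc j'" by (cases j) auto
      have "attains D good_config (t + (j' * (t + 1) + 1)) ?Q (p # While r p # K, m, S)"
      proof (rule reached_trans[OF body])
        fix m' S' assume "good m' S'" "\<exists>i<j. I i m' S'"
        then obtain i where i: "i < j" "I i m' S'" by auto
        have "attains D good_config (i * (t + 1) + 1) ?Q (While r p # K, m', S')"
          by (rule less.IH[OF i(1) \<open>good m' S'\<close> i(2)]) (use less.prems i in simp)
        then show "attains D good_config (j' * (t + 1) + 1) ?Q (While r p # K, m', S')"
          by (rule attains_mono) (use i j in \<open>auto intro!: add_mono mult_le_mono\<close>)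
      qed
      then have "attains D good_config (Suc (t + (j' * (t + 1) + 1))) ?Q (While r p # K, m, S)"
        using False less.prems by (simp add: good_config_def)
      then show ?thesis by (rule attains_mono) (simp add: j)
    qed
  qed
  from this[OF order.refl]
  show "attains D good_config (j * (t + 1) + 1) (reached K (\<lambda>m S. m r = 0 \<and> (\<exists>i\<le>j. I i m S)))
      (While r p # K, m, S)" .
qed

lemma triple_Draw:
  assumes "\<And>m S z. P m S \<Longrightarrow> z \<in> set_pmf D \<Longrightarrow> Q m (S @ [z]) \<and> length S < M"
  shows "triple P (Instr Draw) 1 Q"
proof (rule tripleI)
  fix K m S assume "good m S" "P m S"
  with assms[of m S] show "attains D good_config 1 (reached K Q) (Instr Draw # K, m, S)"
    unfolding One_nat_def by (auto simp: good_config_def good_def reached_def Suc_le_eq)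
qed

text \<open>The preconditions include the bounds on addresses and contents; only
  \<open>Const\<close> and \<open>Add\<close> have to be checked against \<open>V\<close>. Random
  instructions and loops get \<open>False\<close> and are left to rules such as
  \<open>triple_Draw\<close> and \<open>triple_While\<close>.\<close>

fun wpi :: "sample list \<Rightarrow> instr \<Rightarrow> (mem \<Rightarrow> bool) \<Rightarrow> mem \<Rightarrow> bool" where
  "wpi S (Const r v) Q m \<longleftrightarrow> r < A \<and> v \<le> V \<and> Q (m(r := v))"
| "wpi S (Add r a b) Q m \<longleftrightarrow> r < A \<and> m a + m b \<le> V \<and> Q (m(r := m a + m b))"
| "wpi S (Sub r a b) Q m \<longleftrightarrow> r < A \<and> Q (m(r := m a - m b))"
| "wpi S (Load r a) Q m \<longleftrightarrow> r < A \<and> Q (m(r := m (m a)))"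
| "wpi S (Store a r) Q m \<longleftrightarrow> m a < A \<and> Q (m(m a := m r))"
| "wpi S (Coin r) Q m \<longleftrightarrow> False"
| "wpi S Draw Q m \<longleftrightarrow> False"
| "wpi S (QueryBit r i j) Q m \<longleftrightarrow> r < A \<and>
     Q (m(r := of_bool (m i < length S \<and> m j < length (fst (S ! m i)) \<and> fst (S ! m i) ! m j)))"
| "wpi S (QueryLabel r i) Q m \<longleftrightarrow> r < A \<and> Q (m(r := of_bool (m i < length S \<and> snd (S ! m i) = 1)))"

fun wp :: "sample list \<Rightarrow> prog \<Rightarrow> (mem \<Rightarrow> bool) \<Rightarrow> mem \<Rightarrow> bool" where
  "wp S (Instr i) Q m \<longleftrightarrow> wpi S i Q m"
| "wp S (Seq p q) Q m \<longleftrightarrow> wp S p (wp S q Q) m"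
| "wp S (If r p q) Q m \<longleftrightarrow> (if m r \<noteq> 0 then wp S p Q m else wp S q Q m)"
| "wp S (While r p) Q m \<longleftrightarrow> False"

lemma wp_mono: "wp S p Q m \<Longrightarrow> (\<And>m. Q m \<Longrightarrow> Q' m) \<Longrightarrow> wp S p Q' m"
proof (induction p arbitrary: Q Q' m)
  case (Instr i)
  then show ?case by (cases i) auto
next
  case (Seq p q)
  show ?case unfolding wp.simps
    by (rule Seq.IH(1)[OF Seq.prems(1)[unfolded wp.simps]]) (rule Seq.IH(2)[OF _ Seq.prems(2)])
next
  case (If r p q)
  then show ?case by (auto split: if_splits)
qed simp

fun time :: "prog \<Rightarrow> nat" where
  "time (Instr i) = 1"
| "time (Seq p q) = Suc (time p + time q)"
| "time (If r p q) = Suc (max (time p) (time q))"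
| "time (While r p) = 0"

lemma wpi_sound:
  assumes "wpi S i Q m" "bounded_mem A V m"
  shows "\<exists>m'. exec D i m S = return_pmf (m', S) \<and> bounded_mem A V m' \<and> Q m'"
proof -
  have V: "1 \<le> V" using A AV by simp
  have "of_bool b \<le> V" for b using V by (cases b) auto
  moreover have "m a \<le> V" "m a - b \<le> V" for a b
    using assms(2) by (auto simp: bounded_mem_def intro: order.trans[OF diff_le_self])
  ultimately show ?thesis using assms V
    by (cases i) (auto intro!: bounded_mem_upd)
qed

lemma wp_sound: "triple (\<lambda>m S. wp S p (\<lambda>m. Q m S) m) p (time p) Q"
proof (induction p arbitrary: Q)
  case (Instr i)
  show ?case
  proof (rule tripleI)
    fix K m S assume *: "good m S" "wp S (Instr i) (\<lambda>m. Q m S) m"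
    with wpi_sound[of S i "\<lambda>m. Q m S" m] obtain m' where
      "exec D i m S = return_pmf (m', S)" "bounded_mem A V m'" "Q m' S" by (auto simp: good_def)
    with * show "attains D good_config (time (Instr i)) (reached K Q) (Instr i # K, m, S)"
      by (simp add: good_config_def good_def reached_def)
  qed
next
  case (Seq p q)
  show ?case unfolding wp.simps time.simps
    by (rule triple_Seq[OF Seq.IH(1) Seq.IH(2)])
next
  case (If r p q)
  show ?case unfolding wp.simps time.simps
    by (rule triple_If; rule triple_mono[OF If.IH(1)] triple_mono[OF If.IH(2)]) auto
next
  case (While r p)
  show ?case by (rule tripleI) simp
qed

lemma triple_wp:
  assumes "\<And>m S. good m S \<Longrightarrow> P m S \<Longrightarrow> wp S p (\<lambda>m. Q m S) m"
  shows "triple P p (time p) Q"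
  unfolding triple_def using tripleD[OF wp_sound[of p Q]] assms by blast

text \<open>\<open>F k\<close> describes the state after \<open>k\<close> rounds. The counter
  \<open>r\<close> runs downwards, so \<open>F\<close> has to be insensitive to it;
  \<open>o'\<close> is the cell with the constant 1.\<close>

lemma triple_repeat:
  assumes body: "\<And>k. k < c \<Longrightarrow> triple (\<lambda>m S. F k m S \<and> m r = c - k) p t (\<lambda>m S. F (Suc k) m S \<and> m r = c - k)"
    and stable: "\<And>k m S v. F k m S \<Longrightarrow> F k (m(r := v)) S"
    and one: "\<And>k m S. F k m S \<Longrightarrow> m o' = 1" and r: "r < A"
  shows "triple (\<lambda>m S. F 0 m S \<and> m r = c) (While r (Seq p (Instr (Sub r r o')))) (c * (t + 3) + 1) (F c)"
proof -
  define I where "I j m S \<longleftrightarrow> j \<le> c \<and> F (c - j) m S \<and> m r = j" for j m S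
  have "triple (\<lambda>m S. I j m S \<and> m r \<noteq> 0) (Seq p (Instr (Sub r r o'))) (Suc (t + 1)) (\<lambda>m S. \<exists>i<j. I i m S)" for j
  proof (cases "j \<noteq> 0 \<and> j \<le> c")
    case False
    then show ?thesis by (auto simp: triple_def I_def)
  next
    case True
    then have k: "c - j < c" "c - (c - j) = j" "Suc (c - j) = c - (j - 1)" by auto
    have sub: "triple (\<lambda>m S. F (c - (j - 1)) m S \<and> m r = j) (Instr (Sub r r o')) (time (Instr (Sub r r o')))
        (\<lambda>m S. \<exists>i<j. I i m S)"
    proof (rule triple_wp)
      fix m S assume *: "F (c - (j - 1)) m S \<and> m r = j"
      with one have "m o' = 1" by blast
      with * True r stable show "wp S (Instr (Sub r r o')) (\<lambda>m. \<exists>i<j. I i m S) m"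
        by (auto simp: I_def intro!: exI[of _ "j - 1"])
    qed
    have "triple (\<lambda>m S. F (c - j) m S \<and> m r = j) p t (\<lambda>m S. F (c - (j - 1)) m S \<and> m r = j)"
      using body[OF k(1)] by (simp only: k)
    from triple_Seq[OF this sub] show ?thesis
      by (rule triple_mono) (auto simp: I_def)
  qed
  from triple_While[of I, OF this, of c] show ?thesis
    by (rule triple_mono) (auto simp: I_def algebra_simps)
qed

end

section \<open>The program\<close>

text \<open>
  Cell 0 holds \<open>N\<close> and cells 1, 4, 5, 6 the constants 32, 0, 1, 3.  The stack starts at address 32
  and takes three cells per entry; cell 7 holds its limit \<open>32 + 3 * d\<close>, where the output starts.
  Cells 8 and 9 hold \<open>R\<close> and the number of samples, cells 10, 11, 12 point to the end of the
  stack, the end of its lowest \<open>B\<close> entries and the end of the output, cells 13 to 15 encode the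
  mode, and cells 16 to 31 are scratch.  A scan of the stack leaves in cell 30 the number of entries
  with the same variable as the top one and in cell 31 the number of tests; a scan of the samples
  leaves in cells 24 and 25 whether labels -1 and 1 were seen on the current path.
\<close>

fun blk :: "prog list \<Rightarrow> prog" where
  "blk [] = Instr (Const 17 0)"
| "blk [p] = p"
| "blk (p # q # ps) = Seq p (blk (q # ps))"

abbreviation "skip \<equiv> Instr (Const 17 0)"

text \<open>Truncated subtractions both ways add up to the distance of two numbers, which is the
  test for equality here and in later programs. Elsewhere, adding cell 4, which is 0, copies a
  cell.\<close>

definition scan_body :: prog where
  "scan_body = blk [Instr (Sub 18 18 6), Instr (Load 22 18), Instr (Sub 23 22 21), Instr (Sub 24 21 22),
     Instr (Add 23 23 24), If 23 skip (Instr (Add 30 30 5)),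
     Instr (Add 24 18 5), Instr (Load 25 24), Instr (Add 24 24 5), Instr (Load 26 24),
     If 25 (If 26 (Instr (Add 31 31 5)) skip) (If 26 skip (Instr (Add 31 31 5))),
     Instr (Sub 16 18 1)]"

definition scan_init :: prog where
  "scan_init = blk [Instr (Sub 16 10 6), Instr (Load 21 16), Instr (Const 30 0), Instr (Const 31 0),
     Instr (Add 18 10 4), Instr (Sub 16 18 1)]"

definition match_body :: prog where
  "match_body = blk [Instr (Sub 18 18 6), Instr (Load 26 18), Instr (QueryBit 27 22 26),
     Instr (Add 28 18 5), Instr (Load 29 28),
     If 27 (If 29 skip (Instr (Const 23 0))) (If 29 (Instr (Const 23 0)) skip),
     Instr (Sub 16 18 1)]"

definition match_init :: prog where
  "match_init = blk [Instr (Sub 22 22 5), Instr (Const 23 1), Instr (Add 18 10 4), Instr (Sub 16 18 1)]"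

definition match_final :: prog where
  "match_final = If 23 (Seq (Instr (QueryLabel 26 22)) (If 26 (Instr (Const 25 1)) (Instr (Const 24 1)))) skip"

definition seen_init :: prog where
  "seen_init = blk [Instr (Const 24 0), Instr (Const 25 0), Instr (Add 22 9 4)]"

definition attempt_prog :: prog where
  "attempt_prog = Seq (Instr (Sub 16 0 22)) (If 16 (blk [Instr (Store 10 22), Instr (Add 10 10 5),
     Instr (Store 10 4), Instr (Add 10 10 5), Instr (Store 10 4), Instr (Add 10 10 5), Instr (Const 14 0)]) skip)"

definition leaf_prog :: prog where
  "leaf_prog = blk [Instr (Const 15 1), Instr (Sub 17 10 11), Instr (Sub 18 11 10), Instr (Add 17 17 18),
     If 17 skip (Seq (Instr (Store 12 25)) (Instr (Add 12 12 5)))]"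

definition decide_prog :: prog where
  "decide_prog = blk [Instr (Const 14 1), Instr (Const 15 0), Instr (Sub 16 30 5),
     If 16 skip (Seq (Instr (Sub 16 7 10)) (If 16
       (If 24 (If 25 (Seq (Instr (Sub 16 8 31)) (If 16 (Seq (Instr (Const 22 0)) attempt_prog) skip))
         leaf_prog) leaf_prog)
       leaf_prog))]"

definition enter_prog :: prog where
  "enter_prog = Seq (Seq scan_init (While 16 scan_body)) (Seq (Seq seen_init
     (While 22 (Seq match_init (Seq (While 16 match_body) match_final)))) decide_prog)"

definition fail_prog :: prog where
  "fail_prog = If 25 (Instr (Add 10 18 4))
     (If 24 (blk [Instr (Add 22 22 5), Instr (Add 10 18 4), attempt_prog])
       (blk [Instr (Store 19 5), Instr (Store 20 5), Instr (Const 14 0)]))"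

definition success_prog :: prog where
  "success_prog = blk [Instr (Sub 27 10 11), Instr (Sub 28 11 10), Instr (Add 27 27 28),
     If 27
       (If 25 (Instr (Add 10 18 4))
         (blk [Instr (Add 28 11 6), Instr (Sub 29 28 10), Instr (Sub 28 10 28), Instr (Add 28 28 29),
           Instr (Const 14 0), Instr (Const 15 0),
           If 28 (Seq (Instr (Sub 23 5 23)) (Instr (Store 19 23)))
             (blk [Instr (Store 19 4), Instr (Add 11 11 6), Instr (Add 22 22 5), Instr (Add 22 22 5),
               Instr (Store 12 22), Instr (Add 12 12 5)])]))
       (If 23 (Seq (Instr (Add 10 18 4)) (Instr (Sub 11 11 6)))
         (blk [Instr (Store 19 5), Instr (Const 14 0), Instr (Const 15 0)]))]"

definition return_prog :: prog where
  "return_prog = Seq (Instr (Sub 16 10 1)) (If 16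
     (blk [Instr (Sub 18 10 6), Instr (Load 22 18), Instr (Add 19 18 5), Instr (Load 23 19),
       Instr (Add 20 19 5), Instr (Load 24 20),
       Instr (Sub 25 23 24), Instr (Sub 26 24 23), Instr (Add 25 25 26),
       If 15 success_prog fail_prog])
     (Instr (Const 13 0)))"

definition move_prog :: prog where
  "move_prog = If 14 return_prog enter_prog"

section \<open>Representation of the stack machine in memory\<close>

fun stored :: "mem \<Rightarrow> entry list \<Rightarrow> bool" where
  "stored m [] \<longleftrightarrow> True"
| "stored m ((v, b, t) # st) \<longleftrightarrow> m (32 + 3 * length st) = v \<and> m (33 + 3 * length st) = of_bool b \<and>
     m (34 + 3 * length st) = of_bool t \<and> stored m st"

text \<open>For \<open>b\<close> up to 32 only scratch cells may differ. With \<open>b = 30\<close>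
  the results of the stack scan in cells 30 and 31 survive the scan of the samples.\<close>

definition agree :: "nat \<Rightarrow> mem \<Rightarrow> mem \<Rightarrow> bool" where
  "agree b m m' \<longleftrightarrow> (\<forall>a. a < 16 \<or> b \<le> a \<longrightarrow> m' a = m a)"

definition occurrences :: "nat \<Rightarrow> entry list \<Rightarrow> nat" where
  "occurrences v st = length (filter (\<lambda>e. fst e = v) st)"

lemma stored_append: "stored m (st @ st') \<Longrightarrow> stored m st'"
  by (induction st) auto

lemma stored_upd: "a < 32 \<or> 32 + 3 * length st \<le> a \<Longrightarrow> stored (m(a := v)) st = stored m st"
  by (induction st) auto

lemma stored_agree: "agree b m m' \<Longrightarrow> b \<le> 32 \<Longrightarrow> stored m' st = stored m st"
  by (induction st) (auto simp: agree_def)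

lemma agree_upd: "agree b m m' \<Longrightarrow> 16 \<le> r \<Longrightarrow> r < b \<Longrightarrow> agree b m (m'(r := v))"
  by (auto simp: agree_def)

lemma agreeD: "agree b m m' \<Longrightarrow> a < 16 \<or> b \<le> a \<Longrightarrow> m' a = m a"
  unfolding agree_def by blast

lemma agree_refl: "agree b m m"
  by (simp add: agree_def)

lemma dup_iff: "st \<noteq> [] \<Longrightarrow> dup st \<longleftrightarrow> 2 \<le> occurrences (fst (hd st)) st"
proof (cases st)
  case (Cons e st')
  have "occurrences v st' \<noteq> 0 \<longleftrightarrow> v \<in> fst ` set st'" for v
    by (auto simp: occurrences_def filter_empty_conv)
  with Cons show ?thesis by (cases e) (auto simp: occurrences_def Suc_le_eq)
qed simp

lemma tests_snoc: "tests (st @ [(v, b, t)]) = tests st + of_bool (b = t)"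
  by (simp add: tests_def)

lemma occurrences_snoc: "occurrences w (st @ [(v, b, t)]) = occurrences w st + of_bool (v = w)"
  by (simp add: occurrences_def)

lemma matches_snoc: "matches (st @ [(v, b, t)]) x \<longleftrightarrow> matches st x \<and> bit_of x v = b"
  by (auto simp: matches_def)

lemma diff_add_diff_le: "x \<le> V \<Longrightarrow> y \<le> V \<Longrightarrow> x - y + (y - x) \<le> (V::nat)"
  by arith

lemma split_at:
  assumes "k \<le> length st" "k \<noteq> 0"
  obtains e rest where "st = take (length st - k) st @ e # rest" "k = Suc (length rest)"
proof (cases "drop (length st - k) st")
  case Nil
  with assms show ?thesis by simp
next
  case (Cons e rest)
  from arg_cong[OF Cons, of length] assms have "k = Suc (length rest)" by simp
  moreover have "st = take (length st - k) st @ e # rest" using Cons append_take_drop_id by metis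
  ultimately show ?thesis using that by blast
qed

lemma bex_set_conv_nth: "(\<exists>z\<in>set xs. P z) \<longleftrightarrow> (\<exists>i<length xs. P (xs ! i))"
  by (auto simp: set_conv_nth)

lemma ex_ge_Suc:
  fixes j :: nat
  shows "j < M \<Longrightarrow> (\<exists>i<M. j \<le> i \<and> P i) \<longleftrightarrow> P j \<or> (\<exists>i<M. Suc j \<le> i \<and> P i)"
  by (auto simp: Suc_le_eq le_less)

lemma tests_le_length: "tests st \<le> length st"
  unfolding tests_def by (rule length_filter_le)

lemma occurrences_le_length: "occurrences v st \<le> length st"
  unfolding occurrences_def by (rule length_filter_le)

text \<open>The sample list is fixed since all draws precede the search; \<open>W\<close> is the
  number of cells reserved for the output.\<close>

locale implementation = search S N d R + machine D A V M
  for S :: "sample list" and N d R :: nat and D :: "sample pmf" and A V M :: nat +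
  fixes W :: nat
  assumes length_S: "length S = M" and A_ge: "32 + 3 * d + W \<le> A" and V_ge: "A + N + M + R + 5 \<le> V"
begin

lemma good_le: "good m S' \<Longrightarrow> m a \<le> V"
  by (auto simp: good_def bounded_mem_def)

definition base :: "mem \<Rightarrow> bool" where
  "base m \<longleftrightarrow> m 0 = N \<and> m 1 = 32 \<and> m 4 = 0 \<and> m 5 = 1 \<and> m 6 = 3 \<and> m 7 = 32 + 3 * d \<and> m 8 = R \<and> m 9 = M"

fun rep :: "state \<Rightarrow> mem \<Rightarrow> bool" where
  "rep (st, B, out, mode) m \<longleftrightarrow> base m \<and> m 10 = 32 + 3 * length st \<and> m 11 = 32 + 3 * B \<and>
     m 12 = 32 + 3 * d + length out \<and> m 13 = of_bool (mode \<noteq> Done) \<and>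
     (mode \<noteq> Done \<longrightarrow> m 14 = of_bool (mode \<noteq> Enter) \<and> m 15 = of_bool (mode = Ret True)) \<and> stored m st \<and> (\<forall>k<length out. m (32 + 3 * d + k) = out ! k)"

lemma scan_loop:
  assumes "base m0" "m0 10 = 32 + 3 * length st" "stored m0 st" "length st \<le> d"
  shows "triple (\<lambda>m S'. S' = S \<and> agree 32 m0 m \<and> m 18 = 32 + 3 * length st \<and> m 16 = 3 * length st \<and>
      m 21 = v \<and> m 30 = 0 \<and> m 31 = 0)
    (While 16 scan_body) (d * 40 + 1)
    (\<lambda>m S'. S' = S \<and> agree 32 m0 m \<and> m 30 = occurrences v st \<and> m 31 = tests st)"
proof -
  define I where "I k m S' \<longleftrightarrow> S' = S \<and> agree 32 m0 m \<and> m 21 = v \<and> m 18 = 32 + 3 * k \<and> m 16 = 3 * k \<and>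
     k \<le> length st \<and> m 30 = occurrences v (take (length st - k) st) \<and> m 31 = tests (take (length st - k) st)" for k m S'
  have "triple (\<lambda>m S'. I k m S' \<and> m 16 \<noteq> 0) scan_body (time scan_body) (\<lambda>m S'. \<exists>i<k. I i m S')" for k
  proof (rule triple_wp)
    fix m S' assume g: "good m S'" and "I k m S' \<and> m 16 \<noteq> 0"
    then obtain dn e rest where *: "S' = S" "agree 32 m0 m" "m 21 = v" "m 18 = 32 + 3 * k" "m 16 = 3 * k"
        "st = dn @ e # rest" "k = Suc (length rest)" "m 30 = occurrences v dn" "m 31 = tests dn"
      unfolding I_def using split_at[of k st] by (metis mult_0_right)
    obtain w b t where e: "e = (w, b, t)" by (cases e)
    have st: "stored m ((w, b, t) # rest)"
      using stored_append[of m dn "(w, b, t) # rest"] assms(3) stored_agree[OF *(2)] *(6) e by simp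
    have r: "m 1 = 32" "m 5 = 1" "m 6 = 3" using agreeD[OF *(2)] assms(1) by (auto simp: base_def)
    have le: "w \<le> V" "v \<le> V" using g good_le[OF g, of 21] good_le[OF g, of "32 + 3 * length rest"] st * by auto
    have "Suc (tests dn) \<le> V" "Suc (occurrences v dn) \<le> V"
      using tests_le_length[of dn] occurrences_le_length[of v dn] * assms(4) A_ge V_ge by auto
    moreover have "32 + 3 * length rest + 2 \<le> V" using * assms(4) A_ge V_ge by simp
    ultimately have "wp S scan_body (\<lambda>m. I (length rest) m S) m"
      unfolding scan_body_def I_def
      using st r * e le
      by (auto simp: agree_upd diff_add_diff_le tests_snoc occurrences_snoc)
    then show "wp S' scan_body (\<lambda>m. \<exists>i<k. I i m S') m"
      unfolding *(1) by (rule wp_mono) (use *(7) in auto)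
  qed
  from triple_While[of I, OF this, of "length st"]
  show ?thesis
  proof (rule triple_mono)
    show "length st * (time scan_body + 1) + 1 \<le> d * 40 + 1"
      using assms(4) by (intro add_mono mult_le_mono) (simp_all add: scan_body_def)
    show "I (length st) m S'" if "S' = S \<and> agree 32 m0 m \<and> m 18 = 32 + 3 * length st \<and> m 16 = 3 * length st \<and>
      m 21 = v \<and> m 30 = 0 \<and> m 31 = 0" for m S'
      using that by (auto simp: I_def occurrences_def)
    show "S' = S \<and> agree 32 m0 m \<and> m 30 = occurrences v st \<and> m 31 = tests st"
      if "m 16 = 0 \<and> (\<exists>i\<le>length st. I i m S')" for m S'
      using that by (auto simp: I_def)
  qed
qed

lemma scan:
  assumes "base m0" "m0 10 = 32 + 3 * length st" "stored m0 st" "length st \<le> d"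
  shows "triple (\<lambda>m S'. S' = S \<and> m = m0) (Seq scan_init (While 16 scan_body)) (d * 40 + 20)
    (\<lambda>m S'. S' = S \<and> agree 32 m0 m \<and> (dup st \<longleftrightarrow> 2 \<le> m 30) \<and> m 31 = tests st)"
proof -
  \<comment> \<open>This is the address of the variable of the top entry. For an empty stack it is
    scratch cell 29; then \<open>occurrences v st\<close> is 0 for every \<open>v\<close>.\<close>
  define v where "v = m0 (29 + 3 * length st)"
  have "triple (\<lambda>m S'. S' = S \<and> m = m0) scan_init (time scan_init)
    (\<lambda>m S'. S' = S \<and> agree 32 m0 m \<and> m 18 = 32 + 3 * length st \<and> m 16 = 3 * length st \<and>
      m 21 = v \<and> m 30 = 0 \<and> m 31 = 0)"
  proof (rule triple_wp)
    fix m S' assume "good m S'" "S' = S \<and> m = m0"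
    moreover have "32 + 3 * length st \<le> V" using assms(4) A_ge V_ge by simp
    ultimately show "wp S' scan_init (\<lambda>m. S' = S \<and> agree 32 m0 m \<and> m 18 = 32 + 3 * length st \<and>
        m 16 = 3 * length st \<and> m 21 = v \<and> m 30 = 0 \<and> m 31 = 0) m"
      using assms(1,2) by (auto simp: scan_init_def base_def agree_upd agree_refl v_def)
  qed
  from triple_Seq[OF this scan_loop[OF assms]] show ?thesis
  proof (rule triple_mono)
    have "dup st \<longleftrightarrow> 2 \<le> occurrences v st"
    proof (cases st)
      case (Cons e st')
      then have "v = fst (hd st)" using assms(3) by (cases e) (auto simp: v_def)
      with Cons show ?thesis by (simp add: dup_iff del: dup.simps)
    qed (simp add: occurrences_def)
    then show "S' = S \<and> agree 32 m0 m \<and> (dup st \<longleftrightarrow> 2 \<le> m 30) \<and> m 31 = tests st"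
      if "S' = S \<and> agree 32 m0 m \<and> m 30 = occurrences v st \<and> m 31 = tests st" for m S'
      using that by simp
  qed (simp_all add: scan_init_def)
qed

lemma match_loop:
  assumes "base m0" "m0 10 = 32 + 3 * length st" "stored m0 st" "length st \<le> d" "j < M"
  shows "triple (\<lambda>m S'. S' = S \<and> agree 30 m0 m \<and> m 18 = 32 + 3 * length st \<and> m 16 = 3 * length st \<and>
      m 22 = j \<and> m 23 = 1 \<and> m 24 = a \<and> m 25 = b)
    (While 16 match_body) (d * 30 + 1)
    (\<lambda>m S'. S' = S \<and> agree 30 m0 m \<and> m 22 = j \<and> m 23 = of_bool (matches st (fst (S ! j))) \<and> m 24 = a \<and> m 25 = b)"
proof -
  define I where "I k m S' \<longleftrightarrow> S' = S \<and> agree 30 m0 m \<and> m 22 = j \<and> m 24 = a \<and> m 25 = b \<and>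
     m 18 = 32 + 3 * k \<and> m 16 = 3 * k \<and>
     k \<le> length st \<and> m 23 = of_bool (matches (take (length st - k) st) (fst (S ! j)))" for k m S'
  have "triple (\<lambda>m S'. I k m S' \<and> m 16 \<noteq> 0) match_body (time match_body) (\<lambda>m S'. \<exists>i<k. I i m S')" for k
  proof (rule triple_wp)
    fix m S' assume g: "good m S'" and "I k m S' \<and> m 16 \<noteq> 0"
    then obtain dn e rest where *: "S' = S" "agree 30 m0 m" "m 22 = j" "m 24 = a" "m 25 = b" "m 18 = 32 + 3 * k" "m 16 = 3 * k"
        "st = dn @ e # rest" "k = Suc (length rest)" "m 23 = of_bool (matches dn (fst (S ! j)))"
      unfolding I_def using split_at[of k st] by (metis mult_0_right)
    obtain w c t where e: "e = (w, c, t)" by (cases e)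
    have st: "stored m ((w, c, t) # rest)"
      using stored_append[of m dn "(w, c, t) # rest"] assms(3) stored_agree[OF *(2)] *(8) e by simp
    have r: "m 1 = 32" "m 5 = 1" "m 6 = 3" using agreeD[OF *(2)] assms(1) by (auto simp: base_def)
    have "32 + 3 * length rest + 2 \<le> V" using * assms(4) A_ge V_ge by simp
    then have "wp S match_body (\<lambda>m. I (length rest) m S) m"
      unfolding match_body_def I_def
      using st r * e assms(5) length_S
      by (auto simp: agree_upd matches_snoc bit_of_def)
    then show "wp S' match_body (\<lambda>m. \<exists>i<k. I i m S') m"
      unfolding *(1) by (rule wp_mono) (use *(9) in auto)
  qed
  from triple_While[of I, OF this, of "length st"]
  show ?thesis
  proof (rule triple_mono)
    show "length st * (time match_body + 1) + 1 \<le> d * 30 + 1"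
      using assms(4) by (intro add_mono mult_le_mono) (simp_all add: match_body_def)
    show "I (length st) m S'" if "S' = S \<and> agree 30 m0 m \<and> m 18 = 32 + 3 * length st \<and> m 16 = 3 * length st \<and>
      m 22 = j \<and> m 23 = 1 \<and> m 24 = a \<and> m 25 = b" for m S'
      using that by (auto simp: I_def)
    show "S' = S \<and> agree 30 m0 m \<and> m 22 = j \<and> m 23 = of_bool (matches st (fst (S ! j))) \<and> m 24 = a \<and> m 25 = b"
      if "m 16 = 0 \<and> (\<exists>i\<le>length st. I i m S')" for m S'
      using that by (auto simp: I_def)
  qed
qed

text \<open>The loop counts down from \<open>M\<close>, so when \<open>j\<close> samples remain,
  those of index at least \<open>j\<close> have been inspected.\<close>

definition seen_from :: "nat \<Rightarrow> entry list \<Rightarrow> bool \<Rightarrow> bool" where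
  "seen_from j st c \<longleftrightarrow> (\<exists>i<M. j \<le> i \<and> matches st (fst (S ! i)) \<and> (snd (S ! i) = 1) = c)"

lemma seen_from_0: "seen_from 0 st c = seen st c"
  using length_S by (simp add: seen_from_def seen_def bex_set_conv_nth)

lemma seen_from_Suc:
  assumes "j < M"
  shows "seen_from j st c \<longleftrightarrow> matches st (fst (S ! j)) \<and> (snd (S ! j) = 1) = c \<or> seen_from (Suc j) st c"
  unfolding seen_from_def by (rule ex_ge_Suc[OF assms])

lemma seen_loop:
  assumes "base m0" "m0 10 = 32 + 3 * length st" "stored m0 st" "length st \<le> d"
  shows "triple (\<lambda>m S'. S' = S \<and> m = m0)
    (Seq seen_init (While 22 (Seq match_init (Seq (While 16 match_body) match_final))))
    (M * (d * 30 + 20) + 10)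
    (\<lambda>m S'. S' = S \<and> agree 30 m0 m \<and> m 24 = of_bool (seen st False) \<and> m 25 = of_bool (seen st True))"
proof -
  define I where "I j m S' \<longleftrightarrow> S' = S \<and> agree 30 m0 m \<and> m 22 = j \<and> j \<le> M \<and>
    m 24 = of_bool (seen_from j st False) \<and> m 25 = of_bool (seen_from j st True)" for j m S'
  have body: "triple (\<lambda>m S'. I j m S' \<and> m 22 \<noteq> 0) (Seq match_init (Seq (While 16 match_body) match_final))
      (Suc (time match_init + Suc ((d * 30 + 1) + time match_final))) (\<lambda>m S'. \<exists>i<j. I i m S')" for j
  proof (cases "j \<noteq> 0 \<and> j \<le> M")
    case False
    then show ?thesis by (auto simp: triple_def I_def)
  next
    case True
    then obtain i where i: "j = Suc i" "i < M" by (cases j) auto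
    let ?a = "of_bool (seen_from j st False)" and ?b = "of_bool (seen_from j st True)"
    have "triple (\<lambda>m S'. I j m S' \<and> m 22 \<noteq> 0) match_init (time match_init)
      (\<lambda>m S'. S' = S \<and> agree 30 m0 m \<and> m 18 = 32 + 3 * length st \<and> m 16 = 3 * length st \<and>
        m 22 = i \<and> m 23 = 1 \<and> m 24 = ?a \<and> m 25 = ?b)"
    proof (rule triple_wp)
      fix m S' assume I: "I j m S' \<and> m 22 \<noteq> 0"
      then have ag: "agree 30 m0 m" by (simp add: I_def)
      have "m 1 = 32" "m 4 = 0" "m 5 = 1" "m 10 = 32 + 3 * length st"
        using agreeD[OF ag] assms(1,2) by (auto simp: base_def)
      moreover have "32 + 3 * length st \<le> V" using assms(4) A_ge V_ge by simp
      ultimately show "wp S' match_init (\<lambda>m. S' = S \<and> agree 30 m0 m \<and> m 18 = 32 + 3 * length st \<and>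
          m 16 = 3 * length st \<and> m 22 = i \<and> m 23 = 1 \<and> m 24 = ?a \<and> m 25 = ?b) m"
        using I i by (auto simp: match_init_def I_def agree_upd)
    qed
    moreover have "triple (\<lambda>m S'. S' = S \<and> agree 30 m0 m \<and> m 22 = i \<and>
        m 23 = of_bool (matches st (fst (S ! i))) \<and> m 24 = ?a \<and> m 25 = ?b) match_final (time match_final) (\<lambda>m S'. \<exists>i<j. I i m S')"
    proof (rule triple_wp)
      fix m S' assume *: "S' = S \<and> agree 30 m0 m \<and> m 22 = i \<and>
        m 23 = of_bool (matches st (fst (S ! i))) \<and> m 24 = ?a \<and> m 25 = ?b"
      have "wp S match_final (\<lambda>m. I i m S) m"
        unfolding match_final_def I_def
        using * i length_S by (auto simp: agree_upd seen_from_Suc)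
      then show "wp S' match_final (\<lambda>m. \<exists>i<j. I i m S') m"
        using * i by (auto elim!: wp_mono)
    qed
    ultimately show ?thesis by (intro triple_Seq[OF _ triple_Seq[OF match_loop[OF assms i(2)]]])
  qed
  have "triple (\<lambda>m S'. S' = S \<and> m = m0) seen_init (time seen_init) (I M)"
  proof (rule triple_wp)
    fix m S' assume "good m S'" "S' = S \<and> m = m0"
    moreover have "\<not> seen_from M st c" for c by (simp add: seen_from_def)
    moreover have "M \<le> V" using V_ge by simp
    ultimately show "wp S' seen_init (\<lambda>m. I M m S') m"
      using assms(1) by (auto simp: seen_init_def base_def agree_upd agree_refl I_def)
  qed
  from triple_Seq[OF this triple_While[of I, OF body, of M]] show ?thesis
    by (rule triple_mono)
       (auto simp: seen_init_def match_init_def match_final_def I_def seen_from_0 algebra_simps)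
qed

end

section \<open>Simulation of the moves by the program\<close>

context implementation
begin

lemma rep_agree:
  assumes "rep a m" "agree b m m'" "b \<le> 32"
  shows "rep a m'"
proof -
  obtain st B out mode where "a = (st, B, out, mode)" by (cases a)
  with assms show ?thesis
    using stored_agree[OF assms(2,3)] agreeD[OF assms(2)] by (simp add: base_def)
qed

lemma attempt_prog:
  assumes "rep (st, B, out, Ret False) m" "m 22 = v" "length st < d"
  shows "wp S attempt_prog (rep (attempt v st B out)) m"
proof -
  have "32 + 3 * length st + 3 \<le> A" "32 + 3 * length st + 3 \<le> V" using assms(3) A_ge V_ge by simp_all
  with assms show ?thesis
    by (auto simp: attempt_prog_def attempt_def base_def stored_upd)
qed

lemma leaf_prog:
  assumes "rep (st, B, out, Ret False) m" "m 25 = of_bool (seen st True)" "length st \<le> d" "B \<le> d"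
    "length out < W \<or> length st \<noteq> B"
  shows "wp S leaf_prog (rep (st, B, if length st = B then out @ [of_bool (seen st True)] else out, Ret True)) m"
proof -
  have "32 + 3 * length st \<le> V" "32 + 3 * B \<le> V" using assms(3,4) A_ge V_ge by simp_all
  moreover have "32 + 3 * d + length out < A \<and> Suc (32 + 3 * d + length out) \<le> V" if "length st = B"
    using assms(5) that A_ge V_ge by simp
  ultimately show ?thesis using assms(1-3)
    by (auto simp: leaf_prog_def base_def stored_upd diff_add_diff_le nth_append less_Suc_eq)
qed

lemma decide_prog:
  assumes "rep (st, B, out, Enter) m" "dup st \<longleftrightarrow> 2 \<le> m 30" "m 31 = tests st"
    "m 24 = of_bool (seen st False)" "m 25 = of_bool (seen st True)" "length st \<le> d" "B \<le> d"
    "length (written (move (st, B, out, Enter))) \<le> W"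
  shows "wp S decide_prog (rep (move (st, B, out, Enter))) m"
proof -
  \<comment> \<open>These are the memories at the nested branches of \<open>decide_prog\<close>. It
    presets the mode \<open>Ret False\<close>, so a failing branch has nothing left to do.\<close>
  define m1 where "m1 = m(14 := Suc 0, 15 := 0, 16 := m 30 - Suc 0)"
  define m2 where "m2 = m1(16 := 3 * d - 3 * length st)"
  define m3 where "m3 = m2(16 := R - tests st, 22 := 0)"
  note defs = m1_def m2_def m3_def
  have m1: "rep (st, B, out, Ret False) m1"
    using assms(1) by (simp add: m1_def base_def stored_upd)
  have m2: "rep (st, B, out, Ret False) m2" "m2 24 = of_bool (seen st False)" "m2 25 = of_bool (seen st True)"
    using m1 assms(4,5) by (auto simp: m2_def m1_def base_def stored_upd)
  have m3: "rep (st, B, out, Ret False) m3" "m3 22 = 0"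
    using m2 by (auto simp: m3_def base_def stored_upd)
  have regs: "m 5 = 1" "m 7 = 32 + 3 * d" "m 8 = R" "m 10 = 32 + 3 * length st"
    using assms(1) by (auto simp: base_def)
  have 1: "wp S decide_prog Q m \<longleftrightarrow>
     (if dup st then wp S skip Q m1
      else if length st = d \<or> pure st then wp S leaf_prog Q m2
      else if R \<le> tests st then wp S skip Q (m2(16 := 0))
      else wp S attempt_prog Q m3)" for Q
    using assms(2-6) regs
    by (auto simp: decide_prog_def defs pure_def)
  show ?thesis
    unfolding 1
    using m1 m2 m3 assms(6-8) attempt_prog[OF m3] leaf_prog[OF m2(1,3)]
    by (auto simp: written_def base_def stored_upd)
qed

lemma enter_prog:
  assumes "proper (st, B, out, Enter)" "length (written (move (st, B, out, Enter))) \<le> W"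
  shows "triple (\<lambda>m S'. S' = S \<and> rep (st, B, out, Enter) m) enter_prog (M * (d * 30 + 20) + d * 40 + 90)
    (\<lambda>m S'. S' = S \<and> rep (move (st, B, out, Enter)) m)"
  unfolding triple_def
proof (intro allI impI)
  fix K m0 S'
  assume g: "good m0 S'" and *: "S' = S \<and> rep (st, B, out, Enter) m0"
  then have r: "base m0" "m0 10 = 32 + 3 * length st" "stored m0 st" "length st \<le> d" using assms(1) by auto
  have d: "triple (\<lambda>m S'. S' = S \<and> agree 32 m0 m \<and> (dup st \<longleftrightarrow> 2 \<le> m 30) \<and> m 31 = tests st)
     (Seq (Seq seen_init (While 22 (Seq match_init (Seq (While 16 match_body) match_final)))) decide_prog)
     (Suc (M * (d * 30 + 20) + 10 + time decide_prog)) (\<lambda>m S'. S' = S \<and> rep (move (st, B, out, Enter)) m)"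
    unfolding triple_def
  proof (intro allI impI)
    fix K m1 S'
    assume g1: "good m1 S'" and 1: "S' = S \<and> agree 32 m0 m1 \<and> (dup st \<longleftrightarrow> 2 \<le> m1 30) \<and> m1 31 = tests st"
    then have rep1: "rep (st, B, out, Enter) m1" using rep_agree * by blast
    then have r1: "base m1" "m1 10 = 32 + 3 * length st" "stored m1 st" by auto
    have dec: "triple (\<lambda>m S'. S' = S \<and> agree 30 m1 m \<and> m 24 = of_bool (seen st False) \<and> m 25 = of_bool (seen st True))
       decide_prog (time decide_prog) (\<lambda>m S'. S' = S \<and> rep (move (st, B, out, Enter)) m)"
    proof (rule triple_wp)
      fix m S' assume 2: "S' = S \<and> agree 30 m1 m \<and> m 24 = of_bool (seen st False) \<and> m 25 = of_bool (seen st True)"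
      then have rep2: "rep (st, B, out, Enter) m" using rep_agree rep1 by (meson numeral_le_iff semiring_norm)
      have "m 30 = m1 30" "m 31 = m1 31" using 2 agreeD[of 30 m1 m] by auto
      then have "wp S decide_prog (rep (move (st, B, out, Enter))) m"
        using 1 2 assms by (intro decide_prog[OF rep2]) auto
      then show "wp S' decide_prog (\<lambda>m. S' = S \<and> rep (move (st, B, out, Enter)) m) m"
        using 2 by simp
    qed
    from tripleD[OF triple_Seq[OF seen_loop[OF r1 r(4)] dec] g1] 1
    show "attains D good_config (Suc (M * (d * 30 + 20) + 10 + time decide_prog))
        (reached K (\<lambda>m S'. S' = S \<and> rep (move (st, B, out, Enter)) m))
        (Seq (Seq seen_init (While 22 (Seq match_init (Seq (While 16 match_body) match_final)))) decide_prog # K, m1, S')"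
      by simp
  qed
  have "time decide_prog \<le> 50"
    by (simp add: decide_prog_def leaf_prog_def attempt_prog_def)
  moreover have "attains D good_config (Suc (d * 40 + 20 + Suc (M * (d * 30 + 20) + 10 + time decide_prog)))
    (reached K (\<lambda>m S'. S' = S \<and> rep (move (st, B, out, Enter)) m)) (enter_prog # K, m0, S')"
    unfolding enter_prog_def using tripleD[OF triple_Seq[OF scan[OF r] d] g] * by simp
  ultimately show "attains D good_config (M * (d * 30 + 20) + d * 40 + 90)
    (reached K (\<lambda>m S'. S' = S \<and> rep (move (st, B, out, Enter)) m)) (enter_prog # K, m0, S')"
    by (elim attains_mono) simp
qed

lemma return_prog:
  assumes "proper (st, B, out, Ret c)" "length (written (move (st, B, out, Ret c))) \<le> W"
    "rep (st, B, out, Ret c) m" "good m S"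
  shows "wp S return_prog (rep (move (st, B, out, Ret c))) m"
proof (cases st)
  case Nil
  with assms show ?thesis
    by (cases c) (auto simp: return_prog_def base_def)
next
  case (Cons e st')
  obtain v b t where e: "e = (v, b, t)" by (cases e)
  have st: "m (32 + 3 * length st') = v" "m (33 + 3 * length st') = of_bool b" "m (34 + 3 * length st') = of_bool t"
    "stored m st'" using assms(3) Cons e by auto
  have len: "Suc (length st') \<le> d" "B \<le> d" using assms(1) Cons by auto
  have v: "v + 2 \<le> V" using assms(1) Cons e V_ge by auto
  have bd: "32 + 3 * Suc (length st') \<le> A" "32 + 3 * Suc (length st') \<le> V" "32 + 3 * Suc B \<le> V"
    using len A_ge V_ge A by auto
  have regs: "base m" "m 10 = 35 + 3 * length st'" "m 11 = 32 + 3 * B" "m 12 = 32 + 3 * d + length out"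
    "m 13 = 1" "m 14 = 1" "m 15 = of_bool c" "\<forall>k<length out. m (32 + 3 * d + k) = out ! k"
    using assms(3) Cons by auto
  \<comment> \<open>The memory once the top entry has been unpacked into registers. Cell 25 is
    written twice and ends up telling whether \<open>b\<close> and \<open>t\<close> differ, i.e.
    whether the entry is not a test.\<close>
  define m1 where "m1 = m(16 := 3 * Suc (length st'), 18 := 32 + 3 * length st', 22 := v, 19 := 33 + 3 * length st',
    23 := of_bool b, 20 := 34 + 3 * length st', 24 := of_bool t,
    25 := of_bool b - of_bool t, 26 := of_bool t - of_bool b, 25 := of_bool (b \<noteq> t))"
  have m1: "base m1" "m1 10 = 35 + 3 * length st'" "m1 11 = 32 + 3 * B" "m1 12 = 32 + 3 * d + length out"
    "m1 13 = 1" "m1 14 = 1" "m1 15 = of_bool c" "\<forall>k<length out. m1 (32 + 3 * d + k) = out ! k"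
    "m1 18 = 32 + 3 * length st'" "m1 22 = v" "m1 19 = 33 + 3 * length st'" "m1 20 = 34 + 3 * length st'"
    "m1 23 = of_bool b" "m1 24 = of_bool t" "m1 25 = of_bool (b \<noteq> t)"
    "m1 (32 + 3 * length st') = v" "m1 (33 + 3 * length st') = of_bool b" "m1 (34 + 3 * length st') = of_bool t"
    "stored m1 st'"
    using regs st by (auto simp: m1_def base_def stored_upd)
  have "wp S (if c then success_prog else fail_prog) Q m1 \<Longrightarrow> wp S return_prog Q m" for Q
    using regs st bd v
    by (cases b; cases t) (auto simp: return_prog_def m1_def base_def split: if_splits)
  moreover have "wp S (if c then success_prog else fail_prog) (rep (move (st, B, out, Ret c))) m1"
  proof (cases c)
    case False
    define m2 where "m2 = m1(22 := Suc v, 10 := 32 + 3 * length st')"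
    have m2: "rep (st', B, out, Ret False) m2" "m2 22 = Suc v"
      using m1 False by (auto simp: m2_def base_def stored_upd)
    have "wp S attempt_prog (rep (attempt (Suc v) st' B out)) m2"
      by (rule attempt_prog[OF m2]) (use len in simp)
    with m1 False Cons e bd v len show ?thesis
      by (cases b; cases t) (auto simp: fail_prog_def m2_def base_def stored_upd)
  next
    case True
    have out: "32 + 3 * d + length out < A \<and> Suc (32 + 3 * d + length out) \<le> V"
      if "b = t" "length st' = B"
      using that True Cons e assms(2) A_ge V_ge by (auto simp: written_def)
    show ?thesis
    proof (cases "Suc (length st') = B")
      case B: True
      with m1 True Cons e bd v len show ?thesis
        by (cases b) (auto simp: success_prog_def base_def stored_upd)
    next
      case B: False
      show ?thesis
      proof (cases "b = t \<and> length st' = B")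
        case case1: True
        with m1 True Cons e bd v len B out show ?thesis
          by (auto simp: success_prog_def base_def stored_upd nth_append less_Suc_eq)
      next
        case False
        with m1 True Cons e bd v len B show ?thesis
          by (cases b; cases t) (auto simp: success_prog_def base_def stored_upd diff_add_diff_le)
      qed
    qed
  qed
  ultimately show ?thesis .
qed

definition move_time :: nat where
  "move_time = M * (d * 30 + 20) + d * 40 + 100"

lemma move_prog:
  assumes "proper a" "length (written (move a)) \<le> W" "mode_of a \<noteq> Done"
  shows "triple (\<lambda>m S'. S' = S \<and> rep a m) move_prog move_time (\<lambda>m S'. S' = S \<and> rep (move a) m)"
proof -
  obtain st B out mode where a: "a = (st, B, out, mode)" by (cases a)
  show ?thesis
  proof (cases mode)
    case Enter
    have "triple (\<lambda>m S'. (S' = S \<and> rep a m) \<and> m 14 \<noteq> 0) return_prog 0 (\<lambda>m S'. S' = S \<and> rep (move a) m)"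
      using a Enter by (auto simp: triple_def)
    moreover have "triple (\<lambda>m S'. (S' = S \<and> rep a m) \<and> m 14 = 0) enter_prog (M * (d * 30 + 20) + d * 40 + 90)
        (\<lambda>m S'. S' = S \<and> rep (move a) m)"
      unfolding a Enter
      by (rule triple_mono[OF enter_prog[OF assms(1,2)[unfolded a Enter]]]) auto
    ultimately show ?thesis unfolding move_prog_def
      by (rule triple_mono[OF triple_If]) (simp_all add: move_time_def)
  next
    case (Ret c)
    have 1: "triple (\<lambda>m S'. (S' = S \<and> rep a m) \<and> m 14 \<noteq> 0) return_prog (time return_prog) (\<lambda>m S'. S' = S \<and> rep (move a) m)"
      by (rule triple_wp) (use return_prog[of st B out c] assms(1,2) a Ret in auto)
    have 2: "triple (\<lambda>m S'. (S' = S \<and> rep a m) \<and> m 14 = 0) enter_prog 0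
        (\<lambda>m S'. S' = S \<and> rep (move a) m)"
      using a Ret by (auto simp: triple_def)
    have "time return_prog \<le> 90"
      by (simp add: return_prog_def success_prog_def fail_prog_def attempt_prog_def)
    then show ?thesis unfolding move_prog_def
      by (intro triple_mono[OF triple_If[OF 1 2]]) (simp_all add: move_time_def)
  qed (use assms a in \<open>simp add: mode_of_def\<close>)
qed

text \<open>The variant is the number of moves still to be made: if cell 13 is not 0, the mode is
  not \<open>Done\<close>, so at least one move remains. When the loop ends, \<open>move\<close>
  fixes the state reached, which is then \<open>b\<close>.\<close>

lemma main_loop:
  assumes fin: "(move ^^ j) a = b" "mode_of b = Done" "length (written b) \<le> W" and "proper a"
  shows "triple (\<lambda>m S'. S' = S \<and> rep a m) (While 13 move_prog) (j * (move_time + 1) + 1)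
    (\<lambda>m S'. S' = S \<and> rep b m)"
proof -
  define I where "I j m S' \<longleftrightarrow> S' = S \<and> (\<exists>a. proper a \<and> rep a m \<and> (move ^^ j) a = b)" for j m S'
  have "triple (\<lambda>m S'. I j m S' \<and> m 13 \<noteq> 0) move_prog move_time (\<lambda>m S'. \<exists>i<j. I i m S')" for j
    unfolding triple_def
  proof (intro allI impI)
    fix K m S' assume g: "good m S'" and "I j m S' \<and> m 13 \<noteq> 0"
    then obtain a where a: "S' = S" "proper a" "rep a m" "(move ^^ j) a = b" and m13: "m 13 \<noteq> 0"
      unfolding I_def by blast
    have nd: "mode_of a \<noteq> Done"
      using a(3) m13 by (cases a) (auto simp: mode_of_def)
    then obtain i where j: "j = Suc i" using a(4) fin(2) by (cases j) auto
    then have mv: "(move ^^ i) (move a) = b" using a(4) by (simp add: funpow_swap1)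
    then have W: "length (written (move a)) \<le> W" using written_funpow[of "move a" i] fin(3) by simp
    have "I i m S'" if "S' = S \<and> rep (move a) m" for m S'
      unfolding I_def using that mv proper_move[OF a(2)] by blast
    with j have ex: "\<exists>i<j. I i m S'" if "S' = S \<and> rep (move a) m" for m S'
      using that by blast
    have "triple (\<lambda>m S'. S' = S \<and> rep a m) move_prog move_time (\<lambda>m S'. \<exists>i<j. I i m S')"
      by (rule triple_mono[OF move_prog[OF a(2) W nd] order.refl]) (assumption, rule ex)
    from tripleD[OF this g] a
    show "attains D good_config move_time (reached K (\<lambda>m S'. \<exists>i<j. I i m S')) (move_prog # K, m, S')"
      by simp
  qed
  from triple_While[of I, OF this, of j] show ?thesis
  proof (rule triple_mono)
    fix m S' assume "m 13 = 0 \<and> (\<exists>i\<le>j. I i m S')"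
    then obtain i a where a: "S' = S" "rep a m" "(move ^^ i) a = b" "m 13 = 0" unfolding I_def by blast
    then have "mode_of a = Done" by (cases a) (auto simp: mode_of_def)
    with a move_Done show "S' = S \<and> rep b m" by metis
  next
    fix m S' assume "S' = S \<and> rep a m"
    then show "I j m S'" unfolding I_def using assms(1,4) by blast
  qed simp
qed

end

section \<open>Computing the parameters and drawing the samples\<close>

definition log_body :: "nat \<Rightarrow> prog" where
  "log_body l = blk [Instr (Add 17 17 17), Instr (Add l l 5), Instr (Sub 16 18 17)]"

definition log_init :: "nat \<Rightarrow> nat \<Rightarrow> prog" where
  "log_init x l = blk [Instr (Add 18 x 5), Instr (Const 17 1), Instr (Const l 0), Instr (Sub 16 18 17)]"

definition log_prog :: "nat \<Rightarrow> nat \<Rightarrow> prog" where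
  "log_prog x l = Seq (log_init x l) (While 16 (log_body l))"

definition repeat :: "nat \<Rightarrow> prog \<Rightarrow> prog" where
  "repeat r p = While r (Seq p (Instr (Sub r r 5)))"

text \<open>For \<open>s = 1\<close> the running time must not depend on \<open>n\<close>, and for \<open>n = 1\<close> not on \<open>s\<close>.  In these cases
  the problem is replaced by an equivalent one with at most one variable and size at most 2.\<close>

definition clamp_prog :: prog where
  "clamp_prog = blk [Instr (Const 1 2), Instr (Sub 16 5 0), Instr (Sub 0 5 16)]"

definition setup1 :: prog where
  "setup1 = blk [Instr (Const 5 1), Instr (Const 6 3), Instr (Sub 16 1 5), Instr (Sub 17 0 5),
     If 16 (If 17 skip clamp_prog) clamp_prog, Instr (Add 20 0 6)]"

definition setup2 :: prog where
  "setup2 = blk [Instr (Add 19 19 8), Instr (Add 19 19 5), Instr (Add 22 19 19), Instr (Add 22 22 19),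
     Instr (Add 7 22 22), Instr (Add 7 7 22), Instr (Const 1 32), Instr (Add 7 7 1), Instr (Const 23 2)]"

definition setup3 :: prog where
  "setup3 = blk [Instr (Const 10 32), Instr (Const 11 32), Instr (Add 12 7 4), Instr (Const 13 1),
     Instr (Const 14 0), Instr (Const 15 0)]"

text \<open>With addition only, powers are repeated doublings and products repeated additions. The
  numbers of rounds, \<open>d\<close>, \<open>floorlog 2 (N + 3)\<close> and \<open>2 * E\<close>,
  fit into the time bound.\<close>

definition draw_prog :: prog where
  "draw_prog = blk [setup1, log_prog 1 8, log_prog 2 19, log_prog 20 21, setup2,
     repeat 22 (Instr (Add 23 23 23)), repeat 21 (Instr (Add 3 3 23)),
     Instr (Add 2 2 2), Instr (Const 9 0), repeat 2 (Instr (Add 9 9 3)),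
     Instr (Add 2 9 4), repeat 2 (Instr Draw), setup3]"

context machine
begin

text \<open>\<open>floorlog 2 X\<close> is the least \<open>i\<close> with \<open>X < 2 ^ i\<close>,
  found by doubling. Storing \<open>Suc X\<close> turns \<open>2 ^ i \<le> X\<close> into a nonzero
  truncated difference. \<open>F\<close> is a frame preserved by writes to the scratch cells and to
  \<open>l\<close>.\<close>

lemma log_prog:
  assumes stable: "\<And>m r v. F m \<Longrightarrow> r \<in> {16, 17, 18, l} \<Longrightarrow> F (m(r := v))"
    and F: "\<And>m. F m \<Longrightarrow> m x = X \<and> m 5 = 1"
    and regs: "l \<notin> {5, 16, 17, 18}" "x \<notin> {16, 17, 18, l}" "l < A" and V: "2 * X + 2 \<le> V"
  shows "triple (\<lambda>m S. F m \<and> S = S0) (log_prog x l) (floorlog 2 X * 10 + 20)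
    (\<lambda>m S. (F m \<and> m l = floorlog 2 X) \<and> S = S0)"
proof -
  define I where "I j m S \<longleftrightarrow> F m \<and> S = S0 \<and> m l + j = floorlog 2 X \<and> m 17 = 2 ^ m l \<and>
     m 18 = Suc X \<and> m 16 = Suc X - m 17" for j m S
  have lt: "2 ^ i < Suc X \<longleftrightarrow> i < floorlog 2 X" for i
    using floorlog_le_iff[of 2 X i] by (auto simp: not_le[symmetric] less_Suc_eq_le)
  have body: "triple (\<lambda>m S. I j m S \<and> m 16 \<noteq> 0) (log_body l) (time (log_body l)) (\<lambda>m S. \<exists>i<j. I i m S)" for j
  proof (rule triple_wp)
    fix m S assume *: "I j m S \<and> m 16 \<noteq> 0"
    then have "2 ^ m l < Suc X" by (auto simp: I_def)
    then have p: "2 ^ m l \<le> X" and "m l < floorlog 2 X" using lt[of "m l"] by auto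
    then obtain i where i: "j = Suc i" using * by (cases j) (auto simp: I_def)
    have "m l < 2 ^ m l" by (rule less_exp)
    with p V have "Suc (m l) \<le> V" "2 ^ m l + 2 ^ m l \<le> V" by linarith+
    then have "wp S (log_body l) (\<lambda>m. I i m S) m"
      using * regs F[of m] i
      by (auto simp: log_body_def I_def intro!: stable)
    then show "wp S (log_body l) (\<lambda>m. \<exists>i<j. I i m S) m"
      by (rule wp_mono) (use i in auto)
  qed
  have "triple (\<lambda>m S. F m \<and> S = S0) (log_init x l) (time (log_init x l)) (I (floorlog 2 X))"
  proof (rule triple_wp)
    fix m S assume "F m \<and> S = S0"
    with regs F[of m] V show "wp S (log_init x l) (\<lambda>m. I (floorlog 2 X) m S) m"
      by (auto simp: log_init_def I_def intro!: stable)
  qed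
  from triple_Seq[OF this triple_While[of I, OF body, of "floorlog 2 X"]]
  show ?thesis unfolding log_prog_def
  proof (rule triple_mono)
    fix m S assume "m 16 = 0 \<and> (\<exists>i\<le>floorlog 2 X. I i m S)"
    then obtain i where "I i m S" "m 16 = 0" by auto
    with lt[of "m l"] show "(F m \<and> m l = floorlog 2 X) \<and> S = S0" by (auto simp: I_def)
  qed (simp_all add: log_init_def log_body_def)
qed

lemma repeat_instr:
  assumes "\<And>k m S. k < c \<Longrightarrow> good m S \<Longrightarrow> F k m S \<Longrightarrow> m r = c - k \<Longrightarrow> wpi S i (\<lambda>m'. F (Suc k) m' S \<and> m' r = c - k) m"
    and stable: "\<And>k m S v. F k m S \<Longrightarrow> F k (m(r := v)) S"
    and one: "\<And>k m S. F k m S \<Longrightarrow> m 5 = 1" and r: "r < A"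
  shows "triple (\<lambda>m S. F 0 m S \<and> m r = c) (repeat r (Instr i)) (c * 4 + 1) (F c)"
proof -
  have body: "triple (\<lambda>m S. F k m S \<and> m r = c - k) (Instr i) 1 (\<lambda>m S. F (Suc k) m S \<and> m r = c - k)" if "k < c" for k
    using triple_wp[of "\<lambda>m S. F k m S \<and> m r = c - k" "Instr i" "\<lambda>m S. F (Suc k) m S \<and> m r = c - k"] assms(1) that
    by simp
  have "triple (\<lambda>m S. F 0 m S \<and> m r = c) (While r (Seq (Instr i) (Instr (Sub r r 5)))) (c * (1 + 3) + 1) (F c)"
    by (rule triple_repeat) (erule body, erule stable, erule one, rule r)
  then show ?thesis by (simp add: repeat_def)
qed

end

text \<open>The factor 3 in \<open>d\<close> is due to \<open>(3/4) ^ 3 \<le> 1/2\<close>.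
  \<open>X\<close> is the union bound in bits: \<open>L\<close> for the confidence, the rest for the
  number of partial trees; \<open>M\<close> comes from dividing it by the accuracy
  \<open>\<epsilon> / 2\<close>. \<open>A\<close> adds up registers, stack and output, and the
  factor 2 in \<open>V\<close> leaves room for the last doubling in \<open>log_prog\<close>.\<close>

locale setting = machine D A V M for D :: "sample pmf" and A V M :: nat +
  fixes n s N s' E L R d w X :: nat
  assumes N_def: "N = (if s \<le> 1 \<or> n \<le> 1 then min n 1 else n)"
    and s'_def: "s' = (if s \<le> 1 \<or> n \<le> 1 then 2 else s)"
    and R_def: "R = floorlog 2 s'"
    and d_def: "d = 3 * (R + floorlog 2 E + 1)"
    and w_def: "w = 2 ^ Suc d"
    and X_def: "X = L + floorlog 2 (N + 3) * w"
    and M_def: "M = (E + E) * X"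
    and A_def: "A = 32 + 3 * d + w"
    and V_def: "V = 2 * (A + n + s + s' + E + L + X + M + R + 10)"
begin

lemma draw_prog:
  "triple (\<lambda>m S. m 0 = n \<and> m 1 = s \<and> m 2 = E \<and> m 3 = L \<and> m 4 = 0 \<and> S = [])
    draw_prog (time setup1 + time setup2 + time setup3 + 200 + 10 * (R + floorlog 2 E + floorlog 2 (N + 3)) +
      4 * (d + floorlog 2 (N + 3) + 2 * E + M))
    (\<lambda>m S. (m 0 = N \<and> m 1 = 32 \<and> m 4 = 0 \<and> m 5 = 1 \<and> m 6 = 3 \<and> m 7 = 32 + 3 * d \<and> m 8 = R \<and> m 9 = M \<and>
      m 10 = 32 \<and> m 11 = 32 \<and> m 12 = 32 + 3 * d \<and> m 13 = 1 \<and> m 14 = 0 \<and> m 15 = 0) \<and>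
      length S = M \<and> set S \<subseteq> set_pmf D)"
proof -
  let ?e = "floorlog 2 E" and ?g = "floorlog 2 (N + 3)"
  let ?P1 = "\<lambda>m. m 0 = N \<and> m 1 = s' \<and> m 2 = E \<and> m 3 = L \<and> m 4 = 0 \<and> m 5 = 1 \<and> m 6 = 3 \<and> m 20 = N + 3"
  let ?P2 = "\<lambda>m. m 0 = N \<and> m 1 = 32 \<and> m 4 = 0 \<and> m 5 = 1 \<and> m 6 = 3 \<and> m 7 = 32 + 3 * d \<and> m 8 = R"
  have NV: "N + 3 \<le> n + 3" by (auto simp: N_def)
  have s1: "triple (\<lambda>m S. m 0 = n \<and> m 1 = s \<and> m 2 = E \<and> m 3 = L \<and> m 4 = 0 \<and> S = []) setup1 (time setup1)
      (\<lambda>m S. ?P1 m \<and> S = [])"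
  proof (rule triple_wp)
    fix m :: mem and S :: "sample list" assume "m 0 = n \<and> m 1 = s \<and> m 2 = E \<and> m 3 = L \<and> m 4 = 0 \<and> S = []"
    moreover have "n + 3 \<le> V" "4 \<le> V" by (auto simp: V_def)
    \<comment> \<open>In the clamped case cell 0 becomes \<open>1 - (1 - n)\<close>, which is
      \<open>min n 1\<close> for truncated subtraction.\<close>
    ultimately show "wp S setup1 (\<lambda>m. ?P1 m \<and> S = []) m"
      by (auto simp: setup1_def clamp_prog_def N_def s'_def min_def)
  qed
  have s2: "triple (\<lambda>m S. ?P1 m \<and> S = []) (log_prog 1 8) (R * 10 + 20) (\<lambda>m S. (?P1 m \<and> m 8 = R) \<and> S = [])"
    unfolding R_def by (rule log_prog) (auto simp: V_def)
  have s3: "triple (\<lambda>m S. (?P1 m \<and> m 8 = R) \<and> S = []) (log_prog 2 19) (?e * 10 + 20)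
      (\<lambda>m S. ((?P1 m \<and> m 8 = R) \<and> m 19 = ?e) \<and> S = [])"
    by (rule log_prog) (auto simp: V_def)
  have s4: "triple (\<lambda>m S. ((?P1 m \<and> m 8 = R) \<and> m 19 = ?e) \<and> S = []) (log_prog 20 21) (?g * 10 + 20)
      (\<lambda>m S. (((?P1 m \<and> m 8 = R) \<and> m 19 = ?e) \<and> m 21 = ?g) \<and> S = [])"
    by (rule log_prog) (use NV in \<open>auto simp: V_def\<close>)
  have s5: "triple (\<lambda>m S. (((?P1 m \<and> m 8 = R) \<and> m 19 = ?e) \<and> m 21 = ?g) \<and> S = []) setup2 (time setup2)
      (\<lambda>m S. (?P2 m \<and> m 2 = E \<and> m 3 = L \<and> m 21 = ?g \<and> m 23 = 2 * 2 ^ 0 \<and> S = []) \<and> m 22 = d)"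
  proof (rule triple_wp)
    fix m :: mem and S :: "sample list" assume "(((?P1 m \<and> m 8 = R) \<and> m 19 = ?e) \<and> m 21 = ?g) \<and> S = []"
    moreover have "32 + 3 * d \<le> V" "3 * (R + ?e + 1) \<le> V" by (auto simp: V_def A_def d_def)
    ultimately show "wp S setup2 (\<lambda>m. (?P2 m \<and> m 2 = E \<and> m 3 = L \<and> m 21 = ?g \<and> m 23 = 2 * 2 ^ 0 \<and> S = []) \<and> m 22 = d) m"
      by (auto simp: setup2_def d_def)
  qed
  \<comment> \<open>Starting from 2, \<open>d\<close> doublings give \<open>2 ^ Suc d\<close>, which
    is \<open>w\<close>.\<close>
  have s6: "triple (\<lambda>m S. (?P2 m \<and> m 2 = E \<and> m 3 = L \<and> m 21 = ?g \<and> m 23 = 2 * 2 ^ 0 \<and> S = []) \<and> m 22 = d)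
      (repeat 22 (Instr (Add 23 23 23))) (d * 4 + 1)
      (\<lambda>m S. ?P2 m \<and> m 2 = E \<and> m 3 = L \<and> m 21 = ?g \<and> m 23 = 2 * 2 ^ d \<and> S = [])"
  proof (rule repeat_instr)
    fix k :: nat and m :: mem and S :: "sample list" assume "k < d" and *: "?P2 m \<and> m 2 = E \<and> m 3 = L \<and> m 21 = ?g \<and> m 23 = 2 * 2 ^ k \<and> S = []" "m 22 = d - k"
    then have "(2::nat) ^ Suc k \<le> 2 ^ d" by (intro power_increasing) auto
    then have "4 * 2 ^ k \<le> V" by (simp add: V_def A_def w_def)
    with * show "wpi S (Add 23 23 23) (\<lambda>m. (?P2 m \<and> m 2 = E \<and> m 3 = L \<and> m 21 = ?g \<and> m 23 = 2 * 2 ^ Suc k \<and> S = []) \<and> m 22 = d - k) m"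
      by simp
  qed auto
  have s7: "triple (\<lambda>m S. ?P2 m \<and> m 2 = E \<and> m 3 = L \<and> m 21 = ?g \<and> m 23 = 2 * 2 ^ d \<and> S = [])
      (repeat 21 (Instr (Add 3 3 23))) (?g * 4 + 1)
      (\<lambda>m S. ?P2 m \<and> m 2 = E \<and> m 3 = L + ?g * w \<and> m 23 = w \<and> S = [])"
  proof (rule triple_mono[OF repeat_instr[where c = "?g" and F = "\<lambda>k m S. ?P2 m \<and> m 2 = E \<and> m 3 = L + k * w \<and> m 23 = w \<and> S = []"]])
    fix k :: nat and m :: mem and S :: "sample list" assume "k < ?g" and *: "?P2 m \<and> m 2 = E \<and> m 3 = L + k * w \<and> m 23 = w \<and> S = []" "m 21 = ?g - k"
    then have "Suc k * w \<le> ?g * w" by (intro mult_le_mono) auto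
    then have "L + Suc k * w \<le> V" by (simp add: V_def X_def)
    with * show "wpi S (Add 3 3 23) (\<lambda>m. (?P2 m \<and> m 2 = E \<and> m 3 = L + Suc k * w \<and> m 23 = w \<and> S = []) \<and> m 21 = ?g - k) m"
      by (simp add: algebra_simps)
  qed (auto simp: w_def)
  have s8: "triple (\<lambda>m S. ?P2 m \<and> m 2 = E \<and> m 3 = L + ?g * w \<and> m 23 = w \<and> S = [])
     (Instr (Add 2 2 2)) (time (Instr (Add 2 2 2)))
     (\<lambda>m S. ?P2 m \<and> m 2 = E + E \<and> m 3 = X \<and> S = [])"
  proof -
    have "E + E \<le> V" by (simp add: V_def)
    then show ?thesis by (intro triple_wp) (auto simp: X_def)
  qed
  have s9: "triple (\<lambda>m S. ?P2 m \<and> m 2 = E + E \<and> m 3 = X \<and> S = []) (Instr (Const 9 0)) (time (Instr (Const 9 0)))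
     (\<lambda>m S. (?P2 m \<and> m 3 = X \<and> m 9 = 0 * X \<and> S = []) \<and> m 2 = E + E)"
    by (rule triple_wp) auto
  have s10: "triple (\<lambda>m S. (?P2 m \<and> m 3 = X \<and> m 9 = 0 * X \<and> S = []) \<and> m 2 = E + E)
      (repeat 2 (Instr (Add 9 9 3))) ((E + E) * 4 + 1)
      (\<lambda>m S. ?P2 m \<and> m 3 = X \<and> m 9 = (E + E) * X \<and> S = [])"
  proof (rule repeat_instr)
    fix k :: nat and m :: mem and S :: "sample list" assume "k < E + E" and *: "?P2 m \<and> m 3 = X \<and> m 9 = k * X \<and> S = []" "m 2 = E + E - k"
    then have "Suc k * X \<le> (E + E) * X" by (intro mult_le_mono) auto
    then have "Suc k * X \<le> V" by (simp add: V_def M_def)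
    with * show "wpi S (Add 9 9 3) (\<lambda>m. (?P2 m \<and> m 3 = X \<and> m 9 = Suc k * X \<and> S = []) \<and> m 2 = E + E - k) m"
      by (simp add: algebra_simps)
  qed auto
  have s11: "triple (\<lambda>m S. ?P2 m \<and> m 3 = X \<and> m 9 = (E + E) * X \<and> S = []) (Instr (Add 2 9 4)) (time (Instr (Add 2 9 4)))
     (\<lambda>m S. (?P2 m \<and> m 9 = M \<and> length S = 0 \<and> set S \<subseteq> set_pmf D) \<and> m 2 = M)"
  proof -
    have "(E + E) * X \<le> V" by (simp add: V_def M_def)
    then show ?thesis by (intro triple_wp) (auto simp: M_def)
  qed
  have s12: "triple (\<lambda>m S. (?P2 m \<and> m 9 = M \<and> length S = 0 \<and> set S \<subseteq> set_pmf D) \<and> m 2 = M)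
     (repeat 2 (Instr Draw)) (M * (1 + 3) + 1)
     (\<lambda>m S. ?P2 m \<and> m 9 = M \<and> length S = M \<and> set S \<subseteq> set_pmf D)"
    unfolding repeat_def
    by (rule triple_repeat[where F = "\<lambda>k m S. ?P2 m \<and> m 9 = M \<and> length S = k \<and> set S \<subseteq> set_pmf D"])
       (rule triple_Draw, auto)
  have s13: "triple (\<lambda>m S. ?P2 m \<and> m 9 = M \<and> length S = M \<and> set S \<subseteq> set_pmf D) setup3 (time setup3)
    (\<lambda>m S. (m 0 = N \<and> m 1 = 32 \<and> m 4 = 0 \<and> m 5 = 1 \<and> m 6 = 3 \<and> m 7 = 32 + 3 * d \<and> m 8 = R \<and> m 9 = M \<and>
      m 10 = 32 \<and> m 11 = 32 \<and> m 12 = 32 + 3 * d \<and> m 13 = 1 \<and> m 14 = 0 \<and> m 15 = 0) \<and>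
      length S = M \<and> set S \<subseteq> set_pmf D)"
  proof -
    have "32 + 3 * d \<le> V" by (simp add: V_def A_def)
    then show ?thesis by (intro triple_wp) (auto simp: setup3_def)
  qed
  note chain = triple_Seq[OF s1 triple_Seq[OF s2 triple_Seq[OF s3 triple_Seq[OF s4 triple_Seq[OF s5
       triple_Seq[OF s6 triple_Seq[OF s7 triple_Seq[OF s8 triple_Seq[OF s9 triple_Seq[OF s10
       triple_Seq[OF s11 triple_Seq[OF s12 s13]]]]]]]]]]]]
  show ?thesis
    unfolding draw_prog_def blk.simps by (rule triple_mono[OF chain]) simp_all
qed

end

section \<open>The distribution of the samples\<close>

lemma steps_0: "steps D 0 c = return_pmf c"
  by (simp add: steps_def)

lemma steps_Suc: "steps D (Suc t) c = bind_pmf (steps D t c) (step D)"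
  by (simp add: steps_def)

text \<open>\<open>Q\<close> implies halting, and a halted configuration is a fixed point of
  \<open>step\<close>, so \<open>Q\<close> persists from time \<open>t\<close> on. This carries
  facts about single runs over to the distribution \<open>steps\<close>.\<close>

lemma attains_steps:
  assumes "attains D J t Q c" and Q: "\<And>c. Q c \<Longrightarrow> halted c \<and> J c"
    and "c' \<in> set_pmf (steps D u c)"
  shows "J c'" "t \<le> u \<Longrightarrow> Q c'"
proof -
  have J: "J c" if "attains D J t Q c" for t c
    using that Q[of c] by (cases t) auto
  have step: "attains D J (t - 1) Q c'" if "attains D J t Q c" "c' \<in> set_pmf (step D c)" for t c c'
  proof (cases "Q c")
    case True
    then have "fst c = []" using Q by (simp add: halted_def)
    with that(2) have "c' = c" by (cases c) auto
    with True show ?thesis by (auto intro: attains_now)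
  next
    case False
    with that show ?thesis by (cases t) auto
  qed
  have "attains D J (t - u) Q c'"
    using assms(3)
  proof (induction u arbitrary: c')
    case 0
    then show ?case using assms(1) by (simp add: steps_0)
  next
    case (Suc u)
    then obtain c1 where "c1 \<in> set_pmf (steps D u c)" "c' \<in> set_pmf (step D c1)"
      by (auto simp: steps_Suc)
    with step[OF Suc.IH] show ?case by fastforce
  qed
  with J show "J c'" and "t \<le> u \<Longrightarrow> Q c'" by auto
qed

definition completed :: "sample pmf \<Rightarrow> nat \<Rightarrow> config \<Rightarrow> sample list pmf" where
  "completed D M c = map_pmf (\<lambda>r. snd (snd c) @ r) (replicate_pmf (M - length (snd (snd c))) D)"

text \<open>Drawing one sample and then completing by one fewer is the same as completing at once;
  other steps leave the list alone. The bound \<open>M\<close> guarantees that a sample is still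
  missing whenever one is drawn.\<close>

lemma completed_step:
  assumes "\<And>c'. c' \<in> set_pmf (step D c) \<Longrightarrow> samples_used c' \<le> M"
  shows "bind_pmf (step D c) (completed D M) = completed D M c"
proof (cases "\<exists>m S K. c = (Instr Draw # K, m, S)")
  case True
  then obtain m S K where c: "c = (Instr Draw # K, m, S)" by auto
  obtain z where "z \<in> set_pmf D" using set_pmf_not_empty by fast
  then have "Suc (length S) \<le> M" using assms[of "(K, m, S @ [z])"] by (simp add: c samples_used_def)
  then obtain k where k: "M - length S = Suc k" by (cases "M - length S") auto
  then have "M - Suc (length S) = k" by simp
  with k show ?thesis
    by (simp add: c completed_def bind_map_pmf map_bind_pmf map_pmf_comp) (simp add: map_pmf_def)
next
  case False
  have same: "snd (snd c') = snd (snd c)" if "c' \<in> set_pmf (step D c)" for c'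
  proof (cases "(D, c)" rule: step.cases)
    case (2 D' i K m S)
    with False that show ?thesis by (cases i) auto
  qed (use that in auto)
  have "bind_pmf (step D c) (completed D M) = bind_pmf (step D c) (\<lambda>_. completed D M c)"
    by (intro bind_pmf_cong refl) (simp add: completed_def same)
  then show ?thesis by simp
qed

text \<open>Extending the samples drawn so far by fresh ones to a list of length \<open>M\<close> is a martingale,
  whatever the program does.\<close>

lemma completed_steps:
  assumes "\<And>u c'. c' \<in> set_pmf (steps D u c) \<Longrightarrow> samples_used c' \<le> M"
  shows "bind_pmf (steps D t c) (completed D M) = completed D M c"
proof (induction t)
  case (Suc t)
  have "bind_pmf (steps D (Suc t) c) (completed D M)
      = bind_pmf (steps D t c) (\<lambda>c. bind_pmf (step D c) (completed D M))"
    by (simp add: steps_Suc bind_assoc_pmf)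
  also have "\<dots> = bind_pmf (steps D t c) (completed D M)"
    using assms[where u = "Suc t"] by (intro bind_pmf_cong refl completed_step) (auto simp: steps_Suc)
  finally show ?case using Suc by simp
qed (simp add: steps_0 bind_return_pmf)

text \<open>Once \<open>M\<close> samples are drawn, completion adds nothing, so the martingale
  identifies their law as that of independent samples.\<close>

lemma samples_distribution:
  assumes "\<And>u c'. c' \<in> set_pmf (steps D u (K, m, [])) \<Longrightarrow> samples_used c' \<le> M"
    and "\<And>c'. c' \<in> set_pmf (steps D t (K, m, [])) \<Longrightarrow> samples_used c' = M"
  shows "map_pmf (\<lambda>c. snd (snd c)) (steps D t (K, m, [])) = replicate_pmf M D"
proof -
  have "replicate_pmf M D = completed D M (K, m, [])" by (simp add: completed_def)
  also have "\<dots> = bind_pmf (steps D t (K, m, [])) (completed D M)"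
    using completed_steps[OF assms(1)] by simp
  also have "\<dots> = bind_pmf (steps D t (K, m, [])) (\<lambda>c. return_pmf (snd (snd c)))"
    by (intro bind_pmf_cong refl) (use assms(2) in \<open>simp add: completed_def samples_used_def\<close>)
  finally show ?thesis by (simp add: map_pmf_def)
qed

section \<open>Generalization\<close>

lemma prob_replicate:
  fixes D :: "'a :: countable pmf"
  shows "measure_pmf.prob (replicate_pmf k D) {xs. \<forall>x\<in>set xs. H x} = measure_pmf.prob D {x. H x} ^ k"
proof (induction k)
  case 0
  then show ?case by simp
next
  case (Suc k)
  have "replicate_pmf (Suc k) D = map_pmf (\<lambda>(x, xs). x # xs) (pair_pmf D (replicate_pmf k D))"
    by (simp add: pair_pmf_def map_bind_pmf)
  moreover have "(\<lambda>(x, xs). x # xs) -` {xs. \<forall>x\<in>set xs. H x} = {x. H x} \<times> {xs. \<forall>x\<in>set xs. H x}"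
    by auto
  ultimately have "measure_pmf.prob (replicate_pmf (Suc k) D) {xs. \<forall>x\<in>set xs. H x} =
      measure_pmf.prob (pair_pmf D (replicate_pmf k D)) ({x. H x} \<times> {xs. \<forall>x\<in>set xs. H x})"
    by simp
  also have "\<dots> = measure_pmf.prob D {x. H x} * measure_pmf.prob (replicate_pmf k D) {xs. \<forall>x\<in>set xs. H x}"
    by (intro measure_pmf_prob_product) auto
  finally show ?case using Suc by simp
qed

text \<open>Label 0 marks an undecided leaf.\<close>

definition misleading :: "nat \<Rightarrow> (bool list \<Rightarrow> int) \<Rightarrow> real \<Rightarrow> nat \<Rightarrow> nat \<Rightarrow> sample list \<Rightarrow> bool" where
  "misleading n f \<epsilon> N d S \<longleftrightarrow> (\<exists>T\<in>partial_trees N d.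
     \<epsilon> < measure_pmf.prob (pmf_of_set (cube n)) {x. dt_eval T x \<notin> {0, f x}} \<and>
     (\<forall>z\<in>set S. dt_eval T (fst z) \<in> {0, snd z}))"

text \<open>A bad tree survives \<open>M\<close> samples with probability at most
  \<open>(1 - \<epsilon>) ^ M \<le> exp (- X) \<le> (1/2) ^ X\<close>, and there are at most
  \<open>2 ^ (X - L)\<close> such trees.\<close>

lemma prob_misleading:
  fixes \<epsilon> :: real
  assumes "0 < \<epsilon>" "real X / \<epsilon> \<le> real M" "X = L + floorlog 2 (N + 3) * 2 ^ Suc d"
  shows "measure_pmf.prob (replicate_pmf M (random_sample n f)) {S. misleading n f \<epsilon> N d S} \<le> (1/2) ^ L"
proof -
  let ?D = "random_sample n f" and ?U = "pmf_of_set (cube n)"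
  define bad where "bad = {T \<in> partial_trees N d. \<epsilon> < measure_pmf.prob ?U {x. dt_eval T x \<notin> {0, f x}}}"
  have fin: "finite bad" using card_partial_trees[of N d] by (simp add: bad_def)
  have "{S. misleading n f \<epsilon> N d S} = (\<Union>T\<in>bad. {S. \<forall>z\<in>set S. dt_eval T (fst z) \<in> {0, snd z}})"
    by (auto simp: misleading_def bad_def)
  then have "measure_pmf.prob (replicate_pmf M ?D) {S. misleading n f \<epsilon> N d S} \<le>
      (\<Sum>T\<in>bad. measure_pmf.prob (replicate_pmf M ?D) {S. \<forall>z\<in>set S. dt_eval T (fst z) \<in> {0, snd z}})"
    using fin by (simp only:) (intro measure_pmf.finite_measure_subadditive_finite, auto)
  also have "\<dots> \<le> (\<Sum>T\<in>bad. (1/2) ^ X)"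
  proof (rule sum_mono)
    fix T assume T: "T \<in> bad"
    let ?p = "measure_pmf.prob ?D {z. dt_eval T (fst z) \<in> {0, snd z}}"
    have "?p = measure_pmf.prob ?U (UNIV - {x. dt_eval T x \<notin> {0, f x}})"
      unfolding random_sample_def measure_map_pmf by (rule arg_cong[where f = "measure_pmf.prob ?U"]) auto
    also have "\<dots> = 1 - measure_pmf.prob ?U {x. dt_eval T x \<notin> {0, f x}}"
      using measure_pmf.prob_compl[of "{x. dt_eval T x \<notin> {0, f x}}" ?U] by simp
    finally have "?p \<le> 1 - \<epsilon>" using T by (simp add: bad_def)
    also have "\<dots> \<le> exp (- \<epsilon>)" using exp_ge_add_one_self[of "- \<epsilon>"] by simp
    finally have p: "?p \<le> exp (- \<epsilon>)" .
    have "measure_pmf.prob (replicate_pmf M ?D) {S. \<forall>z\<in>set S. dt_eval T (fst z) \<in> {0, snd z}} = ?p ^ M"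
      by (rule prob_replicate)
    also have "\<dots> \<le> exp (- \<epsilon>) ^ M" using p by (intro power_mono) auto
    also have "\<dots> = exp (- (real M * \<epsilon>))" by (simp add: exp_of_nat_mult[symmetric])
    also have "\<dots> \<le> exp (- real X)" using assms(1,2) by (simp add: field_simps)
    also have "\<dots> = exp (- 1) ^ X" by (simp add: exp_of_nat_mult[symmetric])
    also have "\<dots> \<le> (1/2) ^ X"
    proof (rule power_mono)
      have "2 \<le> exp (1::real)" using exp_ge_add_one_self[of "1::real"] by simp
      then show "exp (- 1) \<le> (1/2::real)" by (simp add: exp_minus field_simps)
    qed simp
    finally show "measure_pmf.prob (replicate_pmf M ?D) {S. \<forall>z\<in>set S. dt_eval T (fst z) \<in> {0, snd z}} \<le> (1/2) ^ X" .
  qed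
  also have "\<dots> = real (card bad) * (1/2) ^ X" by simp
  also have "\<dots> \<le> 2 ^ (floorlog 2 (N + 3) * 2 ^ Suc d) * (1/2) ^ X"
  proof (rule mult_right_mono)
    have "card bad \<le> card (partial_trees N d)"
      using card_partial_trees[of N d] by (intro card_mono) (auto simp: bad_def)
    also have "\<dots> \<le> (N + 3) ^ (2 ^ Suc d - 1)" using card_partial_trees[of N d] by simp
    also have "\<dots> \<le> (N + 3) ^ (2 ^ Suc d)" by (intro power_increasing) auto
    also have "\<dots> \<le> (2 ^ floorlog 2 (N + 3)) ^ (2 ^ Suc d)"
      using floorlog_bounds[of "N + 3" 2] by (intro power_mono) auto
    finally have "card bad \<le> 2 ^ (floorlog 2 (N + 3) * 2 ^ Suc d)" by (simp add: power_mult)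
    then have "real (card bad) \<le> real (2 ^ (floorlog 2 (N + 3) * 2 ^ Suc d))" by (rule of_nat_mono)
    then show "real (card bad) \<le> 2 ^ (floorlog 2 (N + 3) * 2 ^ Suc d)" by simp
  qed simp
  also have "\<dots> = (1/2) ^ L"
    unfolding assms(3) power_add by (simp add: power_one_over)
  finally show ?thesis .
qed

lemma finite_cube: "finite (cube n)" and cube_nonempty: "cube n \<noteq> {}" and card_cube: "card (cube n) = 2 ^ n"
  using finite_lists_length_eq[of "UNIV :: bool set" n] card_lists_length_eq[of "UNIV :: bool set" n]
    Ex_list_of_length[of n]
  by (auto simp: cube_def)

text \<open>Half of \<open>\<epsilon>\<close> pays for inputs where the partial tree is decided but
  wrong, the other half for undecided inputs, whatever label the output has there.\<close>

lemma (in search) build_approximates: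
  assumes "ok []" "N \<le> n" "\<not> misleading n f (\<epsilon> / 2) N d S"
    and "2 ^ R * (3/4) ^ d \<le> \<epsilon> / 2"
    and S: "\<And>z. z \<in> set S \<Longrightarrow> fst z \<in> cube n \<and> snd z = f (fst z)"
    and f: "\<forall>x\<in>cube n. f x \<in> {-1, 1}"
  shows "approximates n \<epsilon> (build label []) f"
proof -
  let ?T = "build (\<lambda>_. 0) []" and ?U = "pmf_of_set (cube n)"
  have "?T \<in> partial_trees N d" using build_in_partial_trees[OF assms(1)] by simp
  moreover have "\<forall>z\<in>set S. dt_eval ?T (fst z) \<in> {0, snd z}"
  proof
    fix z assume z: "z \<in> set S"
    from S[OF z] f assms(2) show "dt_eval ?T (fst z) \<in> {0, snd z}"
      by (intro build_consistent[OF assms(1) z]) (auto simp: cube_def)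
  qed
  ultimately have 1: "measure_pmf.prob ?U {x. dt_eval ?T x \<notin> {0, f x}} \<le> \<epsilon> / 2"
    using assms(3) unfolding misleading_def by (meson not_le)
  have "measure_pmf.prob ?U {x. dt_eval ?T x = 0} = real (card {x \<in> cube n. matches [] x \<and> dt_eval ?T x = 0}) / 2 ^ n"
    using finite_cube cube_nonempty by (simp add: measure_pmf_of_set card_cube Int_def)
  also have "\<dots> \<le> 2 ^ R * (3/4) ^ d"
    using card_truncated[OF assms(1,2)] by (simp add: field_simps)
  finally have 2: "measure_pmf.prob ?U {x. dt_eval ?T x = 0} \<le> \<epsilon> / 2" using assms(4) by simp
  have "measure_pmf.prob ?U {x. dt_eval (build label []) x \<noteq> f x} \<le>
      measure_pmf.prob ?U ({x. dt_eval ?T x \<notin> {0, f x}} \<union> {x. dt_eval ?T x = 0})"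
  proof (rule measure_pmf.finite_measure_mono)
    show "{x. dt_eval (build label []) x \<noteq> f x} \<subseteq> {x. dt_eval ?T x \<notin> {0, f x}} \<union> {x. dt_eval ?T x = 0}"
      using build_agrees[OF assms(1), of _ label] by auto
  qed simp
  also have "\<dots> \<le> measure_pmf.prob ?U {x. dt_eval ?T x \<notin> {0, f x}} + measure_pmf.prob ?U {x. dt_eval ?T x = 0}"
    by (rule measure_Un_le) auto
  finally show ?thesis using 1 2 by (simp add: approximates_def)
qed

section \<open>Correctness of the program\<close>

text \<open>Cell 0 serves as \<open>N\<close> during the search; the last instruction replaces it by
  the output address from cell 7, as \<open>returns\<close> demands.\<close>

definition learner :: prog where
  "learner = Seq draw_prog (Seq (While 13 move_prog) (Instr (Add 0 7 4)))"

definition loop_time :: "nat \<Rightarrow> nat \<Rightarrow> nat \<Rightarrow> nat \<Rightarrow> nat" where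
  "loop_time N R d M =
     2 ^ Suc d * (4 + 2 * N * Suc ((4 * N + 3) ^ R * 2 ^ d)) * (M * (d * 30 + 20) + d * 40 + 101) + 1"

definition setup_time :: "nat \<Rightarrow> nat \<Rightarrow> nat \<Rightarrow> nat \<Rightarrow> nat \<Rightarrow> nat" where
  "setup_time N R E d M = 400 + 10 * (R + floorlog 2 E + floorlog 2 (N + 3)) +
     4 * (d + floorlog 2 (N + 3) + 2 * E + M)"

definition total_time :: "nat \<Rightarrow> nat \<Rightarrow> nat \<Rightarrow> nat \<Rightarrow> nat \<Rightarrow> nat" where
  "total_time N R E d M = setup_time N R E d M + loop_time N R d M + 10"

context implementation
begin

lemma search_triple:
  assumes "ok []" "2 ^ Suc d \<le> W"
  shows "triple (\<lambda>m S'. S' = S \<and> rep ([], 0, [], Enter) m)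
    (Seq (While 13 move_prog) (Instr (Add 0 7 4))) (loop_time N R d M + 2)
    (\<lambda>m S'. S' = S \<and> (\<forall>k<length (encode (build label [])). m (m 0 + k) = encode (build label []) ! k))"
proof -
  let ?t = "encode (build label [])"
  from reach_tree[OF assms(1)] obtain j where j: "j \<le> 2 ^ Suc d * node_time"
      "(move ^^ j) ([], 0, [], Enter) = ([], 0, ?t, Done)" by (auto simp: reach_def)
  have "length ?t \<le> W" using length_encode_build[of label "[]"] assms(2) by simp
  then have 1: "triple (\<lambda>m S'. S' = S \<and> rep ([], 0, [], Enter) m) (While 13 move_prog) (j * (move_time + 1) + 1)
      (\<lambda>m S'. S' = S \<and> rep ([], 0, ?t, Done) m)"
    by (intro main_loop[OF j(2)]) (auto simp: mode_of_def written_def)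
  have 2: "triple (\<lambda>m S'. S' = S \<and> rep ([], 0, ?t, Done) m) (Instr (Add 0 7 4)) (time (Instr (Add 0 7 4)))
      (\<lambda>m S'. S' = S \<and> (\<forall>k<length ?t. m (m 0 + k) = ?t ! k))"
    using A_ge V_ge by (intro triple_wp) (auto simp: base_def)
  have "j * (move_time + 1) \<le> 2 ^ Suc d * node_time * (move_time + 1)"
    using j(1) by (rule mult_le_mono1)
  moreover have "loop_time N R d M = 2 ^ Suc d * node_time * (move_time + 1) + 1"
    by (simp add: loop_time_def node_time_def ok_time_def move_time_def)
  ultimately have "j * (move_time + 1) + 1 \<le> loop_time N R d M" by linarith
  then show ?thesis by (intro triple_mono[OF triple_Seq[OF 1 2]]) simp_all
qed

end

text \<open>Clamping loses nothing: a tree of size 1, or without variables, is a leaf, and on one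
  variable two leaves suffice however large \<open>s\<close> is.\<close>

lemma small_tree_exists:
  assumes f: "computable_by_size n f s" and N: "N = (if s \<le> 1 \<or> n \<le> 1 then min n 1 else n)"
    and R: "R = floorlog 2 (if s \<le> 1 \<or> n \<le> 1 then 2 else s)"
  obtains T where "dtree_on N T" "leaves T \<le> 2 ^ R" "\<And>x. x \<in> cube n \<Longrightarrow> dt_eval T x = f x"
proof -
  from f obtain T where T: "dtree_on n T" "leaves T = s" "\<And>x. x \<in> cube n \<Longrightarrow> dt_eval T x = f x"
    by (auto simp: computable_by_size_def)
  have pos: "1 \<le> leaves T" for T by (induction T) auto
  have R2: "floorlog 2 2 = 2" by (simp add: compute_floorlog)
  show thesis
  proof (cases "s \<le> 1 \<or> n \<le> 1")
    case False
    then have "s < 2 ^ R" using floorlog_bounds[of s 2] R by auto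
    with False T N show thesis by (intro that[of T]) auto
  next
    case True
    show thesis
    proof (cases T)
      case (Leaf y)
      with T True N show thesis by (intro that[of T]) auto
    next
      case (Node i l r)
      have "s \<ge> 2" using T(2) Node pos[of l] pos[of r] by simp
      with True T(1) Node have n: "n = 1" by (cases n) auto
      with T(1) Node have i: "i = 0" by simp
      have *: "dtree_on n U \<Longrightarrow> dt_eval U x \<in> {-1, 1}" for U x by (induction U) auto
      define U where "U = Node 0 (Leaf (f [False])) (Leaf (f [True]))"
      have c: "[False] \<in> cube n" "[True] \<in> cube n" by (auto simp: cube_def n)
      show thesis
      proof (rule that[of U])
        show "dtree_on N U"
          using *[OF T(1), of "[False]"] *[OF T(1), of "[True]"] T(3)[OF c(1)] T(3)[OF c(2)] by (auto simp: U_def N n)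
        show "leaves U \<le> 2 ^ R" using True R R2 by (simp add: U_def)
        show "dt_eval U x = f x" if "x \<in> cube n" for x
          using that by (cases x) (auto simp: U_def cube_def n)
      qed
    qed
  qed
qed

context setting
begin

text \<open>\<open>ok\<close> is assumed for every list in the support because the time bound is to
  hold on all runs. The list is known only after the draws, so \<open>implementation\<close> is
  interpreted inside the proof.\<close>

lemma learner_triple:
  assumes ok: "\<And>S. set S \<subseteq> set_pmf D \<Longrightarrow> search.ok S N d R []"
  shows "triple (\<lambda>m S. m 0 = n \<and> m 1 = s \<and> m 2 = E \<and> m 3 = L \<and> m 4 = 0 \<and> S = []) learner
    (total_time N R E d M)
    (\<lambda>m S. length S = M \<and> set S \<subseteq> set_pmf D \<and>
      (\<forall>k<length (encode (search.build S N d R (search.label S) [])).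
         m (m 0 + k) = encode (search.build S N d R (search.label S) []) ! k))"
proof -
  let ?Q = "\<lambda>m S. length S = M \<and> set S \<subseteq> set_pmf D \<and>
      (\<forall>k<length (encode (search.build S N d R (search.label S) [])).
         m (m 0 + k) = encode (search.build S N d R (search.label S) []) ! k)"
  have "triple (\<lambda>m S. (m 0 = N \<and> m 1 = 32 \<and> m 4 = 0 \<and> m 5 = 1 \<and> m 6 = 3 \<and> m 7 = 32 + 3 * d \<and> m 8 = R \<and> m 9 = M \<and>
      m 10 = 32 \<and> m 11 = 32 \<and> m 12 = 32 + 3 * d \<and> m 13 = 1 \<and> m 14 = 0 \<and> m 15 = 0) \<and>
      length S = M \<and> set S \<subseteq> set_pmf D) (Seq (While 13 move_prog) (Instr (Add 0 7 4))) (loop_time N R d M + 2) ?Q"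
    unfolding triple_def
  proof (intro allI impI, elim conjE)
    fix K m S
    assume g: "good m S" and S: "length S = M" "set S \<subseteq> set_pmf D"
      and m: "m 0 = N" "m 1 = 32" "m 4 = 0" "m 5 = 1" "m 6 = 3" "m 7 = 32 + 3 * d" "m 8 = R" "m 9 = M"
        "m 10 = 32" "m 11 = 32" "m 12 = 32 + 3 * d" "m 13 = 1" "m 14 = 0" "m 15 = 0"
    have "N \<le> n" by (auto simp: N_def)
    then interpret implementation S N d R D A V M w
      by unfold_locales (use S in \<open>simp_all add: A_def V_def\<close>)
    have rp: "rep ([], 0, [], Enter) m" using m by (simp add: base_def)
    have tri: "triple (\<lambda>m S'. S' = S \<and> rep ([], 0, [], Enter) m)
      (Seq (While 13 move_prog) (Instr (Add 0 7 4))) (loop_time N R d M + 2) ?Q"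
      by (rule triple_mono[OF search_triple]) (use ok S w_def in auto)
    show "attains D good_config (loop_time N R d M + 2) (reached K ?Q)
        (Seq (While 13 move_prog) (Instr (Add 0 7 4)) # K, m, S)"
      by (rule tripleD[OF tri g]) (use rp in blast)
  qed
  from triple_Seq[OF draw_prog this]
  show ?thesis unfolding learner_def
    by (rule triple_mono)
       (simp_all add: total_time_def setup_time_def setup1_def setup2_def setup3_def clamp_prog_def)
qed

lemma learner_correct:
  assumes D: "D = random_sample n f" and comp: "computable_by_size n f s"
    and f: "\<forall>x\<in>cube n. f x \<in> {-1, 1}" and eps: "\<epsilon> > 0" and del: "\<delta> > 0"
    and E: "E = nat \<lceil>1 / \<epsilon>\<rceil>" and L: "L = nat \<lceil>log 2 (1 / \<delta>)\<rceil>"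
  shows "\<forall>c\<in>set_pmf (run_for learner n s \<epsilon> \<delta> f (total_time N R E d M)). halted c"
    and "1 - \<delta> \<le> measure_pmf.prob (run_for learner n s \<epsilon> \<delta> f (total_time N R E d M))
      {c. \<exists>T. returns n c T \<and> approximates n \<epsilon> T f}"
    and "c \<in> set_pmf (run_for learner n s \<epsilon> \<delta> f t) \<Longrightarrow>
      memory_used c \<le> A * (floorlog 2 A + floorlog 2 V) \<and> samples_used c \<le> M"
proof -
  let ?m = "initial_mem n s \<epsilon> \<delta>" and ?t = "total_time N R E d M"
  define tree where "tree S = search.build S N d R (search.label S) []" for S
  have N: "N \<le> n" by (auto simp: N_def)
  obtain T where T: "dtree_on N T" "leaves T \<le> 2 ^ R" "\<And>x. x \<in> cube n \<Longrightarrow> dt_eval T x = f x"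
    using small_tree_exists[OF comp N_def R_def[unfolded s'_def]] by blast
  have SD: "fst z \<in> cube n \<and> snd z = f (fst z)" if "set S \<subseteq> set_pmf D" "z \<in> set S" for S :: "sample list" and z
    using that finite_cube cube_nonempty by (auto simp: D random_sample_def)
  have ok: "search.ok S N d R []" if "set S \<subseteq> set_pmf D" for S
    using SD[OF that] T N by (intro search.ok_if_small_tree[of T]) (auto simp: cube_def)
  define Q :: "mem \<Rightarrow> sample list \<Rightarrow> bool" where
    "Q m S \<longleftrightarrow> length S = M \<and> set S \<subseteq> set_pmf D \<and>
      (\<forall>k<length (encode (tree S)). m (m 0 + k) = encode (tree S) ! k)" for m S
  have "4 \<le> A" "n \<le> V" "s \<le> V" "E \<le> V" "L \<le> V" by (auto simp: A_def V_def)
  then have "good ?m []"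
    by (auto simp: good_def bounded_mem_def initial_mem_def E[symmetric] L[symmetric])
  moreover have "?m 0 = n \<and> ?m 1 = s \<and> ?m 2 = E \<and> ?m 3 = L \<and> ?m 4 = 0"
    by (auto simp: initial_mem_def E L)
  ultimately have run: "attains D good_config ?t (reached [] Q) ([learner], ?m, [])"
    using tripleD[OF learner_triple[OF ok]] unfolding Q_def tree_def by blast
  have fin: "halted c \<and> good_config c" if "reached [] Q c" for c
    using that by (auto simp: reached_def halted_def good_config_def)
  have always: "good_config c" if "c \<in> set_pmf (steps D u ([learner], ?m, []))" for c u
    using attains_steps(1)[OF run _ that] fin by blast
  have final: "reached [] Q c" if "c \<in> set_pmf (steps D u ([learner], ?m, []))" "?t \<le> u" for c u
    using attains_steps(2)[OF run _ that] fin by blast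
  have rf: "run_for learner n s \<epsilon> \<delta> f t = steps D t ([learner], ?m, [])" for t
    by (simp add: run_for_def D)
  show "\<forall>c\<in>set_pmf (run_for learner n s \<epsilon> \<delta> f ?t). halted c"
    using final[of _ ?t] fin by (auto simp: rf)
  have used: "samples_used c \<le> M" if "c \<in> set_pmf (steps D t ([learner], ?m, []))" for c t
    using always[OF that] by (auto simp: samples_used_def good_config_def good_def)
  show "memory_used c \<le> A * (floorlog 2 A + floorlog 2 V) \<and> samples_used c \<le> M"
    if "c \<in> set_pmf (run_for learner n s \<epsilon> \<delta> f t)"
    using always[of c t] used[of c t] that
    by (auto simp: rf memory_used_def good_config_def good_def intro: mem_bits_le)
  have dist: "map_pmf (\<lambda>c. snd (snd c)) (steps D ?t ([learner], ?m, [])) = replicate_pmf M D"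
    by (rule samples_distribution)
       (use used final in \<open>auto simp: samples_used_def reached_def Q_def\<close>)
  have E1: "1 / \<epsilon> \<le> real E" unfolding E by (rule real_nat_ceiling_ge)
  have L1: "(1 / 2) ^ L \<le> \<delta>"
  proof -
    have "log 2 (1 / \<delta>) \<le> real L" unfolding L by (rule real_nat_ceiling_ge)
    then have "1 / \<delta> \<le> 2 powr real L" using del by (simp add: log_le_iff)
    then show ?thesis using del by (simp add: powr_realpow power_one_over field_simps)
  qed
  have trunc: "2 ^ R * (3/4) ^ d \<le> \<epsilon> / 2"
  proof -
    have "E \<noteq> 0" using E1 eps by (intro notI) (simp add: field_simps)
    then have "E \<le> 2 ^ floorlog 2 E" using floorlog_bounds[of E 2] by auto
    then have "1 / \<epsilon> \<le> real (2 ^ floorlog 2 E)" by (rule order.trans[OF E1 of_nat_mono])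
    then have E2: "1 / \<epsilon> \<le> 2 ^ floorlog 2 E" by simp
    \<comment> \<open>Three levels gain a factor \<open>27/64\<close>, below \<open>1/2\<close>. Of
      these halvings \<open>R\<close> cancel \<open>2 ^ R\<close>, \<open>floorlog 2 E\<close> give
      \<open>\<epsilon>\<close>, and the last one gives the remaining \<open>1/2\<close>.\<close>
    have "(3/4 :: real) ^ d = (27/64) ^ (R + floorlog 2 E + 1)"
      unfolding d_def power_mult by (simp add: power3_eq_cube)
    also have "\<dots> \<le> (1/2) ^ (R + floorlog 2 E + 1)" by (intro power_mono) auto
    finally have "2 ^ R * (3/4 :: real) ^ d \<le> 2 ^ R * (1/2) ^ (R + floorlog 2 E + 1)" by simp
    also have "\<dots> = (1 / 2 ^ floorlog 2 E) / 2" by (simp add: power_add power_one_over)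
    also have "\<dots> \<le> \<epsilon> / 2" using E2 eps by (simp add: field_simps)
    finally show ?thesis .
  qed
  have "real X / (\<epsilon> / 2) \<le> real M"
  proof -
    have "real X / (\<epsilon> / 2) = (1 / \<epsilon>) * (2 * real X)" by simp
    also have "\<dots> \<le> real E * (2 * real X)" using E1 by (intro mult_right_mono) auto
    finally show ?thesis by (simp add: M_def)
  qed
  then have "measure_pmf.prob (replicate_pmf M D) {S. misleading n f (\<epsilon> / 2) N d S} \<le> \<delta>"
    using prob_misleading[of "\<epsilon> / 2" X M L N d n f] L1 eps by (simp add: D X_def w_def)
  then have "1 - \<delta> \<le> measure_pmf.prob (replicate_pmf M D) (UNIV - {S. misleading n f (\<epsilon> / 2) N d S})"
    using measure_pmf.prob_compl[of "{S. misleading n f (\<epsilon> / 2) N d S}" "replicate_pmf M D"] by simp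
  also have "\<dots> = measure_pmf.prob (steps D ?t ([learner], ?m, []))
      ((\<lambda>c. snd (snd c)) -` (UNIV - {S. misleading n f (\<epsilon> / 2) N d S}))"
    unfolding dist[symmetric] by simp
  also have "\<dots> \<le> measure_pmf.prob (steps D ?t ([learner], ?m, [])) {c. \<exists>T. returns n c T \<and> approximates n \<epsilon> T f}"
  \<comment> \<open>The inclusion is needed only on the support, where the final configuration is
    known to satisfy \<open>Q\<close>.\<close>
  proof (rule measure_pmf.finite_measure_mono_AE)
    show "AE c in measure_pmf (steps D ?t ([learner], ?m, [])).
      c \<in> (\<lambda>c. snd (snd c)) -` (UNIV - {S. misleading n f (\<epsilon> / 2) N d S}) \<longrightarrow>
      c \<in> {c. \<exists>T. returns n c T \<and> approximates n \<epsilon> T f}"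
    proof (rule AE_pmfI, rule impI, rule CollectI)
      fix c
      assume c: "c \<in> set_pmf (steps D ?t ([learner], ?m, []))"
        and good: "c \<in> (\<lambda>c. snd (snd c)) -` (UNIV - {S. misleading n f (\<epsilon> / 2) N d S})"
      define S where "S = snd (snd c)"
      interpret search S N d R .
      have r: "reached [] Q c" by (rule final[OF c order.refl])
      then have S: "set S \<subseteq> set_pmf D" by (simp add: reached_def Q_def S_def)
      have t: "tree S = build label []" by (simp add: tree_def)
      have "dtree_on N (tree S)" unfolding t
        by (rule dtree_on_build[OF _ ok[OF S]]) (simp add: label_def)
      moreover have "dtree_on N U \<Longrightarrow> dtree_on n U" for U using N by (induction U) auto
      ultimately have "returns n c (tree S)"
        using r by (auto simp: returns_def reached_def halted_def Q_def S_def Let_def)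
      moreover have "approximates n \<epsilon> (tree S) f" unfolding t
        using good SD[OF S] f by (intro build_approximates[OF ok[OF S] N _ trunc]) (auto simp: S_def)
      ultimately show "\<exists>T. returns n c T \<and> approximates n \<epsilon> T f" by blast
    qed
  qed simp
  finally show "1 - \<delta> \<le> measure_pmf.prob (run_for learner n s \<epsilon> \<delta> f ?t)
      {c. \<exists>T. returns n c T \<and> approximates n \<epsilon> T f}"
    by (simp add: rf)
qed

end

section \<open>Polynomial bounds\<close>

text \<open>\<open>P\<close> is a set of parameter tuples, and \<open>C\<close> and \<open>k\<close>
  are uniform over it. When \<open>B\<close> is at least 1 exponents can be raised, so sums and
  products stay dominated.\<close>

definition dominated :: "'p set \<Rightarrow> ('p \<Rightarrow> real) \<Rightarrow> ('p \<Rightarrow> nat) \<Rightarrow> bool" where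
  "dominated P B g \<longleftrightarrow> (\<exists>C k. \<forall>p\<in>P. real (g p) \<le> real C * B p ^ k)"

locale growth =
  fixes P :: "'p set" and B :: "'p \<Rightarrow> real"
  assumes B: "p \<in> P \<Longrightarrow> 1 \<le> B p"
begin

abbreviation "pdom \<equiv> dominated P B"

lemma pdom_real: "(\<And>p. p \<in> P \<Longrightarrow> real (g p) \<le> real C * B p ^ k) \<Longrightarrow> pdom g"
  unfolding dominated_def by blast

lemma pdom_const: "pdom (\<lambda>_. c)"
  by (rule pdom_real[of _ c 0]) simp

lemma pdom_mono: "pdom h \<Longrightarrow> (\<And>p. p \<in> P \<Longrightarrow> g p \<le> h p) \<Longrightarrow> pdom g"
  unfolding dominated_def by (meson of_nat_mono order.trans)

lemma pdom_add:
  assumes "pdom g" "pdom h"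
  shows "pdom (\<lambda>p. g p + h p)"
proof -
  from assms obtain C k C' k' where *: "\<And>p. p \<in> P \<Longrightarrow> real (g p) \<le> real C * B p ^ k"
    "\<And>p. p \<in> P \<Longrightarrow> real (h p) \<le> real C' * B p ^ k'" unfolding dominated_def by blast
  show ?thesis
  proof (rule pdom_real)
    fix p assume p: "p \<in> P"
    have "real (g p) \<le> real C * B p ^ (k + k')"
      using *(1)[OF p] by (rule order.trans) (intro mult_left_mono power_increasing, use B[OF p] in auto)
    moreover have "real (h p) \<le> real C' * B p ^ (k + k')"
      using *(2)[OF p] by (rule order.trans) (intro mult_left_mono power_increasing, use B[OF p] in auto)
    ultimately show "real (g p + h p) \<le> real (C + C') * B p ^ (k + k')" by (simp add: algebra_simps)
  qed
qed

lemma pdom_mult: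
  assumes "pdom g" "pdom h"
  shows "pdom (\<lambda>p. g p * h p)"
proof -
  from assms obtain C k C' k' where *: "\<And>p. p \<in> P \<Longrightarrow> real (g p) \<le> real C * B p ^ k"
    "\<And>p. p \<in> P \<Longrightarrow> real (h p) \<le> real C' * B p ^ k'" unfolding dominated_def by blast
  show ?thesis
  proof (rule pdom_real)
    fix p assume p: "p \<in> P"
    have "real (g p * h p) \<le> (real C * B p ^ k) * (real C' * B p ^ k')"
      using *(1)[OF p] *(2)[OF p] B[OF p] unfolding of_nat_mult by (intro mult_mono) auto
    then show "real (g p * h p) \<le> real (C * C') * B p ^ (k + k')" by (simp add: power_add mult_ac)
  qed
qed

lemma pdom_power: "pdom g \<Longrightarrow> pdom (\<lambda>p. g p ^ k)"
  by (induction k) (auto intro: pdom_const pdom_mult)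

lemma pdom_Suc: "pdom g \<Longrightarrow> pdom (\<lambda>p. Suc (g p))"
  using pdom_add[OF _ pdom_const[of 1]] by simp

lemmas pdom_intros = pdom_add pdom_mult pdom_Suc pdom_const pdom_power

lemma floorlog_le: "floorlog 2 x \<le> x"
  by (rule floorlog_leI) (auto intro: less_exp)

lemma pdom_floorlog: "pdom g \<Longrightarrow> pdom (\<lambda>p. floorlog 2 (g p))"
  by (erule pdom_mono) (rule floorlog_le)

text \<open>The exponential of a logarithm stays polynomial: \<open>2 ^ floorlog 2 x\<close> is at
  most \<open>2 * x\<close>, and the summand 1 covers \<open>x = 0\<close>.\<close>

lemma pdom_power_floorlog:
  assumes "pdom g"
  shows "pdom (\<lambda>p. 2 ^ floorlog 2 (g p))"
proof (rule pdom_mono)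
  show "2 ^ floorlog 2 (g p) \<le> 2 * g p + 1" for p
  proof (cases "g p = 0")
    case False
    then have "2 ^ (floorlog 2 (g p) - 1) \<le> g p" "floorlog 2 (g p) \<noteq> 0"
      using floorlog_bounds[of "g p" 2] by (auto simp: floorlog_eq_zero_iff)
    then show ?thesis by (cases "floorlog 2 (g p)") auto
  qed (simp add: floorlog_def)
qed (intro pdom_intros assms)

end

context growth
begin

text \<open>Shared by the time and the space analysis. \<open>g\<close> stands for
  \<open>floorlog 2 (N + 3)\<close>, which is bounded through \<open>n powr log 2 s\<close> in the
  former and through \<open>log 2 n\<close> in the latter.\<close>

lemma pdom_sample_size:
  assumes "pdom s'" "pdom E" "pdom L" "pdom g"
    and d: "\<And>p. d p = 3 * (floorlog 2 (s' p) + floorlog 2 (E p) + 1)"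
    and X: "\<And>p. X p = L p + g p * 2 ^ Suc (d p)"
    and M: "\<And>p. M p = (E p + E p) * X p"
  shows "pdom (\<lambda>p. floorlog 2 (s' p))" "pdom d" "pdom (\<lambda>p. 2 ^ d p)" "pdom X" "pdom M"
proof -
  show R: "pdom (\<lambda>p. floorlog 2 (s' p))" using assms(1) by (rule pdom_floorlog)
  show "pdom d" unfolding d by (intro pdom_intros R pdom_floorlog assms)
  have "(2::nat) ^ d p = (2 ^ floorlog 2 (s' p) * 2 ^ floorlog 2 (E p) * 2) ^ 3" for p
    by (simp only: d mult.commute[of 3] power_mult power_add power_one_right)
  then show d2: "pdom (\<lambda>p. 2 ^ d p)"
    by (simp only:) (intro pdom_intros pdom_power_floorlog assms)
  show X': "pdom X"
    unfolding X power_Suc by (intro pdom_intros assms d2)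
  show "pdom M"
    unfolding M by (intro pdom_intros assms X')
qed

end

lemma real_nat_ceiling_le: "real (nat \<lceil>x\<rceil>) \<le> max 0 x + 1"
  by linarith

lemma real_floorlog_le: "1 \<le> x \<Longrightarrow> real (floorlog 2 x) \<le> log 2 (real x) + 1"
  by (simp add: floorlog_def)

lemma floorlog_mult_le: "floorlog 2 (a * b) \<le> floorlog 2 a + floorlog 2 b"
proof (rule floorlog_leI)
  have "x < 2 ^ floorlog 2 x" for x :: nat
    by (cases "x = 0") (use floorlog_bounds[of x 2] in auto)
  then show "a * b < 2 ^ (floorlog 2 a + floorlog 2 b)"
    unfolding power_add by (intro mult_strict_mono) auto
qed auto

section \<open>Time and memory in terms of the parameters\<close>

locale parameters =
  fixes P :: "'p set" and n s :: "'p \<Rightarrow> nat" and \<epsilon> \<delta> :: "'p \<Rightarrow> real"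
    and N s' E L R d X M A V :: "'p \<Rightarrow> nat"
  assumes valid: "p \<in> P \<Longrightarrow> 1 \<le> s p \<and> (n p = 0 \<longrightarrow> s p = 1) \<and> 0 < \<epsilon> p \<and> 0 < \<delta> p"
    and N: "\<And>p. N p = (if s p \<le> 1 \<or> n p \<le> 1 then min (n p) 1 else n p)"
    and s': "\<And>p. s' p = (if s p \<le> 1 \<or> n p \<le> 1 then 2 else s p)"
    and E: "\<And>p. E p = nat \<lceil>1 / \<epsilon> p\<rceil>"
    and L: "\<And>p. L p = nat \<lceil>log 2 (1 / \<delta> p)\<rceil>"
    and R: "\<And>p. R p = floorlog 2 (s' p)"
    and d: "\<And>p. d p = 3 * (R p + floorlog 2 (E p) + 1)"
    and X: "\<And>p. X p = L p + floorlog 2 (N p + 3) * 2 ^ Suc (d p)"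
    and M: "\<And>p. M p = (E p + E p) * X p"
    and A: "\<And>p. A p = 32 + 3 * d p + 2 ^ Suc (d p)"
    and V: "\<And>p. V p = 2 * (A p + n p + s p + s' p + E p + L p + X p + M p + R p + 10)"
begin

definition work :: "'p \<Rightarrow> real" where
  "work p = real (n p) powr log 2 (real (s p))"

definition time_base :: "'p \<Rightarrow> real" where
  "time_base p = 1 + (work p + (1 / \<epsilon> p + log_inv (\<delta> p)))"

definition space_base :: "'p \<Rightarrow> real" where
  "space_base p = 1 + (real (s p) + (log 2 (real (n p)) + (1 / \<epsilon> p + log_inv (\<delta> p))))"

text \<open>At \<open>n p = 0\<close> this uses the default value
  \<open>log 2 0 = 0\<close>.\<close>

lemma log_n: "0 \<le> log 2 (real (n p))"
  by (cases "n p = 0") (auto simp: log_def)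

lemma parts:
  assumes "p \<in> P"
  shows "0 \<le> work p" "0 \<le> 1 / \<epsilon> p" "0 \<le> log_inv (\<delta> p)" "real (E p) \<le> 1 / \<epsilon> p + 1" "real (L p) \<le> log_inv (\<delta> p) + 1"
proof -
  show "0 \<le> 1 / \<epsilon> p" using valid[OF assms] by simp
  then show "real (E p) \<le> 1 / \<epsilon> p + 1" unfolding E using real_nat_ceiling_le[of "1 / \<epsilon> p"] by simp
  show "real (L p) \<le> log_inv (\<delta> p) + 1" unfolding L log_inv_def by (rule real_nat_ceiling_le)
qed (auto simp: work_def log_inv_def)

text \<open>For \<open>n\<close> and \<open>s\<close> at least 2, \<open>n powr log 2 s\<close>
  dominates both. As \<open>R\<close> is at most \<open>1 + log 2 s\<close>, \<open>n ^ R\<close> is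
  at most \<open>work p ^ 2\<close>, and \<open>4 * n + 3 \<le> n ^ 4\<close> raises the exponent to
  8.\<close>

lemma large:
  assumes "p \<in> P" "\<not> (s p \<le> 1 \<or> n p \<le> 1)"
  shows "real (s p) \<le> work p" "real (n p) \<le> work p" "real ((4 * n p + 3) ^ R p) \<le> work p ^ 8"
proof -
  have n: "2 \<le> n p" and s: "2 \<le> s p" using assms(2) by auto
  have log: "1 \<le> log 2 (real (s p))" using s by (simp add: le_log_iff)
  have "real (s p) = 2 powr log 2 (real (s p))" using s by simp
  also have "\<dots> \<le> work p" unfolding work_def using n log by (intro powr_mono2) auto
  finally show "real (s p) \<le> work p" .
  have "real (n p) = real (n p) powr 1" using n by simp
  also have "\<dots> \<le> work p" unfolding work_def using n log by (intro powr_mono) auto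
  finally show nw: "real (n p) \<le> work p" .
  have "real (R p) \<le> 1 + log 2 (real (s p))"
    using real_floorlog_le[of "s p"] assms(2) s by (simp add: R s')
  then have "real (n p) ^ R p \<le> real (n p) powr (1 + log 2 (real (s p)))"
    using n by (subst powr_realpow[symmetric]) (auto intro!: powr_mono)
  also have "\<dots> = real (n p) * work p" using n by (simp add: powr_add work_def)
  also have "\<dots> \<le> work p * work p" using nw by (intro mult_right_mono) (auto simp: work_def)
  finally have nR: "real (n p) ^ R p \<le> work p ^ 2" by (simp add: power2_eq_square)
  have "4 * n p + 3 \<le> 8 * n p" using n by simp
  also have "\<dots> \<le> n p ^ 3 * n p"
    using power_mono[OF n, of 3] by (intro mult_le_mono1) simp
  finally have "4 * n p + 3 \<le> n p ^ 4" by (simp add: power_numeral_reduce mult_ac)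
  then have "(4 * n p + 3) ^ R p \<le> (n p ^ 4) ^ R p" by (rule power_mono) simp
  then have "real ((4 * n p + 3) ^ R p) \<le> real ((n p ^ 4) ^ R p)" by (rule of_nat_mono)
  also have "\<dots> = (real (n p) ^ R p) ^ 4" by (simp add: power_mult[symmetric] mult.commute)
  also have "\<dots> \<le> (work p ^ 2) ^ 4" using nR by (rule power_mono) simp
  finally show "real ((4 * n p + 3) ^ R p) \<le> work p ^ 8" by (simp add: power_mult[symmetric])
qed

sublocale time: growth P time_base
  by unfold_locales (use parts in \<open>simp add: time_base_def add_nonneg_nonneg\<close>)

sublocale space: growth P space_base
  by unfold_locales (use parts log_n in \<open>simp add: space_base_def add_nonneg_nonneg\<close>)

lemma time_dominated: "time.pdom (\<lambda>p. total_time (N p) (R p) (E p) (d p) (M p))"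
proof -
  have B: "work p \<le> time_base p" "1 / \<epsilon> p \<le> time_base p" "log_inv (\<delta> p) \<le> time_base p" "1 \<le> time_base p"
    if "p \<in> P" for p
    using parts[OF that] by (auto simp: time_base_def)
  have N': "time.pdom N"
  proof (rule time.pdom_real)
    fix p assume p: "p \<in> P"
    show "real (N p) \<le> real 1 * time_base p ^ 1"
      using B[OF p] large(2)[OF p] by (auto simp: N)
  qed
  have s'': "time.pdom s'"
  proof (rule time.pdom_real)
    fix p assume p: "p \<in> P"
    show "real (s' p) \<le> real 2 * time_base p ^ 1"
      using B[OF p] large(1)[OF p] by (auto simp: s')
  qed
  have E': "time.pdom E"
  proof (rule time.pdom_real)
    fix p assume p: "p \<in> P"
    show "real (E p) \<le> real 2 * time_base p ^ 1"
      using B[OF p] parts(4)[OF p] by simp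
  qed
  have L': "time.pdom L"
  proof (rule time.pdom_real)
    fix p assume p: "p \<in> P"
    show "real (L p) \<le> real 2 * time_base p ^ 1"
      using B[OF p] parts(5)[OF p] by simp
  qed
  have NR: "time.pdom (\<lambda>p. (4 * N p + 3) ^ R p)"
  proof (rule time.pdom_real)
    fix p assume p: "p \<in> P"
    have "1 \<le> time_base p ^ 8" using B(4)[OF p] by simp
    moreover have "work p ^ 8 \<le> time_base p ^ 8" using B(1)[OF p] parts(1)[OF p] by (rule power_mono)
    \<comment> \<open>Clamped parameters have \<open>N p \<le> 1\<close> and \<open>R p = 2\<close>,
      so the power is at most \<open>7 ^ 2 = 49\<close>.\<close>
    moreover have "real ((4 * N p + 3) ^ R p) \<le> 49" if "s p \<le> 1 \<or> n p \<le> 1"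
    proof -
      have "R p = 2" using that by (simp add: R s' compute_floorlog)
      moreover have "4 * N p + 3 \<le> 7" using that by (auto simp: N)
      ultimately have "(4 * N p + 3) ^ R p \<le> 7 ^ 2" by (simp only:) (intro power_mono, auto)
      from of_nat_mono[OF this, where 'a = real] show ?thesis by simp
    qed
    ultimately show "real ((4 * N p + 3) ^ R p) \<le> real 49 * time_base p ^ 8"
      using large(3)[OF p] by (cases "s p \<le> 1 \<or> n p \<le> 1") (auto simp: N)
  qed
  note g = time.pdom_floorlog[OF time.pdom_add[OF N' time.pdom_const[of 3]]]
  note facts = time.pdom_sample_size[OF s'' E' L' g d[unfolded R] X M]
  show ?thesis
    unfolding total_time_def setup_time_def loop_time_def power_Suc R
    by (intro time.pdom_intros facts NR[unfolded R] time.pdom_floorlog N' E')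
qed

lemma space_dominated:
  "space.pdom M" "space.pdom (\<lambda>p. A p * (floorlog 2 (A p) + floorlog 2 (V p)))"
proof -
  have B: "real (s p) \<le> space_base p" "log 2 (real (n p)) \<le> space_base p" "1 / \<epsilon> p \<le> space_base p"
      "log_inv (\<delta> p) \<le> space_base p" "1 \<le> space_base p"
    if "p \<in> P" for p
    using parts[OF that] log_n[of p] by (auto simp: space_base_def)
  have s: "space.pdom s"
  proof (rule space.pdom_real)
    fix p assume p: "p \<in> P"
    show "real (s p) \<le> real 1 * space_base p ^ 1" using B[OF p] by simp
  qed
  have s'': "space.pdom s'"
    by (rule space.pdom_mono[OF space.pdom_add[OF s space.pdom_const[of 2]]]) (auto simp: s')
  have E': "space.pdom E"
  proof (rule space.pdom_real)
    fix p assume p: "p \<in> P"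
    show "real (E p) \<le> real 2 * space_base p ^ 1"
      using B[OF p] parts(4)[OF p] by simp
  qed
  have L': "space.pdom L"
  proof (rule space.pdom_real)
    fix p assume p: "p \<in> P"
    show "real (L p) \<le> real 2 * space_base p ^ 1"
      using B[OF p] parts(5)[OF p] by simp
  qed
  have gn: "space.pdom (\<lambda>p. floorlog 2 (n p + 3))"
  proof (rule space.pdom_real)
    fix p assume p: "p \<in> P"
    have "real (floorlog 2 (n p + 3)) \<le> log 2 (real (n p)) + 3"
    proof (cases "n p = 0")
      case True
      have "floorlog 2 3 = 2" by (simp add: compute_floorlog)
      with True show ?thesis by (simp add: log_def)
    next
      case False
      then have "log 2 (real (n p + 3)) \<le> log 2 (4 * real (n p))" by simp
      also have "\<dots> = 2 + log 2 (real (n p))"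
        using False log_nat_power[of 2 2 2] by (simp add: log_mult)
      finally show ?thesis using real_floorlog_le[of "n p + 3"] by simp
    qed
    then show "real (floorlog 2 (n p + 3)) \<le> real 4 * space_base p ^ 1" using B[OF p] by simp
  qed
  then have g: "space.pdom (\<lambda>p. floorlog 2 (N p + 3))"
    by (rule space.pdom_mono) (auto simp: N intro!: floorlog_mono)
  note facts = space.pdom_sample_size[OF s'' E' L' g d[unfolded R] X M]
  show "space.pdom M" by (rule facts)
  have A': "space.pdom A" unfolding A power_Suc by (intro space.pdom_intros facts)
  \<comment> \<open>The space bound allows only \<open>log n\<close>, while \<open>V\<close>
    contains \<open>n\<close> itself. Splitting off a factor \<open>n + 3\<close> isolates it, and
    \<open>floorlog\<close> turns the product into a sum.\<close>
  let ?V = "\<lambda>p. 2 * (A p + s p + s' p + E p + L p + X p + M p + R p + 10)"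
  have V': "space.pdom ?V" unfolding R by (intro space.pdom_intros A' s s'' E' L' facts)
  have "floorlog 2 (V p) \<le> floorlog 2 (n p + 3) + floorlog 2 (?V p)" for p
  proof -
    have "V p \<le> (n p + 3) * ?V p" by (simp add: V algebra_simps)
    then have "floorlog 2 (V p) \<le> floorlog 2 ((n p + 3) * ?V p)" by (rule floorlog_mono)
    also have "\<dots> \<le> floorlog 2 (n p + 3) + floorlog 2 (?V p)" by (rule floorlog_mult_le)
    finally show ?thesis .
  qed
  then have V'': "space.pdom (\<lambda>p. floorlog 2 (V p))"
    by (intro space.pdom_mono[OF space.pdom_add[OF gn space.pdom_floorlog[OF V']]])
  show "space.pdom (\<lambda>p. A p * (floorlog 2 (A p) + floorlog 2 (V p)))"
    by (rule space.pdom_mult[OF A' space.pdom_add[OF space.pdom_floorlog[OF A'] V'']])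
qed

end

lemma poly_bound_mono:
  assumes "real x \<le> real C * (1 + sum_list xs) ^ k" "C \<le> C'" "k \<le> k'" "0 \<le> sum_list xs"
  shows "real x \<le> poly_bound C' k' xs"
proof -
  have "real C * (1 + sum_list xs) ^ k \<le> real C' * (1 + sum_list xs) ^ k'"
    using assms by (intro mult_mono power_increasing) auto
  with assms(1) show ?thesis by (simp add: poly_bound_def)
qed

theorem theorem9p11:
  shows "\<exists>(P :: prog) (C :: nat) (k :: nat).
    \<forall>(n :: nat) (s :: nat) (f :: bool list \<Rightarrow> int) (\<epsilon> :: real) (\<delta> :: real).
      (\<forall>x\<in>cube n. f x \<in> {-1, 1}) \<longrightarrow> computable_by_size n f s \<longrightarrow> \<epsilon> > 0 \<longrightarrow> \<delta> > 0 \<longrightarrow>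
      (\<exists>t. real t \<le> poly_bound C k [real n powr log 2 (real s), 1 / \<epsilon>, log_inv \<delta>] \<and>
           (\<forall>c \<in> set_pmf (run_for P n s \<epsilon> \<delta> f t). halted c) \<and>
           measure_pmf.prob (run_for P n s \<epsilon> \<delta> f t)
             {c. \<exists>T. returns n c T \<and> approximates n \<epsilon> T f} \<ge> 1 - \<delta>) \<and>
      (\<forall>t. \<forall>c \<in> set_pmf (run_for P n s \<epsilon> \<delta> f t).
           real (memory_used c) \<le> poly_bound C k [real s, log 2 (real n), 1 / \<epsilon>, log_inv \<delta>] \<and>
           real (samples_used c) \<le> poly_bound C k [real s, log 2 (real n), 1 / \<epsilon>, log_inv \<delta>])"
proof -
  define Q :: "(nat \<times> nat \<times> real \<times> real) set" where
    "Q = {(n, s, \<epsilon>, \<delta>). 1 \<le> s \<and> (n = 0 \<longrightarrow> s = 1) \<and> 0 < \<epsilon> \<and> 0 < \<delta>}"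
  define n where "n p = fst p" for p :: "nat \<times> nat \<times> real \<times> real"
  define s where "s p = fst (snd p)" for p :: "nat \<times> nat \<times> real \<times> real"
  define \<epsilon> where "\<epsilon> p = fst (snd (snd p))" for p :: "nat \<times> nat \<times> real \<times> real"
  define \<delta> where "\<delta> p = snd (snd (snd p))" for p :: "nat \<times> nat \<times> real \<times> real"
  define N where "N p = (if s p \<le> 1 \<or> n p \<le> 1 then min (n p) 1 else n p)" for p
  define s' where "s' p = (if s p \<le> 1 \<or> n p \<le> 1 then 2 else s p)" for p
  define E where "E p = nat \<lceil>1 / \<epsilon> p\<rceil>" for p
  define L where "L p = nat \<lceil>log 2 (1 / \<delta> p)\<rceil>" for p
  define R where "R p = floorlog 2 (s' p)" for p
  define d where "d p = 3 * (R p + floorlog 2 (E p) + 1)" for p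
  define X where "X p = L p + floorlog 2 (N p + 3) * 2 ^ Suc (d p)" for p
  define M where "M p = (E p + E p) * X p" for p
  define A where "A p = 32 + 3 * d p + 2 ^ Suc (d p)" for p
  define V where "V p = 2 * (A p + n p + s p + s' p + E p + L p + X p + M p + R p + 10)" for p
  interpret parameters Q n s \<epsilon> \<delta> N s' E L R d X M A V
    by unfold_locales
       (auto simp: Q_def n_def s_def \<epsilon>_def \<delta>_def N_def s'_def E_def L_def R_def d_def X_def M_def A_def V_def)
  obtain C1 k1 where 1: "\<And>p. p \<in> Q \<Longrightarrow>
      real (total_time (N p) (R p) (E p) (d p) (M p)) \<le> real C1 * time_base p ^ k1"
    using time_dominated unfolding dominated_def by blast
  obtain C2 k2 where 2: "\<And>p. p \<in> Q \<Longrightarrow>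
      real (A p * (floorlog 2 (A p) + floorlog 2 (V p))) \<le> real C2 * space_base p ^ k2"
    using space_dominated(2) unfolding dominated_def by blast
  obtain C3 k3 where 3: "\<And>p. p \<in> Q \<Longrightarrow> real (M p) \<le> real C3 * space_base p ^ k3"
    using space_dominated(1) unfolding dominated_def by blast
  show ?thesis
  \<comment> \<open>One constant and one exponent must serve time, memory and samples at once, hence
    the sums.\<close>
  proof (rule exI[of _ learner], rule exI[of _ "C1 + C2 + C3"], rule exI[of _ "k1 + k2 + k3"], intro allI impI)
    fix n' sz :: nat and f :: "bool list \<Rightarrow> int" and eps del :: real
    assume f: "\<forall>x\<in>cube n'. f x \<in> {-1, 1}" and comp: "computable_by_size n' f sz" and pos: "eps > 0" "del > 0"
    define p where "p = (n', sz, eps, del)"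
    have p: "n p = n'" "s p = sz" "\<epsilon> p = eps" "\<delta> p = del"
      by (simp_all add: p_def n_def s_def \<epsilon>_def \<delta>_def)
    from comp obtain T where T: "dtree_on n' T" "leaves T = sz" by (auto simp: computable_by_size_def)
    have "1 \<le> leaves T" by (induction T) auto
    moreover have "leaves T = 1" if "n' = 0" using T(1) that by (cases T) auto
    ultimately have pQ: "p \<in> Q" using T pos by (auto simp: Q_def p_def)
    interpret setting "random_sample n' f" "A p" "V p" "M p" n' sz "N p" "s' p" "E p" "L p" "R p" "d p" "2 ^ Suc (d p)" "X p"
      by unfold_locales (simp_all add: A_def V_def N_def s'_def R_def d_def X_def M_def p)
    note correct = learner_correct[OF refl comp f pos E_def[of p, unfolded p] L_def[of p, unfolded p]]
    have tb: "time_base p = 1 + sum_list [real n' powr log 2 (real sz), 1 / eps, log_inv del]"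
      and sb: "space_base p = 1 + sum_list [real sz, log 2 (real n'), 1 / eps, log_inv del]"
      by (simp_all add: time_base_def work_def space_base_def p)
    have t0: "0 \<le> sum_list [real n' powr log 2 (real sz), 1 / eps, log_inv del]"
      and s0: "0 \<le> sum_list [real sz, log 2 (real n'), 1 / eps, log_inv del]"
      using time.B[OF pQ] space.B[OF pQ] unfolding tb sb by simp_all
    let ?C = "C1 + C2 + C3" and ?k = "k1 + k2 + k3"
    have time: "real (total_time (N p) (R p) (E p) (d p) (M p)) \<le>
        poly_bound ?C ?k [real n' powr log 2 (real sz), 1 / eps, log_inv del]"
      using 1[OF pQ] unfolding tb by (rule poly_bound_mono) (use t0 in auto)
    have mem: "real (A p * (floorlog 2 (A p) + floorlog 2 (V p))) \<le>
        poly_bound ?C ?k [real sz, log 2 (real n'), 1 / eps, log_inv del]"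
      using 2[OF pQ] unfolding sb by (rule poly_bound_mono) (use s0 in auto)
    have sam: "real (M p) \<le> poly_bound ?C ?k [real sz, log 2 (real n'), 1 / eps, log_inv del]"
      using 3[OF pQ] unfolding sb by (rule poly_bound_mono) (use s0 in auto)
    show "(\<exists>t. real t \<le> poly_bound ?C ?k [real n' powr log 2 (real sz), 1 / eps, log_inv del] \<and>
           (\<forall>c \<in> set_pmf (run_for learner n' sz eps del f t). halted c) \<and>
           measure_pmf.prob (run_for learner n' sz eps del f t)
             {c. \<exists>T. returns n' c T \<and> approximates n' eps T f} \<ge> 1 - del) \<and>
      (\<forall>t. \<forall>c \<in> set_pmf (run_for learner n' sz eps del f t).
           real (memory_used c) \<le> poly_bound ?C ?k [real sz, log 2 (real n'), 1 / eps, log_inv del] \<and>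
           real (samples_used c) \<le> poly_bound ?C ?k [real sz, log 2 (real n'), 1 / eps, log_inv del])"
    proof (intro conjI allI ballI)
      show "\<exists>t. real t \<le> poly_bound ?C ?k [real n' powr log 2 (real sz), 1 / eps, log_inv del] \<and>
           (\<forall>c \<in> set_pmf (run_for learner n' sz eps del f t). halted c) \<and>
           measure_pmf.prob (run_for learner n' sz eps del f t)
             {c. \<exists>T. returns n' c T \<and> approximates n' eps T f} \<ge> 1 - del"
        using time correct(1,2) by blast
    next
      fix t c assume c: "c \<in> set_pmf (run_for learner n' sz eps del f t)"
      show "real (memory_used c) \<le> poly_bound ?C ?k [real sz, log 2 (real n'), 1 / eps, log_inv del]"
        using correct(3)[OF c] by (intro order.trans[OF of_nat_mono mem]) auto
      show "real (samples_used c) \<le> poly_bound ?C ?k [real sz, log 2 (real n'), 1 / eps, log_inv del]"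
        using correct(3)[OF c] by (intro order.trans[OF of_nat_mono sam]) auto
    qed
  qed
qed

end
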